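(* Suppose that there is $p_0\in[2,\infty)$ so that $\mathcal A_{p_0}(T',\hat t)\subset\mathcal A_\infty(T',\hat t)$ for all $0<\hat t<T'<\infty$. Let $T\in(0,\infty)$. Then for each $y_T\in\mathcal R_T^0\setminus\{0\}$ there is $f^*\in Y_T\setminus\{0\}$ so that each minimal norm control $v^*$ to $(NP)^{y_T}$ verifies $$\langle v^*(t),f^*(t)\rangle_U=\max_{\|w\|_U\le\|y_T\|_{\mathcal R_T}}\langle w,f^*(t)\rangle_U\quad\text{for a.e. }t\in(0,T).$$
   Context: Setting. $\mathbb R^+=[0,\infty)$. $X$ and $U$ are real Hilbert spaces. $A:D(A)\subset X\to X$ generates a $C_0$-semigroup $\{S(t)\}_{t\ge 0}$ on $X$; $S^*(t)$ is the adjoint semigroup, generated by $A^*$. $X_{-1}=D(A^* )'$ is the dual of $D(A^* )$ with respect to the pivot space $X$, and $S_{-1}(t)$ is the extension of $S(t)$ to $X_{-1}$. $B\in\mathcal L(U,X_{-1})$, $B\ne 0$, is an admissible control operator: for each $\hat t\in(0,\infty)$ there is $C(\hat t)>0$ with $\|\int_0^{\hat t}S_{-1}(\hat t-\tau)Bu(\tau)\,d\tau\|_X\le C(\hat t)\|u\|_{L^2(0,\hat t;U)}$ for all $u\in L^2_{loc}(\mathbb R^+;U)$. $B^*\in\mathcal L(D(A^* ),U)$ is its adjoint. For $y_0\in X$, $T\in(0,\infty)$, $v\in L^2(0,T;U)$, put $\hat y(t;y_0,v)=S(t)y_0+\int_0^tS_{-1}(t-\tau)Bv(\tau)\,d\tau$,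 $t\in[0,T]$. Definitions. $\mathcal A_{p_0}(T,\hat t)=\{\hat y(T;0,u):u\in L^{p_0}(0,T;U),\ u|_{(\hat t,T)}=0\}$; $\mathcal A_\infty(T,\hat t)=\{\hat y(T;0,v):v\in L^\infty(0,T;U),\ v|_{(0,\hat t)}=0\}$. $\mathcal R_T=\{\hat y(T;0,v):v\in L^\infty(0,T;U)\}$; for $y_T\in\mathcal R_T$, the problem $(NP)^{y_T}$ is $\|y_T\|_{\mathcal R_T}=\inf\{\|v\|_{L^\infty(0,T;U)}:\hat y(T;0,v)=y_T\}$; an admissible control is $v\in L^\infty(0,T;U)$ with $\hat y(T;0,v)=y_T$, and a minimal norm control is an admissible control $v^*$ with $\|v^*\|_{L^\infty(0,T;U)}=\|y_T\|_{\mathcal R_T}$. $\mathcal R_T^0=\{\hat y(T;0,v):v\in L^\infty(0,T;U),\ \lim_{s\to T}\|v\|_{L^\infty(s,T;U)}=0\}$. $Y_T$ is the closure in $L^1(0,T;U)$ (with the $L^1(0,T;U)$-norm) of $X_T=\{B^*S^*(T-\cdot)z|_{(0,T)}:z\in D(A^* )\}$. *)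

theory Defs
  imports "HOL-Analysis.Analysis" "HOL-Probability.Essential_Supremum"
begin

text \<open>
  Neither Hilbert space is assumed separable, whereas the Bochner integral of the library requires
  second countable codomains. Strong measurability, the spaces \<open>L\<^sup>p(a,b;U)\<close> and the Bochner integral
  in \<open>X\<^sub>-\<^sub>1\<close> are therefore built directly on \<^const>\<open>simple_function\<close>. Elements of \<open>L\<^sup>p\<close> are
  represented by functions on the whole line, of which only the values on the open interval
  matter, and these only almost everywhere.
\<close>

subsection \<open>Lebesgue spaces of vector-valued functions\<close>

abbreviation leb :: "real \<Rightarrow> real \<Rightarrow> real measure" where
  "leb a b \<equiv> lebesgue_on {a<..<b}"

definition strongly_measurable :: "'a measure \<Rightarrow> ('a \<Rightarrow> 'b::real_normed_vector) \<Rightarrow> bool" where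
  "strongly_measurable M f \<longleftrightarrow>
     (\<exists>s. (\<forall>n::nat. simple_function M (s n)) \<and> (AE t in M. (\<lambda>n. s n t) \<longlonglongrightarrow> f t))"

definition Lp :: "real \<Rightarrow> real \<Rightarrow> real \<Rightarrow> (real \<Rightarrow> 'b::real_normed_vector) set" where
  "Lp p a b = {f. strongly_measurable (leb a b) f \<and> integrable (leb a b) (\<lambda>t. norm (f t) powr p)}"

definition Lp_norm :: "real \<Rightarrow> real \<Rightarrow> real \<Rightarrow> (real \<Rightarrow> 'b::real_normed_vector) \<Rightarrow> real" where
  "Lp_norm p a b f = (integral\<^sup>L (leb a b) (\<lambda>t. norm (f t) powr p)) powr (1 / p)"

definition Linf :: "real \<Rightarrow> real \<Rightarrow> (real \<Rightarrow> 'b::real_normed_vector) set" where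
  "Linf a b = {f. strongly_measurable (leb a b) f \<and> esssup (leb a b) (\<lambda>t. ereal (norm (f t))) < \<infinity>}"

definition Linf_norm :: "real \<Rightarrow> real \<Rightarrow> (real \<Rightarrow> 'b::real_normed_vector) \<Rightarrow> real" where
  "Linf_norm a b f = real_of_ereal (esssup (leb a b) (\<lambda>t. ereal (norm (f t))))"

definition L2_loc :: "(real \<Rightarrow> 'b::real_normed_vector) set" where
  "L2_loc = {f. \<forall>b>0. f \<in> Lp 2 0 b}"

subsection \<open>Semigroups, generators and adjoints\<close>

definition C0_semigroup :: "(real \<Rightarrow> 'x::real_normed_vector \<Rightarrow> 'x) \<Rightarrow> bool" where
  "C0_semigroup S \<longleftrightarrow>
     (\<forall>t\<ge>0. bounded_linear (S t)) \<and> S 0 = id \<and> (\<forall>s\<ge>0. \<forall>t\<ge>0. S (s + t) = S s \<circ> S t) \<and>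
     (\<forall>x. ((\<lambda>t. S t x) \<longlongrightarrow> x) (at_right 0))"

text \<open>An unbounded operator is given by its domain \<open>D\<close> and a function \<open>A\<close> that matters only on \<open>D\<close>.\<close>

definition generates ::
    "'x::real_normed_vector set \<Rightarrow> ('x \<Rightarrow> 'x) \<Rightarrow> (real \<Rightarrow> 'x \<Rightarrow> 'x) \<Rightarrow> bool" where
  "generates D A S \<longleftrightarrow> C0_semigroup S \<and>
     D = {x. \<exists>y. ((\<lambda>h. (1 / h) *\<^sub>R (S h x - x)) \<longlongrightarrow> y) (at_right 0)} \<and>
     (\<forall>x\<in>D. ((\<lambda>h. (1 / h) *\<^sub>R (S h x - x)) \<longlongrightarrow> A x) (at_right 0))"

definition adj_dom :: "'x::real_inner set \<Rightarrow> ('x \<Rightarrow> 'x) \<Rightarrow> 'x set" where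
  "adj_dom D A = {z. \<exists>w. \<forall>x\<in>D. A x \<bullet> z = x \<bullet> w}"

definition adj_op :: "'x::real_inner set \<Rightarrow> ('x \<Rightarrow> 'x) \<Rightarrow> 'x \<Rightarrow> 'x" where
  "adj_op D A z = (THE w. \<forall>x\<in>D. A x \<bullet> z = x \<bullet> w)"

definition graph_norm :: "'x::real_inner set \<Rightarrow> ('x \<Rightarrow> 'x) \<Rightarrow> 'x \<Rightarrow> real" where
  "graph_norm D A z = sqrt ((norm z)\<^sup>2 + (norm (adj_op D A z))\<^sup>2)"

definition adj_semigroup :: "(real \<Rightarrow> 'x::real_inner \<Rightarrow> 'x) \<Rightarrow> real \<Rightarrow> 'x \<Rightarrow> 'x" where
  "adj_semigroup S t = adjoint (S t)"

subsection \<open>The extrapolation space\<close>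

text \<open>
  \<open>X\<^sub>-\<^sub>1\<close> consists of the linear functionals on \<open>D(A\<^sup>*)\<close> that are bounded for the graph norm. To make
  equality of functionals equality of functions, they are set to \<open>0\<close> outside \<open>D(A\<^sup>*)\<close>. The
  pivot embedding sends \<open>x\<close> to \<open>z \<mapsto> \<langle>x,z\<rangle>\<close>.
\<close>

definition Xm1 :: "'x::real_inner set \<Rightarrow> ('x \<Rightarrow> 'x) \<Rightarrow> ('x \<Rightarrow> real) set" where
  "Xm1 D A = {\<phi>.
     (\<forall>z. z \<notin> adj_dom D A \<longrightarrow> \<phi> z = 0) \<and>
     (\<forall>z\<in>adj_dom D A. \<forall>w\<in>adj_dom D A. \<forall>a b. \<phi> (a *\<^sub>R z + b *\<^sub>R w) = a * \<phi> z + b * \<phi> w) \<and>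
     (\<exists>C. \<forall>z\<in>adj_dom D A. \<bar>\<phi> z\<bar> \<le> C * graph_norm D A z)}"

definition norm_Xm1 :: "'x::real_inner set \<Rightarrow> ('x \<Rightarrow> 'x) \<Rightarrow> ('x \<Rightarrow> real) \<Rightarrow> real" where
  "norm_Xm1 D A \<phi> = (SUP z\<in>{z \<in> adj_dom D A. graph_norm D A z \<le> 1}. \<bar>\<phi> z\<bar>)"

definition emb :: "'x::real_inner set \<Rightarrow> ('x \<Rightarrow> 'x) \<Rightarrow> 'x \<Rightarrow> 'x \<Rightarrow> real" where
  "emb D A x = (\<lambda>z. if z \<in> adj_dom D A then x \<bullet> z else 0)"

definition bounded_linear_Xm1 ::
    "'x::real_inner set \<Rightarrow> ('x \<Rightarrow> 'x) \<Rightarrow> (('x \<Rightarrow> real) \<Rightarrow> ('x \<Rightarrow> real)) \<Rightarrow> bool" where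
  "bounded_linear_Xm1 D A F \<longleftrightarrow>
     (\<forall>\<phi>\<in>Xm1 D A. F \<phi> \<in> Xm1 D A) \<and>
     (\<forall>\<phi>\<in>Xm1 D A. \<forall>\<psi>\<in>Xm1 D A. \<forall>a b.
        F (\<lambda>z. a * \<phi> z + b * \<psi> z) = (\<lambda>z. a * F \<phi> z + b * F \<psi> z)) \<and>
     (\<exists>C. \<forall>\<phi>\<in>Xm1 D A. norm_Xm1 D A (F \<phi>) \<le> C * norm_Xm1 D A \<phi>)"

text \<open>
  \<open>S\<^sub>-\<^sub>1(t)\<close> is the bounded extension of \<open>S(t)\<close>. It is unique because \<open>X\<close> is dense in \<open>X\<^sub>-\<^sub>1\<close>; membership
  in \<^const>\<open>extensional\<close> only pins down the irrelevant values outside \<open>X\<^sub>-\<^sub>1\<close>.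
\<close>

definition S_m1 :: "'x::real_inner set \<Rightarrow> ('x \<Rightarrow> 'x) \<Rightarrow> (real \<Rightarrow> 'x \<Rightarrow> 'x) \<Rightarrow>
    real \<Rightarrow> ('x \<Rightarrow> real) \<Rightarrow> ('x \<Rightarrow> real)" where
  "S_m1 D A S t = (THE F. F \<in> extensional (Xm1 D A) \<and> bounded_linear_Xm1 D A F \<and>
     (\<forall>x. F (emb D A x) = emb D A (S t x)))"

text \<open>
  The Bochner integral over \<open>(0,t)\<close> in the normed space \<open>X\<^sub>-\<^sub>1\<close>: \<open>F\<close> is an almost everywhere limit of
  \<open>X\<^sub>-\<^sub>1\<close>-valued simple functions that also approximate it in \<open>L\<^sup>1\<close>, and \<open>I\<close> is the limit of
  their integrals.
\<close>

definition simple_integral_Xm1 :: "real \<Rightarrow> (real \<Rightarrow> 'x \<Rightarrow> real) \<Rightarrow> 'x \<Rightarrow> real" where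
  "simple_integral_Xm1 t s =
     (\<lambda>z. \<Sum>\<phi>\<in>s ` {0<..<t}. measure (leb 0 t) {\<tau> \<in> {0<..<t}. s \<tau> = \<phi>} * \<phi> z)"

definition has_integral_Xm1 :: "'x::real_inner set \<Rightarrow> ('x \<Rightarrow> 'x) \<Rightarrow>
    real \<Rightarrow> (real \<Rightarrow> 'x \<Rightarrow> real) \<Rightarrow> ('x \<Rightarrow> real) \<Rightarrow> bool" where
  "has_integral_Xm1 D A t F I \<longleftrightarrow>
     (\<forall>\<tau>\<in>{0<..<t}. F \<tau> \<in> Xm1 D A) \<and> I \<in> Xm1 D A \<and>
     (\<exists>s. (\<forall>n::nat. simple_function (leb 0 t) (s n) \<and> (\<forall>\<tau>\<in>{0<..<t}. s n \<tau> \<in> Xm1 D A)) \<and>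
        (AE \<tau> in leb 0 t. (\<lambda>n. norm_Xm1 D A (\<lambda>z. F \<tau> z - s n \<tau> z)) \<longlonglongrightarrow> 0) \<and>
        (\<lambda>n. \<integral>\<^sup>+\<tau>. ennreal (norm_Xm1 D A (\<lambda>z. F \<tau> z - s n \<tau> z)) \<partial>leb 0 t) \<longlonglongrightarrow> 0 \<and>
        (\<lambda>n. norm_Xm1 D A (\<lambda>z. simple_integral_Xm1 t (s n) z - I z)) \<longlonglongrightarrow> 0)"

subsection \<open>Control operators and reachable sets\<close>

definition control_operator :: "'x::real_inner set \<Rightarrow> ('x \<Rightarrow> 'x) \<Rightarrow>
    ('u::real_inner \<Rightarrow> 'x \<Rightarrow> real) \<Rightarrow> bool" where
  "control_operator D A B \<longleftrightarrow>
     (\<forall>u. B u \<in> Xm1 D A) \<and>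
     (\<forall>u v a b. B (a *\<^sub>R u + b *\<^sub>R v) = (\<lambda>z. a * B u z + b * B v z)) \<and>
     (\<exists>C. \<forall>u. norm_Xm1 D A (B u) \<le> C * norm u)"

text \<open>\<open>B\<^sup>*z\<close> for \<open>z \<in> D(A\<^sup>*)\<close> is the vector representing the bounded functional \<open>u \<mapsto> \<langle>Bu,z\<rangle>\<close> on \<open>U\<close>.\<close>

definition adj_control :: "('u::real_inner \<Rightarrow> 'x \<Rightarrow> real) \<Rightarrow> 'x \<Rightarrow> 'u" where
  "adj_control B z = (THE w. \<forall>u. u \<bullet> w = B u z)"

text \<open>
  The \<open>X\<close>-norm of the integral only makes sense when the integral, taken in \<open>X\<^sub>-\<^sub>1\<close>, lies in \<open>X\<close>; this
  is part of admissibility.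
\<close>

definition admissible :: "'x::real_inner set \<Rightarrow> ('x \<Rightarrow> 'x) \<Rightarrow> (real \<Rightarrow> 'x \<Rightarrow> 'x) \<Rightarrow>
    ('u::real_inner \<Rightarrow> 'x \<Rightarrow> real) \<Rightarrow> bool" where
  "admissible D A S B \<longleftrightarrow> (\<forall>t>0. \<exists>C>0. \<forall>u\<in>L2_loc. \<exists>x.
     has_integral_Xm1 D A t (\<lambda>\<tau>. S_m1 D A S (t - \<tau>) (B (u \<tau>))) (emb D A x) \<and>
     norm x \<le> C * Lp_norm 2 0 t u)"

definition yhat :: "'x::real_inner set \<Rightarrow> ('x \<Rightarrow> 'x) \<Rightarrow> (real \<Rightarrow> 'x \<Rightarrow> 'x) \<Rightarrow>
    ('u::real_inner \<Rightarrow> 'x \<Rightarrow> real) \<Rightarrow> real \<Rightarrow> 'x \<Rightarrow> (real \<Rightarrow> 'u) \<Rightarrow> 'x" where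
  "yhat D A S B t y0 v = S t y0 +
     (THE x. has_integral_Xm1 D A t (\<lambda>\<tau>. S_m1 D A S (t - \<tau>) (B (v \<tau>))) (emb D A x))"

definition A_p :: "'x::real_inner set \<Rightarrow> ('x \<Rightarrow> 'x) \<Rightarrow> (real \<Rightarrow> 'x \<Rightarrow> 'x) \<Rightarrow>
    ('u::real_inner \<Rightarrow> 'x \<Rightarrow> real) \<Rightarrow> real \<Rightarrow> real \<Rightarrow> real \<Rightarrow> 'x set" where
  "A_p D A S B p T th = {yhat D A S B T 0 u | u. u \<in> Lp p 0 T \<and> (AE t in leb th T. u t = 0)}"

definition A_inf :: "'x::real_inner set \<Rightarrow> ('x \<Rightarrow> 'x) \<Rightarrow> (real \<Rightarrow> 'x \<Rightarrow> 'x) \<Rightarrow>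
    ('u::real_inner \<Rightarrow> 'x \<Rightarrow> real) \<Rightarrow> real \<Rightarrow> real \<Rightarrow> 'x set" where
  "A_inf D A S B T th = {yhat D A S B T 0 v | v. v \<in> Linf 0 T \<and> (AE t in leb 0 th. v t = 0)}"

definition reach0 :: "'x::real_inner set \<Rightarrow> ('x \<Rightarrow> 'x) \<Rightarrow> (real \<Rightarrow> 'x \<Rightarrow> 'x) \<Rightarrow>
    ('u::real_inner \<Rightarrow> 'x \<Rightarrow> real) \<Rightarrow> real \<Rightarrow> 'x set" where
  "reach0 D A S B T = {yhat D A S B T 0 v | v. v \<in> Linf 0 T \<and>
     ((\<lambda>s. Linf_norm s T v) \<longlongrightarrow> 0) (at_left T)}"

subsection \<open>The minimal norm problem\<close>

definition admissible_control :: "'x::real_inner set \<Rightarrow> ('x \<Rightarrow> 'x) \<Rightarrow> (real \<Rightarrow> 'x \<Rightarrow> 'x) \<Rightarrow>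
    ('u::real_inner \<Rightarrow> 'x \<Rightarrow> real) \<Rightarrow> real \<Rightarrow> 'x \<Rightarrow> (real \<Rightarrow> 'u) \<Rightarrow> bool" where
  "admissible_control D A S B T yT v \<longleftrightarrow> v \<in> Linf 0 T \<and> yhat D A S B T 0 v = yT"

definition reach_norm :: "'x::real_inner set \<Rightarrow> ('x \<Rightarrow> 'x) \<Rightarrow> (real \<Rightarrow> 'x \<Rightarrow> 'x) \<Rightarrow>
    ('u::real_inner \<Rightarrow> 'x \<Rightarrow> real) \<Rightarrow> real \<Rightarrow> 'x \<Rightarrow> real" where
  "reach_norm D A S B T yT = Inf {Linf_norm 0 T v | v. admissible_control D A S B T yT v}"

definition minimal_norm_control :: "'x::real_inner set \<Rightarrow> ('x \<Rightarrow> 'x) \<Rightarrow> (real \<Rightarrow> 'x \<Rightarrow> 'x) \<Rightarrow>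
    ('u::real_inner \<Rightarrow> 'x \<Rightarrow> real) \<Rightarrow> real \<Rightarrow> 'x \<Rightarrow> (real \<Rightarrow> 'u) \<Rightarrow> bool" where
  "minimal_norm_control D A S B T yT v \<longleftrightarrow>
     admissible_control D A S B T yT v \<and> Linf_norm 0 T v = reach_norm D A S B T yT"

definition X_T :: "'x::real_inner set \<Rightarrow> ('x \<Rightarrow> 'x) \<Rightarrow> (real \<Rightarrow> 'x \<Rightarrow> 'x) \<Rightarrow>
    ('u::real_inner \<Rightarrow> 'x \<Rightarrow> real) \<Rightarrow> real \<Rightarrow> (real \<Rightarrow> 'u) set" where
  "X_T D A S B T = {(\<lambda>t. adj_control B (adj_semigroup S (T - t) z)) | z. z \<in> adj_dom D A}"

definition Y_T :: "'x::real_inner set \<Rightarrow> ('x \<Rightarrow> 'x) \<Rightarrow> (real \<Rightarrow> 'x \<Rightarrow> 'x) \<Rightarrow>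
    ('u::real_inner \<Rightarrow> 'x \<Rightarrow> real) \<Rightarrow> real \<Rightarrow> (real \<Rightarrow> 'u) set" where
  "Y_T D A S B T =
     {f \<in> Lp 1 0 T. \<forall>\<epsilon>>0. \<exists>g\<in>X_T D A S B T. Lp_norm 1 0 T (\<lambda>t. f t - g t) < \<epsilon>}"

end

theory Submission
  imports Defs
begin

text \<open>
  Write \<open>g z s = B\<^sup>*S\<^sup>*(s)z\<close> in reversed time, so that
  \<open>\<langle>y(T;0,v),z\<rangle> = \<integral> \<langle>v(T-s), g z s\<rangle> ds\<close>. Were no constant to control the pairings
  of \<open>g z\<close> with the unit ball of \<open>L\<^sup>p\<close> on \<open>(a,b)\<close> by \<open>\<parallel>g z\<parallel>\<close> in \<open>L\<^sup>1(0,a;U)\<close>, a gliding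
  hump would produce one control violating the inclusion
  \<open>\<A>\<^sub>p \<subseteq> \<A>\<^sub>\<infinity>\<close>. Hence the functions \<open>g z\<close> that are bounded in \<open>L\<^sup>1(0,T;U)\<close> remain bounded
  in \<open>L\<^sup>1(0,T+1;U)\<close> and are equi-integrable away from \<open>s = 0\<close>.

  By duality the minimal norm \<open>M\<close> of \<open>y\<close> is the supremum of \<open>\<langle>y,z\<rangle>\<close> over
  \<open>\<parallel>g z\<parallel> \<le> 1\<close> in \<open>L\<^sup>1(0,T;U)\<close>. The nearly optimal sets are convex and decreasing, and minimising
  the strictly convex functional \<open>\<integral> sqrt (1 + |f|\<^sup>2)\<close> over them selects \<open>z\<^sub>n\<close> for which
  \<open>g z\<^sub>n\<close> converges strongly in \<open>L\<^sup>1(a,T+1;U)\<close> for every \<open>a > 0\<close>. This avoids weak compactness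
  in \<open>L\<^sup>1\<close>. Shifting the limit \<open>F\<close> by \<open>S\<^sup>*(e)\<close> shows that its time reversal lies in \<open>Y\<^sub>T\<close>. Mass of
  \<open>g z\<^sub>n\<close> may escape to \<open>s = 0\<close>, but \<open>y\<close> is reached by a control \<open>w\<close> vanishing there, so
  \<open>\<integral> \<langle>w,F\<rangle> \<ge> M\<close> while \<open>\<integral> |F| \<le> 1\<close>. Approximating \<open>F\<close> by functions \<open>g z\<close>, the same holds for every
  admissible control, and equality in Cauchy-Schwarz is the maximum principle.
\<close>

section \<open>Hilbert space preliminaries\<close>

text \<open>In reversed time the inclusion lets a control living on (a, b) be traded for a bounded
  one on (0, a) that reaches the same state. A pairing over (a, b) therefore costs only the
  \<open>L\<^sup>1\<close> norm of the observation on (0, a), with a constant that at first depends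
  on the control. Finiteness of the exponent is what yields equi-integrability: if the
  \<open>L\<^sup>1\<close> norm of g is at most K, a control of height c placed where |g| > R has
  p-th power integral at most c^p K / R. A large R thus admits a large c, while the pairing stays
  bounded. None of this reaches s = 0, the final time, where observations may concentrate; this is
  why the targets are restricted to \<open>reach0\<close>. The margin beyond T exists because a
  shifted observation looks past T. The integrand sqrt (1 + |f|^2) is chosen over |f|^2 because only
  \<open>L\<^sup>1\<close> bounds are available: linear growth keeps its infima bounded, and its
  convexity defect controls distances where the functions are bounded. Equi-integrability covers the
  remaining set.\<close>

lemma parallelogram_midpoint:
  fixes u v :: "'a::real_inner"
  shows "(norm (u - v))\<^sup>2 = 2 * (norm u)\<^sup>2 + 2 * (norm v)\<^sup>2 - 4 * (norm ((1/2) *\<^sub>R (u + v)))\<^sup>2"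
  unfolding norm_scaleR power_mult_distrib power2_norm_eq_inner
  by (simp add: inner_add_left inner_add_right inner_diff_left inner_diff_right
      inner_commute[of v u] power2_eq_square field_simps)

lemma midpoint_diff:
  fixes a x y :: "'a::real_vector"
  shows "a - ((1/2) *\<^sub>R x + (1/2) *\<^sub>R y) = (1/2) *\<^sub>R ((a - x) + (a - y))"
  using scaleR_half_double[of a] by (simp add: scaleR_diff_right scaleR_add_right algebra_simps)

lemma nearest_point_variational:
  fixes C :: "'a::{real_inner,complete_space} set"
  assumes "closed C" "convex C" "C \<noteq> {}"
  shows "\<exists>p\<in>C. \<forall>x\<in>C. (a - p) \<bullet> (x - p) \<le> 0"
proof -
  define f where "f x = (norm (a - x))\<^sup>2" for x
  define d where "d = Inf (f ` C)"
  have bdd: "bdd_below (f ` C)"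
    by (rule bdd_belowI[of _ 0]) (auto simp: f_def)
  have d_le: "d \<le> f x" if "x \<in> C" for x
    unfolding d_def using bdd that by (intro cInf_lower) auto
  have "\<exists>x\<in>C. f x < d + 1 / real (Suc n)" for n
  proof -
    have "Inf (f ` C) < d + 1 / real (Suc n)" by (simp add: d_def)
    then show ?thesis using cInf_lessD[of "f ` C"] assms(3) by auto
  qed
  then obtain s where s: "\<And>n. s n \<in> C" "\<And>n. f (s n) < d + 1 / real (Suc n)" by metis
  have par: "(dist x y)\<^sup>2 \<le> 2 * (f x - d) + 2 * (f y - d)" if "x \<in> C" "y \<in> C" for x y
  proof -
    have "(1/2) *\<^sub>R x + (1/2) *\<^sub>R y \<in> C"
      using assms(2) that by (auto simp: convex_def)
    then have "d \<le> f ((1/2) *\<^sub>R x + (1/2) *\<^sub>R y)" by (rule d_le)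
    moreover have "(dist x y)\<^sup>2 = 2 * f x + 2 * f y - 4 * f ((1/2) *\<^sub>R x + (1/2) *\<^sub>R y)"
      using parallelogram_midpoint[of "a - x" "a - y"]
      by (simp add: f_def dist_norm norm_minus_commute midpoint_diff)
    ultimately show ?thesis by (simp add: algebra_simps)
  qed
  have "Cauchy s"
  proof (rule metric_CauchyI)
    fix e :: real assume "0 < e"
    then obtain N where N: "inverse (real (Suc N)) < e\<^sup>2 / 4" using reals_Archimedean[of "e\<^sup>2/4"] by auto
    have "dist (s m) (s n) < e" if "m \<ge> N" "n \<ge> N" for m n
    proof -
      have *: "1 / real (Suc k) \<le> inverse (real (Suc N))" if "k \<ge> N" for k
        using that by (simp add: field_simps)
      have "(dist (s m) (s n))\<^sup>2 \<le> 2 * (f (s m) - d) + 2 * (f (s n) - d)" by (rule par) (auto simp: s)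
      also have "\<dots> < e\<^sup>2"
        using s(2)[of m] s(2)[of n] *[OF that(1)] *[OF that(2)] N by simp
      finally show ?thesis by (rule power2_less_imp_less) (use \<open>0 < e\<close> in simp)
    qed
    then show "\<exists>M. \<forall>m\<ge>M. \<forall>n\<ge>M. dist (s m) (s n) < e" by blast
  qed
  then obtain p where p: "s \<longlonglongrightarrow> p" using Cauchy_convergent convergent_def by blast
  have pC: "p \<in> C" using closed_sequentially[OF assms(1)] s p by blast
  have "(\<lambda>n. f (s n)) \<longlonglongrightarrow> f p" unfolding f_def by (intro tendsto_intros p)
  moreover have "(\<lambda>n. d + 1 / real (Suc n)) \<longlonglongrightarrow> d + 0"
    by (intro tendsto_intros LIMSEQ_Suc lim_1_over_n)
  ultimately have "f p \<le> d + 0"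
    by (rule LIMSEQ_le) (use less_imp_le[OF s(2)] in blast)
  then have fp: "f p \<le> f x" if "x \<in> C" for x using d_le[OF that] by simp
  have "(a - p) \<bullet> (x - p) \<le> 0" if x: "x \<in> C" for x
  proof (rule ccontr)
    assume "\<not> ?thesis"
    then have pos: "0 < (a - p) \<bullet> (x - p)" by simp
    \<comment> \<open>Moving from p by t towards x lowers the squared distance by t (2 <a-p, x-p> -
      t |x-p|^2). This t keeps the bracket at least <a-p, x-p>, hence positive.\<close>
    define t where "t = min 1 ((a - p) \<bullet> (x - p) / (norm (x - p))\<^sup>2)"
    have "x \<noteq> p" using pos by auto
    then have r: "0 < (norm (x - p))\<^sup>2" by simp
    have t: "0 < t" "t \<le> 1" using pos r by (auto simp: t_def)
    have "t \<le> (a - p) \<bullet> (x - p) / (norm (x - p))\<^sup>2" by (simp add: t_def)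
    then have t': "t * (norm (x - p))\<^sup>2 \<le> (a - p) \<bullet> (x - p)"
      by (simp only: pos_le_divide_eq[OF r])
    have "p + t *\<^sub>R (x - p) = (1 - t) *\<^sub>R p + t *\<^sub>R x" by (simp add: algebra_simps)
    also have "\<dots> \<in> C" using assms(2) pC x t by (simp add: convex_def)
    finally have "f p \<le> f (p + t *\<^sub>R (x - p))" by (rule fp)
    also have "\<dots> = f p - t * (2 * ((a - p) \<bullet> (x - p)) - t * (norm (x - p))\<^sup>2)"
    proof -
      have "(norm (c - t *\<^sub>R b))\<^sup>2 = (norm c)\<^sup>2 - t * (2 * (c \<bullet> b) - t * (norm b)\<^sup>2)" for b c :: 'a
        unfolding power2_norm_eq_inner
        by (simp add: inner_diff_left inner_diff_right inner_commute[of b c] algebra_simps)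
      then show ?thesis unfolding f_def diff_diff_eq[symmetric] .
    qed
    finally have "t * (2 * ((a - p) \<bullet> (x - p)) - t * (norm (x - p))\<^sup>2) \<le> 0" by simp
    moreover have "0 < t * (2 * ((a - p) \<bullet> (x - p)) - t * (norm (x - p))\<^sup>2)"
      using t t' pos by (intro mult_pos_pos) linarith+
    ultimately show False by simp
  qed
  then show ?thesis using pC by blast
qed

text \<open>In a subspace both p + x and p - x compete, which turns the variational inequality into
  orthogonality.\<close>

lemma nearest_point_subspace:
  fixes G :: "'a::{real_inner,complete_space} set"
  assumes "closed G" "subspace G"
  shows "\<exists>p\<in>G. \<forall>x\<in>G. (a - p) \<bullet> x = 0"
proof -
  obtain p where p: "p \<in> G" "\<And>x. x \<in> G \<Longrightarrow> (a - p) \<bullet> (x - p) \<le> 0"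
    using nearest_point_variational[OF assms(1) subspace_imp_convex[OF assms(2)], of a] subspace_0[OF assms(2)]
    by blast
  have "(a - p) \<bullet> x = 0" if "x \<in> G" for x
    using p(2)[of "p + x"] p(2)[of "p - x"] p(1) that assms(2)
    by (simp add: subspace_add subspace_diff)
  then show ?thesis using p by blast
qed

lemma subspace_closure:
  fixes G :: "'a::real_normed_vector set"
  assumes "subspace G" shows "subspace (closure G)"
proof -
  have "x + y \<in> closure G" if xy: "x \<in> closure G" "y \<in> closure G" for x y
  proof -
    obtain s t where "\<And>n. s n \<in> G" "s \<longlonglongrightarrow> x" "\<And>n. t n \<in> G" "t \<longlonglongrightarrow> y"
      using xy by (meson closure_sequential)
    then show ?thesis
      unfolding closure_sequential
      by (intro exI[of _ "\<lambda>n. s n + t n"]) (auto intro: tendsto_add subspace_add[OF assms])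
  qed
  moreover have "c *\<^sub>R x \<in> closure G" if x: "x \<in> closure G" for c x
  proof -
    obtain s where "\<And>n. s n \<in> G" "s \<longlonglongrightarrow> x" using x by (meson closure_sequential)
    then show ?thesis
      unfolding closure_sequential
      by (intro exI[of _ "\<lambda>n. c *\<^sub>R s n"]) (auto intro: tendsto_scaleR subspace_scale[OF assms])
  qed
  ultimately show ?thesis
    using closure_subset[of G] subspace_0[OF assms] by (auto simp: subspace_def)
qed

lemma subspace_dense_iff_orthogonal_trivial:
  fixes G :: "'a::{real_inner,complete_space} set"
  assumes "subspace G" "\<And>y. (\<And>x. x \<in> G \<Longrightarrow> y \<bullet> x = 0) \<Longrightarrow> y = 0"
  shows "closure G = UNIV"
proof -
  have "a \<in> closure G" for a
  proof -
    obtain p where p: "p \<in> closure G" "\<And>x. x \<in> closure G \<Longrightarrow> (a - p) \<bullet> x = 0"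
      using nearest_point_subspace[of "closure G" a] subspace_closure[OF assms(1)] by auto
    then have "a - p = 0" using assms(2) closure_subset by blast
    with p show ?thesis by simp
  qed
  then show ?thesis by auto
qed

text \<open>Stated on a closed subspace because the representation is needed on the graph of the
  adjoint operator as well as on whole spaces. The representing vector is a multiple of the part of
  some x1 outside the kernel that is orthogonal to the kernel.\<close>

lemma Riesz_subspace:
  fixes G :: "'a::{real_inner,complete_space} set" and \<phi> :: "'a \<Rightarrow> real"
  assumes "closed G" "subspace G"
    and lin: "\<And>x y a b. x \<in> G \<Longrightarrow> y \<in> G \<Longrightarrow> \<phi> (a *\<^sub>R x + b *\<^sub>R y) = a * \<phi> x + b * \<phi> y"
    and bnd: "\<And>x. x \<in> G \<Longrightarrow> \<bar>\<phi> x\<bar> \<le> K * norm x"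
  shows "\<exists>q\<in>G. \<forall>x\<in>G. \<phi> x = q \<bullet> x"
proof (cases "\<forall>x\<in>G. \<phi> x = 0")
  case True then show ?thesis by (intro bexI[of _ 0]) (auto simp: subspace_0 assms(2))
next
  case False
  then obtain x1 where x1: "x1 \<in> G" "\<phi> x1 \<noteq> 0" by blast
  define N where "N = {x \<in> G. \<phi> x = 0}"
  have diff: "\<phi> (x - y) = \<phi> x - \<phi> y" if "x \<in> G" "y \<in> G" for x y
    using lin[OF that, of 1 "-1"] by simp
  have "closed N"
    unfolding closed_sequential_limits
  proof -
    show "\<forall>x l. (\<forall>n. x n \<in> N) \<and> x \<longlonglongrightarrow> l \<longrightarrow> l \<in> N"
    proof (intro allI impI, elim conjE)
      fix x l assume x: "\<forall>n. x n \<in> N" "x \<longlonglongrightarrow> l"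
      have l: "l \<in> G" using closed_sequentially[OF assms(1)] x N_def by blast
      have "(\<lambda>n. K * norm (l - x n)) \<longlonglongrightarrow> K * norm (l - l)" by (intro tendsto_intros x)
      then have lim: "(\<lambda>n. K * norm (l - x n)) \<longlonglongrightarrow> 0" by simp
      have le: "\<bar>\<phi> l\<bar> \<le> K * norm (l - x n)" for n
      proof -
        have "\<phi> (l - x n) = \<phi> l" using diff[of l "x n"] x(1) l by (auto simp: N_def)
        then show ?thesis using bnd[of "l - x n"] l x(1) assms(2) by (auto simp: N_def subspace_diff)
      qed
      have "\<bar>\<phi> l\<bar> \<le> 0" using lim le by (intro LIMSEQ_le_const[OF lim]) auto
      then show "l \<in> N" using l by (simp add: N_def)
    qed
  qed
  moreover have "subspace N"
    unfolding subspace_def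
  proof (intro conjI ballI allI)
    show "0 \<in> N" using lin[of 0 0 0 0] subspace_0[OF assms(2)] by (simp add: N_def)
    show "x + y \<in> N" if "x \<in> N" "y \<in> N" for x y
      using that lin[of x y 1 1] subspace_add[OF assms(2)] by (simp add: N_def)
    show "c *\<^sub>R x \<in> N" if "x \<in> N" for c x
      using that lin[of x x c 0] subspace_scale[OF assms(2)] by (simp add: N_def)
  qed
  ultimately obtain p where p: "p \<in> N" "\<And>x. x \<in> N \<Longrightarrow> (x1 - p) \<bullet> x = 0"
    using nearest_point_subspace by blast
  define w where "w = x1 - p"
  have wG: "w \<in> G" using p x1 assms(2) by (auto simp: w_def N_def subspace_diff)
  have \<phi>w: "\<phi> w \<noteq> 0" using diff[OF x1(1), of p] p(1) x1(2) by (auto simp: w_def N_def)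
  have "w \<noteq> 0" using \<phi>w lin[of 0 0 0 0] subspace_0[OF assms(2)] by auto
  have "\<phi> x = ((\<phi> w / (w \<bullet> w)) *\<^sub>R w) \<bullet> x" if x: "x \<in> G" for x
  proof -
    have "x - (\<phi> x / \<phi> w) *\<^sub>R w \<in> N"
      using lin[OF x wG, of 1 "- (\<phi> x / \<phi> w)"] \<phi>w x wG assms(2)
      by (auto simp: N_def subspace_diff subspace_scale)
    then have "w \<bullet> (x - (\<phi> x / \<phi> w) *\<^sub>R w) = 0" using p(2) w_def by blast
    then have "w \<bullet> x = (\<phi> x / \<phi> w) * (w \<bullet> w)" by (simp add: inner_diff_right)
    then show ?thesis using \<phi>w \<open>w \<noteq> 0\<close> by simp
  qed
  then show ?thesis using wG assms(2) by (meson subspace_scale)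
qed

text \<open>\<open>adjoint\<close> is a Hilbert choice, so its identity holds only once some adjoint
  is exhibited; Riesz representation supplies its value at each y.\<close>

lemma adjoint_works_Hilbert:
  fixes F :: "'a::{real_inner,complete_space} \<Rightarrow> 'b::real_inner"
  assumes "bounded_linear F"
  shows "x \<bullet> adjoint F y = F x \<bullet> y"
proof -
  interpret bounded_linear F by fact
  have "\<exists>q. \<forall>x. F x \<bullet> y = q \<bullet> x" for y
  proof -
    obtain K where K: "\<And>x. norm (F x) \<le> norm x * K" using bounded by blast
    have "\<exists>q\<in>UNIV. \<forall>x\<in>UNIV. F x \<bullet> y = q \<bullet> x"
    proof (rule Riesz_subspace)
      fix x :: 'a
      have "\<bar>F x \<bullet> y\<bar> \<le> norm (F x) * norm y" by (rule Cauchy_Schwarz_ineq2)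
      also have "\<dots> \<le> (norm x * K) * norm y" by (intro mult_right_mono K) auto
      finally show "\<bar>F x \<bullet> y\<bar> \<le> (K * norm y) * norm x" by (simp add: mult_ac)
    qed (auto simp: add scaleR inner_add_left)
    then show ?thesis by blast
  qed
  then obtain F' where "\<And>x y. F x \<bullet> y = x \<bullet> F' y" by (metis inner_commute)
  then have "\<exists>F'. \<forall>x y. F x \<bullet> y = x \<bullet> F' y" by blast
  then show ?thesis unfolding adjoint_def by (rule someI2_ex) simp
qed

text \<open>The sign is chosen so that adding the \<open>n\<close>-th hump does not shrink the partial sum below the
  size of that hump.\<close>

fun hump_sign :: "(nat \<Rightarrow> nat \<Rightarrow> 'b::real_normed_vector) \<Rightarrow> nat \<Rightarrow> real" where
  "hump_sign t n =
     (let r = (\<Sum>k<n. (hump_sign t k / 8 ^ k) *\<^sub>R t n k)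
      in if norm (r + (1 / 8 ^ n) *\<^sub>R t n n) \<ge> norm (t n n) / 8 ^ n then 1 else -1)"

declare hump_sign.simps [simp del]

lemma hump_sign_abs: "\<bar>hump_sign t n\<bar> = 1"
  by (subst hump_sign.simps) (auto simp: Let_def)

text \<open>Twice the hump is the difference of r + q and r - q, so one of the two signs leaves a
  sum at least as long as the hump.\<close>

lemma hump_sign_partial_sum:
  "norm (t n n) / 8 ^ n \<le> norm (\<Sum>k<Suc n. (hump_sign t k / 8 ^ k) *\<^sub>R t n k)"
proof -
  define r where "r = (\<Sum>k<n. (hump_sign t k / 8 ^ k) *\<^sub>R t n k)"
  define q where "q = (1 / 8 ^ n :: real) *\<^sub>R t n n"
  have nq: "norm q = norm (t n n) / 8 ^ n" by (simp add: q_def)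
  have h: "hump_sign t n = (if norm (r + q) \<ge> norm q then 1 else -1)"
    by (subst hump_sign.simps) (simp add: r_def[symmetric] q_def Let_def)
  have "2 * norm q \<le> norm (r + q) + norm (r - q)"
    using norm_triangle_ineq4[of "r + q" "r - q"] by (simp add: scaleR_2[symmetric])
  then have "norm q \<le> norm (r + hump_sign t n *\<^sub>R q)" by (auto simp: h)
  also have "r + hump_sign t n *\<^sub>R q = (\<Sum>k<Suc n. (hump_sign t k / 8 ^ k) *\<^sub>R t n k)"
    by (simp add: r_def q_def)
  finally show ?thesis by (simp add: nq)
qed

text \<open>In row n the terms up to index n sum to at least M n / (2 * 8^n) in norm; the signs take
  care of the earlier ones, about which nothing else is known. The later terms add up to at most M n
  / (7 * 8^n), since \<open>M n\<close> bounds the whole row. The difference is 5/14 of M n / 8^n,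
  and this exceeds 2^n / 4 because \<open>16 ^ n \<le> M n\<close>.\<close>

lemma gliding_hump:
  fixes t :: "nat \<Rightarrow> nat \<Rightarrow> 'b::banach"
  assumes le: "\<And>n k. norm (t n k) \<le> M n" and diag: "\<And>n. M n / 2 \<le> norm (t n n)"
    and big: "\<And>n. 16 ^ n \<le> M n"
  shows "2 ^ n / 4 \<le> norm (\<Sum>k. (hump_sign t k / 8 ^ k) *\<^sub>R t n k)"
proof -
  define a where "a k = (hump_sign t k / 8 ^ k) *\<^sub>R t n k" for k
  have na: "norm (a k) \<le> M n * (1/8) ^ k" for k
    using le[of n k] by (simp add: a_def hump_sign_abs field_simps)
  have sg: "summable (\<lambda>k. M n * (1/8) ^ k)" by (intro summable_mult summable_geometric) simp
  have sa: "summable a" by (rule summable_comparison_test'[OF sg]) (rule na)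
  have sa': "summable (\<lambda>k. a (k + Suc n))" using sa by (simp only: summable_iff_shift)
  have sg': "summable (\<lambda>k. M n / 8 ^ Suc n * (1/8) ^ k)" by (intro summable_mult summable_geometric) simp
  have "norm (\<Sum>k. a (k + Suc n)) \<le> (\<Sum>k. M n / 8 ^ Suc n * (1/8) ^ k)"
    by (rule norm_suminf_le[OF _ sg']) (use na[of "_ + Suc n"] in \<open>simp add: power_add field_simps\<close>)
  also have "\<dots> = M n / 8 ^ Suc n * (8/7)"
    by (subst suminf_mult) (auto simp: suminf_geometric)
  finally have tail: "norm (\<Sum>k. a (k + Suc n)) \<le> M n / 8 ^ n / 7" by (simp add: field_simps)
  define y where "y = M n / 8 ^ n"
  have tail: "norm (\<Sum>k. a (k + Suc n)) \<le> y / 7" using tail by (simp add: y_def)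
  have head: "y / 2 \<le> norm (sum a {..<Suc n})"
    using hump_sign_partial_sum[of t n] divide_right_mono[OF diag[of n], of "8 ^ n"]
    by (simp add: a_def y_def)
  have "suminf a = (\<Sum>k. a (k + Suc n)) + sum a {..<Suc n}"
    by (rule suminf_split_initial_segment[OF sa])
  then have "norm (sum a {..<Suc n}) \<le> norm (suminf a) + norm (\<Sum>k. a (k + Suc n))"
    using norm_triangle_ineq4[of "suminf a" "\<Sum>k. a (k + Suc n)"] by simp
  moreover have "2 ^ n \<le> y"
    using divide_right_mono[OF big[of n], of "8 ^ n"] by (simp add: y_def flip: power_divide)
  moreover have "(0::real) < 2 ^ n" by simp
  ultimately show ?thesis unfolding a_def[symmetric] using head tail by argo
qed

text \<open>Proved for the sorts of the state and control spaces, from which membership in class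
  \<open>banach\<close> does not follow.\<close>

lemma absolutely_summable_complete:
  fixes f :: "nat \<Rightarrow> 'a::{real_normed_vector,complete_space}"
  assumes "summable (\<lambda>n. norm (f n))" shows "summable f"
proof -
  have "Cauchy (\<lambda>n. sum f {..<n})"
  proof (rule metric_CauchyI)
    fix e :: real assume "0 < e"
    have "Cauchy (\<lambda>n. \<Sum>k<n. norm (f k))"
      using assms by (intro convergent_Cauchy) (simp add: summable_iff_convergent)
    then obtain N where N: "\<And>m n. m \<ge> N \<Longrightarrow> n \<ge> N \<Longrightarrow> dist (\<Sum>k<m. norm (f k)) (\<Sum>k<n. norm (f k)) < e"
      using \<open>0 < e\<close> by (meson metric_CauchyD)
    have ord: "dist (sum f {..<m}) (sum f {..<n}) \<le> dist (\<Sum>k<m. norm (f k)) (\<Sum>k<n. norm (f k))"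
      if "m \<le> n" for m n
    proof -
      have "{..<n} = {..<m} \<union> {m..<n}" using that by auto
      then have split: "sum g {..<n} = sum g {..<m} + sum g {m..<n}" for g :: "nat \<Rightarrow> 'c::comm_monoid_add"
        by (simp add: sum.union_disjoint ivl_disj_int)
      have "norm (sum f {m..<n}) \<le> (\<Sum>k=m..<n. norm (f k))" by (rule norm_sum)
      then show ?thesis by (simp add: dist_norm split norm_minus_commute)
    qed
    have "dist (sum f {..<m}) (sum f {..<n}) < e" if "m \<ge> N" "n \<ge> N" for m n
      using ord[of m n] ord[of n m] N[OF that] by (cases "m \<le> n") (auto simp: dist_commute)
    then show "\<exists>M. \<forall>m\<ge>M. \<forall>n\<ge>M. dist (sum f {..<m}) (sum f {..<n}) < e" by blast
  qed
  then show ?thesis by (simp add: summable_iff_convergent Cauchy_convergent_iff)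
qed

text \<open>The gliding hump takes the place of the Baire category argument. Pairing with the unit
  vector \<open>y n\<close> in the direction of \<open>F (r n) (w n)\<close> turns the operators
  into scalar rows, which is why the codomain carries an inner product.\<close>

lemma uniform_boundedness:
  fixes F :: "nat \<Rightarrow> 'a::{real_normed_vector,complete_space} \<Rightarrow> 'b::real_inner"
  assumes lin: "\<And>n. bounded_linear (F n)" and pw: "\<And>x. \<exists>K. \<forall>n. norm (F n x) \<le> K"
  shows "\<exists>K. \<forall>n. onorm (F n) \<le> K"
proof (rule ccontr)
  assume "\<not> ?thesis"
  then have "\<forall>m. \<exists>n. onorm (F n) > 16 ^ m" by (meson not_le)
  then obtain r where r: "\<And>m. onorm (F (r m)) > 16 ^ m" by metis
  have pos: "0 < onorm (F (r m))" for m using r[of m] by (rule less_trans[rotated]) simp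
  have "\<exists>w. norm w = 1 \<and> onorm (F (r m)) / 2 \<le> norm (F (r m) w)" for m
  proof (rule ccontr)
    assume c: "\<not> ?thesis"
    have "norm (F (r m) x) \<le> onorm (F (r m)) / 2 * norm x" for x
    proof (cases "x = 0")
      case True then show ?thesis by (simp add: linear_simps(3)[OF lin])
    next
      case False
      then have "norm (F (r m) (x /\<^sub>R norm x)) < onorm (F (r m)) / 2"
        using c by (auto simp: not_le)
      then show ?thesis using False by (simp add: linear_simps(5)[OF lin] field_simps)
    qed
    then have "onorm (F (r m)) \<le> onorm (F (r m)) / 2" using pos[of m] by (intro onorm_bound) auto
    then show False using pos[of m] by simp
  qed
  then obtain w where w: "\<And>m. norm (w m) = 1" "\<And>m. onorm (F (r m)) / 2 \<le> norm (F (r m) (w m))"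
    by metis
  have "0 < norm (F (r m) (w m))" for m using w(2)[of m] pos[of m] by linarith
  then have "F (r m) (w m) \<noteq> 0" for m by (metis less_irrefl norm_zero)
  define y where "y m = F (r m) (w m) /\<^sub>R norm (F (r m) (w m))" for m
  have y: "norm (y m) = 1" for m using \<open>F (r m) (w m) \<noteq> 0\<close> by (simp add: y_def)
  define t where "t n k = F (r n) (w k) \<bullet> y n" for n k
  have tnn: "t n n = norm (F (r n) (w n))" for n
    using \<open>F (r n) (w n) \<noteq> 0\<close> by (simp add: t_def y_def power2_norm_eq_inner[symmetric] power2_eq_square)
  have bl: "bounded_linear (\<lambda>x. F (r n) x \<bullet> y n)" for n
    by (rule bounded_linear_inner_left_comp[OF lin])
  define x where "x = (\<Sum>k. (hump_sign t k / 8 ^ k) *\<^sub>R w k)"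
  have "summable (\<lambda>k. (1/8::real) ^ k)" by (rule summable_geometric) simp
  then have sw: "summable (\<lambda>k. (hump_sign t k / 8 ^ k) *\<^sub>R w k)"
  proof (rule absolutely_summable_complete[OF back_subst[of summable]])
    show "(\<lambda>k. (1/8::real) ^ k) = (\<lambda>k. norm ((hump_sign t k / 8 ^ k) *\<^sub>R w k))"
      by (rule ext) (simp only: norm_scaleR w real_norm_def abs_divide hump_sign_abs power_abs
          abs_numeral mult_1_right power_one_over)
  qed
  have "2 ^ n / 4 \<le> norm (F (r n) x)" for n
  proof -
    have "2 ^ n / 4 \<le> norm (\<Sum>k. (hump_sign t k / 8 ^ k) *\<^sub>R t n k)"
    proof (rule gliding_hump)
      fix n k
      have "\<bar>t n k\<bar> \<le> norm (F (r n) (w k)) * norm (y n)" unfolding t_def by (rule Cauchy_Schwarz_ineq2)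
      then show "norm (t n k) \<le> onorm (F (r n))"
        using onorm[OF lin[of "r n"], of "w k"] by (simp add: w y)
    qed (use w r in \<open>auto simp: tnn less_imp_le\<close>)
    also have "(\<Sum>k. (hump_sign t k / 8 ^ k) *\<^sub>R t n k) = F (r n) x \<bullet> y n"
      unfolding x_def bounded_linear.suminf[OF bl sw]
      by (simp add: linear_simps(5)[OF bl] t_def)
    also have "norm (F (r n) x \<bullet> y n) \<le> norm (F (r n) x)"
      using Cauchy_Schwarz_ineq2[of "F (r n) x" "y n"] by (simp add: y)
    finally show ?thesis .
  qed
  moreover obtain K where "\<And>n. norm (F n x) \<le> K" using pw by blast
  ultimately have "2 ^ n / 4 \<le> K" for n by (rule order_trans)
  then have "2 ^ n \<le> 4 * K" for n by (simp add: field_simps)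
  moreover obtain n where "4 * K < 2 ^ n" using real_arch_pow[of 2 "4*K"] by auto
  ultimately show False by (metis not_le)
qed

section \<open>Strong measurability\<close>

lemma complete_leb: "complete_measure (leb a b)"
proof
  fix A B assume "B \<subseteq> A" "A \<in> null_sets (leb a b)"
  then show "B \<in> sets (leb a b)"
    by (auto simp: null_sets_restrict_space sets_restrict_space_iff dest: completion.complete2)
qed

lemma finite_measure_leb: "finite_measure (leb a b)"
  by (rule finite_measure_lebesgue_on) simp

lemma space_leb [simp]: "space (leb a b) = {a<..<b}"
  by simp

lemma (in complete_measure) measurable_AE_cong:
  assumes f: "f \<in> measurable M N" and eq: "AE x in M. f x = g x" and g: "g \<in> space M \<rightarrow> space N"
  shows "g \<in> measurable M N"
proof (rule measurableI)
  fix A assume A: "A \<in> sets N"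
  have "f -` A \<inter> space M \<in> sets M" using f A by (rule measurable_sets)
  moreover have "AE x in M. (x \<in> f -` A \<inter> space M) = (x \<in> g -` A \<inter> space M)" using eq by auto
  ultimately show "g -` A \<inter> space M \<in> sets M"
    using in_sets_AE by (metis inf_le2)
qed (use g in auto)

lemma (in complete_measure) borel_measurable_AE_limit:
  fixes s :: "nat \<Rightarrow> 'a \<Rightarrow> 'b::{banach,second_countable_topology}"
  assumes "\<And>n. s n \<in> borel_measurable M" "AE x in M. (\<lambda>n. s n x) \<longlonglongrightarrow> f x"
  shows "f \<in> borel_measurable M"
proof (rule measurable_AE_cong)
  show "(\<lambda>x. lim (\<lambda>n. s n x)) \<in> borel_measurable M" by (intro borel_measurable_lim_metric assms)
  show "AE x in M. lim (\<lambda>n. s n x) = f x" using assms(2) by eventually_elim (rule limI)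
qed simp

lemma strongly_measurable_simple: "simple_function M f \<Longrightarrow> strongly_measurable M f"
  unfolding strongly_measurable_def by (intro exI[of _ "\<lambda>_. f"]) auto

lemma strongly_measurable_const [simp]: "strongly_measurable M (\<lambda>_. c)"
  by (intro strongly_measurable_simple) simp

lemma strongly_measurable_compose2:
  fixes h :: "'b::real_normed_vector \<Rightarrow> 'c::real_normed_vector \<Rightarrow> 'd::real_normed_vector"
  assumes "strongly_measurable M f" "strongly_measurable M g"
    and h: "continuous_on UNIV (\<lambda>p. h (fst p) (snd p))"
  shows "strongly_measurable M (\<lambda>t. h (f t) (g t))"
proof -
  obtain s r where s: "\<And>n::nat. simple_function M (s n)" "AE t in M. (\<lambda>n. s n t) \<longlonglongrightarrow> f t"
    and r: "\<And>n::nat. simple_function M (r n)" "AE t in M. (\<lambda>n. r n t) \<longlonglongrightarrow> g t"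
    using assms(1,2) unfolding strongly_measurable_def by blast
  have "AE t in M. (\<lambda>n. h (s n t) (r n t)) \<longlonglongrightarrow> h (f t) (g t)"
    using s(2) r(2)
  proof eventually_elim
    case (elim t)
    then have "(\<lambda>n. (s n t, r n t)) \<longlonglongrightarrow> (f t, g t)" by (rule tendsto_Pair)
    moreover have "isCont (\<lambda>p. h (fst p) (snd p)) (f t, g t)"
      using h by (simp add: continuous_on_eq_continuous_at)
    ultimately have "(\<lambda>n. (\<lambda>p. h (fst p) (snd p)) (s n t, r n t)) \<longlonglongrightarrow> (\<lambda>p. h (fst p) (snd p)) (f t, g t)"
      by (rule isCont_tendsto_compose[rotated])
    then show ?case by simp
  qed
  moreover have "simple_function M (\<lambda>t. h (s n t) (r n t))" for n
    by (rule simple_function_compose2) (rule s r)+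
  ultimately show ?thesis unfolding strongly_measurable_def by (intro exI[of _ "\<lambda>n t. h (s n t) (r n t)"]) simp
qed

lemma strongly_measurable_compose:
  fixes h :: "'b::real_normed_vector \<Rightarrow> 'd::real_normed_vector"
  assumes "strongly_measurable M f" "continuous_on UNIV h"
  shows "strongly_measurable M (\<lambda>t. h (f t))"
  using assms(1) assms(1)
  by (rule strongly_measurable_compose2[where h = "\<lambda>x _. h x"])
    (intro continuous_on_compose2[OF assms(2)] continuous_intros, simp)

lemma strongly_measurable_add: "strongly_measurable M f \<Longrightarrow> strongly_measurable M g \<Longrightarrow> strongly_measurable M (\<lambda>t. f t + g t)"
  by (erule (1) strongly_measurable_compose2) (intro continuous_intros)

lemma strongly_measurable_diff: "strongly_measurable M f \<Longrightarrow> strongly_measurable M g \<Longrightarrow> strongly_measurable M (\<lambda>t. f t - g t)"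
  by (erule (1) strongly_measurable_compose2) (intro continuous_intros)

lemma strongly_measurable_scaleR: "strongly_measurable M f \<Longrightarrow> strongly_measurable M g \<Longrightarrow> strongly_measurable M (\<lambda>t. f t *\<^sub>R g t)"
  by (erule (1) strongly_measurable_compose2) (intro continuous_intros)

lemma strongly_measurable_inner: "strongly_measurable M f \<Longrightarrow> strongly_measurable M g \<Longrightarrow> strongly_measurable M (\<lambda>t. f t \<bullet> g t)"
  by (erule (1) strongly_measurable_compose2) (intro continuous_intros)

lemma strongly_measurable_norm: "strongly_measurable M f \<Longrightarrow> strongly_measurable M (\<lambda>t. norm (f t))"
  by (erule strongly_measurable_compose) (intro continuous_intros)

lemma strongly_measurable_sum:
  "(\<And>i. i \<in> I \<Longrightarrow> strongly_measurable M (f i)) \<Longrightarrow> strongly_measurable M (\<lambda>t. \<Sum>i\<in>I. f i t)"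
  by (induction I rule: infinite_finite_induct) (auto intro: strongly_measurable_add)

lemma borel_measurable_strongly:
  fixes f :: "'a \<Rightarrow> real"
  assumes "f \<in> borel_measurable M" shows "strongly_measurable M f"
proof -
  obtain s where "\<And>i::nat. simple_function M (s i)" "\<And>x. x \<in> space M \<Longrightarrow> (\<lambda>i. s i x) \<longlonglongrightarrow> f x"
    using borel_measurable_implies_sequence_metric[OF assms, of 0] by metis
  then show ?thesis unfolding strongly_measurable_def by (intro exI[of _ s]) auto
qed

lemma (in complete_measure) strongly_borel_measurable:
  fixes f :: "'a \<Rightarrow> real"
  assumes "strongly_measurable M f" shows "f \<in> borel_measurable M"
proof -
  obtain s where s: "\<And>n::nat. simple_function M (s n)" "AE t in M. (\<lambda>n. s n t) \<longlonglongrightarrow> f t"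
    using assms unfolding strongly_measurable_def by blast
  then show ?thesis by (intro borel_measurable_AE_limit[OF borel_measurable_simple_function])
qed

lemmas leb_borel_measurable = complete_measure.strongly_borel_measurable[OF complete_leb]

lemma leb_norm_measurable:
  "strongly_measurable (leb a b) f \<Longrightarrow> (\<lambda>t. norm (f t)) \<in> borel_measurable (leb a b)"
  by (intro leb_borel_measurable strongly_measurable_norm)

lemma leb_inner_measurable:
  "strongly_measurable (leb a b) f \<Longrightarrow> strongly_measurable (leb a b) g \<Longrightarrow> (\<lambda>t. f t \<bullet> g t) \<in> borel_measurable (leb a b)"
  by (intro leb_borel_measurable strongly_measurable_inner)

text \<open>Each \<open>f n\<close> is replaced by a simple function whose distance to it, measured
  by the integral of min 1 |.|, is at most 2^-n. The truncation makes dominated convergence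
  available on a finite measure without integrability of \<open>f n\<close>. Summability of the
  errors forces the differences to 0 almost everywhere, so the chosen functions form a diagonal
  sequence.\<close>

lemma strongly_measurable_AE_limit:
  fixes f :: "nat \<Rightarrow> 'a \<Rightarrow> 'b::real_normed_vector"
  assumes M: "complete_measure M" "finite_measure M"
    and f: "\<And>n. strongly_measurable M (f n)" and lim: "AE t in M. (\<lambda>n. f n t) \<longlonglongrightarrow> g t"
  shows "strongly_measurable M g"
proof -
  interpret complete_measure M by fact
  interpret finite_measure M by fact
  have "\<exists>s. simple_function M s \<and> (\<integral>\<^sup>+t. min 1 (norm (s t - f n t)) \<partial>M) \<le> ennreal ((1/2) ^ n)" for n
  proof -
    obtain s where s: "\<And>k::nat. simple_function M (s k)" "AE t in M. (\<lambda>k. s k t) \<longlonglongrightarrow> f n t"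
      using f[of n] unfolding strongly_measurable_def by blast
    have [measurable]: "(\<lambda>t. norm (s k t - f n t)) \<in> borel_measurable M" for k
      by (intro strongly_borel_measurable strongly_measurable_norm strongly_measurable_diff
          strongly_measurable_simple s f)
    have "(\<lambda>k. \<integral>\<^sup>+t. min 1 (norm (s k t - f n t)) \<partial>M) \<longlonglongrightarrow> (\<integral>\<^sup>+t. 0 \<partial>M)"
    proof (rule nn_integral_dominated_convergence[where w = "\<lambda>_. 1"])
      show "AE t in M. (\<lambda>k. ennreal (min 1 (norm (s k t - f n t)))) \<longlonglongrightarrow> 0"
        using s(2)
      proof eventually_elim
        case (elim t)
        then have "(\<lambda>k. norm (s k t - f n t)) \<longlonglongrightarrow> norm (f n t - f n t)" by (intro tendsto_intros)
        then have "(\<lambda>k. min 1 (norm (s k t - f n t))) \<longlonglongrightarrow> min 1 (norm (f n t - f n t))"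
          by (intro tendsto_min tendsto_const)
        then show ?case using tendsto_ennrealI by fastforce
      qed
      show "(\<integral>\<^sup>+t. 1 \<partial>M) < \<infinity>" by (simp add: less_top[symmetric])
    qed (auto simp: ennreal_le_1)
    then have "\<forall>\<^sub>F k in sequentially. (\<integral>\<^sup>+t. min 1 (norm (s k t - f n t)) \<partial>M) < ennreal ((1/2) ^ n)"
      by (intro order_tendstoD(2)) auto
    then show ?thesis using s(1) by (meson eventually_sequentially less_imp_le order_refl)
  qed
  then obtain s where s: "\<And>n. simple_function M (s n)"
    "\<And>n. (\<integral>\<^sup>+t. min 1 (norm (s n t - f n t)) \<partial>M) \<le> ennreal ((1/2) ^ n)" by metis
  have [measurable]: "(\<lambda>t. norm (s n t - f n t)) \<in> borel_measurable M" for n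
    by (intro strongly_borel_measurable strongly_measurable_norm strongly_measurable_diff
        strongly_measurable_simple s f)
  have "(\<integral>\<^sup>+t. (\<Sum>n. ennreal (min 1 (norm (s n t - f n t)))) \<partial>M)
      = (\<Sum>n. \<integral>\<^sup>+t. min 1 (norm (s n t - f n t)) \<partial>M)"
    by (rule nn_integral_suminf) measurable
  also have "\<dots> \<le> (\<Sum>n. ennreal ((1/2) ^ n))" by (intro suminf_le s) auto
  also have "\<dots> = ennreal (\<Sum>n. (1/2) ^ n)" by (rule suminf_ennreal2) (auto simp: summable_geometric)
  also have "\<dots> < \<infinity>" by simp
  finally have "(\<integral>\<^sup>+t. (\<Sum>n. ennreal (min 1 (norm (s n t - f n t)))) \<partial>M) \<noteq> \<infinity>" by simp
  then have "AE t in M. (\<Sum>n. ennreal (min 1 (norm (s n t - f n t)))) \<noteq> \<infinity>"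
    by (rule nn_integral_PInf_AE[rotated]) measurable
  then have "AE t in M. (\<lambda>n. s n t) \<longlonglongrightarrow> g t"
    using lim
  proof eventually_elim
    case (elim t)
    have "summable (\<lambda>n. min 1 (norm (s n t - f n t)))"
      using elim(1) by (intro summable_suminf_not_top) auto
    then have "(\<lambda>n. min 1 (norm (s n t - f n t))) \<longlonglongrightarrow> 0" by (rule summable_LIMSEQ_zero)
    then have "(\<lambda>n. norm (s n t - f n t)) \<longlonglongrightarrow> 0"
    proof (rule Lim_transform_eventually)
      have "\<forall>\<^sub>F n in sequentially. min 1 (norm (s n t - f n t)) < 1"
        using \<open>(\<lambda>n. min 1 (norm (s n t - f n t))) \<longlonglongrightarrow> 0\<close> by (rule order_tendstoD(2)) simp
      then show "\<forall>\<^sub>F n in sequentially. min 1 (norm (s n t - f n t)) = norm (s n t - f n t)"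
        by eventually_elim auto
    qed
    then have "(\<lambda>n. s n t - f n t) \<longlonglongrightarrow> 0" by (rule tendsto_norm_zero_cancel)
    then have "(\<lambda>n. (s n t - f n t) + f n t) \<longlonglongrightarrow> 0 + g t" using elim(2) by (rule tendsto_add)
    then show ?case by simp
  qed
  then show ?thesis unfolding strongly_measurable_def using s(1) by blast
qed

lemmas leb_strongly_measurable_AE_limit = strongly_measurable_AE_limit[OF complete_leb finite_measure_leb]

text \<open>\<open>r n t\<close> is the grid point of mesh 1/n just left of t, pushed back to a when
  it falls outside the interval. Sampling f there gives finitely many values, so no separability of
  the codomain enters.\<close>

lemma strongly_measurable_continuous:
  fixes f :: "real \<Rightarrow> 'b::real_normed_vector"
  assumes f: "continuous_on {a..b} f"
  shows "strongly_measurable (leb a b) f"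
proof -
  define r where "r n t = max a (real_of_int \<lfloor>t * real n\<rfloor> / real n)" for n t
  have le: "real_of_int \<lfloor>t * real (Suc n)\<rfloor> / real (Suc n) \<le> t" for n t by (simp add: divide_le_eq)
  have ge: "t - 1 / real (Suc n) \<le> real_of_int \<lfloor>t * real (Suc n)\<rfloor> / real (Suc n)" for n t
  proof -
    have "t * real (Suc n) - 1 \<le> real_of_int \<lfloor>t * real (Suc n)\<rfloor>" by linarith
    then have "(t * real (Suc n) - 1) / real (Suc n) \<le> real_of_int \<lfloor>t * real (Suc n)\<rfloor> / real (Suc n)"
      by (intro divide_right_mono) auto
    then show ?thesis by (simp add: diff_divide_distrib)
  qed
  have simple: "simple_function (leb a b) (r (Suc n))" for n
    unfolding simple_function_def
  proof (intro conjI ballI)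
    have "r (Suc n) ` {a<..<b} \<subseteq> (\<lambda>k. max a (real_of_int k / real (Suc n))) ` {\<lfloor>a * real (Suc n)\<rfloor>..\<lfloor>b * real (Suc n)\<rfloor>}"
    proof (rule image_subsetI)
      fix t assume "t \<in> {a<..<b}"
      then have "a * real (Suc n) \<le> t * real (Suc n)" "t * real (Suc n) \<le> b * real (Suc n)"
        by (intro mult_right_mono; simp)+
      then have "\<lfloor>t * real (Suc n)\<rfloor> \<in> {\<lfloor>a * real (Suc n)\<rfloor>..\<lfloor>b * real (Suc n)\<rfloor>}"
        by (simp only: atLeastAtMost_iff floor_mono simp_thms)
      then show "r (Suc n) t \<in> (\<lambda>k. max a (real_of_int k / real (Suc n))) ` {\<lfloor>a * real (Suc n)\<rfloor>..\<lfloor>b * real (Suc n)\<rfloor>}"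
        unfolding r_def by (rule imageI)
    qed
    then show "finite (r (Suc n) ` space (leb a b))" by (simp add: finite_subset)
    have [measurable]: "r (Suc n) \<in> borel_measurable borel" unfolding r_def by measurable
    have "r (Suc n) -` {x} \<inter> {a<..<b} \<in> sets borel" for x by measurable
    then show "r (Suc n) -` {x} \<inter> space (leb a b) \<in> sets (leb a b)" for x
      by (auto simp: sets_restrict_space_iff)
  qed
  have "(\<lambda>n. f (r (Suc n) t)) \<longlonglongrightarrow> f t" if t: "t \<in> {a<..<b}" for t
  proof (rule continuous_on_tendsto_compose[OF f])
    show "(\<lambda>n. r (Suc n) t) \<longlonglongrightarrow> t"
    proof (rule tendsto_sandwich)
      show "\<forall>\<^sub>F n in sequentially. t - 1 / real (Suc n) \<le> r (Suc n) t"
        using ge by (auto simp: r_def le_max_iff_disj simp del: of_nat_Suc)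
      show "\<forall>\<^sub>F n in sequentially. r (Suc n) t \<le> t" using t le by (auto simp: r_def simp del: of_nat_Suc)
      have "(\<lambda>n. t - 1 / real (Suc n)) \<longlonglongrightarrow> t - 0" by (intro tendsto_intros LIMSEQ_Suc lim_1_over_n)
      then show "(\<lambda>n. t - 1 / real (Suc n)) \<longlonglongrightarrow> t" by simp
    qed simp
    show "\<forall>\<^sub>F n in sequentially. r (Suc n) t \<in> {a..b}"
      using t order_trans[OF le[of t], of b] by (intro always_eventually) (auto simp: r_def simp del: of_nat_Suc)
  qed (use t in auto)
  moreover have "simple_function (leb a b) (\<lambda>t. f (r (Suc n) t))" for n
    using simple by (rule simple_function_compose1)
  ultimately show ?thesis
    unfolding strongly_measurable_def by (intro exI[of _ "\<lambda>n t. f (r (Suc n) t)"]) auto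
qed

section \<open>Restriction, extension by zero and time reversal on intervals\<close>

lemma AE_leb_iff: "(AE t in leb a b. P t) \<longleftrightarrow> (AE t in lebesgue. t \<in> {a<..<b} \<longrightarrow> P t)"
  by (intro AE_restrict_space_iff) simp

lemma AE_leb_mono: "(AE t in leb c d. P t) \<Longrightarrow> {a<..<b} \<subseteq> {c<..<d} \<Longrightarrow> (AE t in leb a b. P t)"
  unfolding AE_leb_iff by (erule AE_mp) (auto intro!: AE_I2)

lemma sets_leb_iff: "A \<in> sets (leb a b) \<longleftrightarrow> A \<in> sets lebesgue \<and> A \<subseteq> {a<..<b}"
  by (auto simp: sets_restrict_space_iff)

lemma simple_function_leb_mono:
  assumes s: "simple_function (leb c d) s" and sub: "{a<..<b} \<subseteq> {c<..<d}"
  shows "simple_function (leb a b) s"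
proof -
  have fin: "finite (s ` {c<..<d})" and m: "\<And>x. x \<in> s ` {c<..<d} \<Longrightarrow> s -` {x} \<inter> {c<..<d} \<in> sets lebesgue"
    using s by (auto simp: simple_function_def sets_leb_iff)
  have "s -` {s t} \<inter> {a<..<b} \<in> sets lebesgue" if t: "t \<in> {a<..<b}" for t
  proof -
    have "s -` {s t} \<inter> {a<..<b} = (s -` {s t} \<inter> {c<..<d}) \<inter> {a<..<b}" using sub by auto
    also have "\<dots> \<in> sets lebesgue" by (rule sets.Int[OF m]) (use t sub in auto)
    finally show ?thesis .
  qed
  then show ?thesis
    unfolding simple_function_def using finite_subset[OF image_mono[OF sub] fin]
    by (auto simp: sets_leb_iff)
qed

lemma strongly_measurable_leb_mono:
  assumes "strongly_measurable (leb c d) f" "{a<..<b} \<subseteq> {c<..<d}"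
  shows "strongly_measurable (leb a b) f"
  using assms unfolding strongly_measurable_def by (meson AE_leb_mono simple_function_leb_mono)

lemma simple_function_extend_zero:
  fixes s :: "real \<Rightarrow> 'b::zero"
  assumes s: "simple_function (leb a b) s"
  shows "simple_function (leb c d) (\<lambda>t. if t \<in> {a<..<b} then s t else 0)"
proof -
  have fin: "finite (s ` {a<..<b})" and m: "\<And>x. x \<in> s ` {a<..<b} \<Longrightarrow> s -` {x} \<inter> {a<..<b} \<in> sets lebesgue"
    using s by (auto simp: simple_function_def sets_leb_iff)
  have m': "s -` {x} \<inter> {a<..<b} \<in> sets lebesgue" for x
  proof (cases "x \<in> s ` {a<..<b}")
    case False then have "s -` {x} \<inter> {a<..<b} = {}" by auto
    then show ?thesis by simp
  qed (rule m)
  have "(\<lambda>t. if t \<in> {a<..<b} then s t else 0) ` {c<..<d} \<subseteq> insert 0 (s ` {a<..<b})" by auto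
  then have "finite ((\<lambda>t. if t \<in> {a<..<b} then s t else 0) ` {c<..<d})"
    by (rule finite_subset) (use fin in simp)
  moreover have "(\<lambda>t. if t \<in> {a<..<b} then s t else 0) -` {x} \<inter> {c<..<d} \<in> sets lebesgue" for x
  proof -
    have "(\<lambda>t. if t \<in> {a<..<b} then s t else 0) -` {x} \<inter> {c<..<d} =
      ((s -` {x} \<inter> {a<..<b}) \<inter> {c<..<d}) \<union> (if x = 0 then {c<..<d} - {a<..<b} else {})"
      by (auto split: if_splits)
    also have "\<dots> \<in> sets lebesgue" by (intro sets.Un sets.Int[OF m']) auto
    finally show ?thesis .
  qed
  ultimately show ?thesis unfolding simple_function_def by (auto simp: sets_leb_iff)
qed

lemma strongly_measurable_extend_zero:
  assumes "strongly_measurable (leb a b) f"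
  shows "strongly_measurable (leb c d) (\<lambda>t. if t \<in> {a<..<b} then f t else 0)"
proof -
  obtain s where s: "\<And>n::nat. simple_function (leb a b) (s n)" "AE t in leb a b. (\<lambda>n. s n t) \<longlonglongrightarrow> f t"
    using assms unfolding strongly_measurable_def by blast
  have "AE t in leb c d. (\<lambda>n. if t \<in> {a<..<b} then s n t else 0) \<longlonglongrightarrow> (if t \<in> {a<..<b} then f t else 0)"
    using s(2) unfolding AE_leb_iff by eventually_elim auto
  then show ?thesis
    unfolding strongly_measurable_def
    using simple_function_extend_zero[OF s(1)]
    by (intro exI[of _ "\<lambda>n t. if t \<in> {a<..<b} then s n t else 0"]) blast
qed

lemma reflect_lebesgue: "(\<lambda>t::real. T - t) \<in> measurable lebesgue lebesgue"
  "distr lebesgue lebesgue (\<lambda>t::real. T - t) = lebesgue"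
proof -
  show "(\<lambda>t::real. T - t) \<in> measurable lebesgue lebesgue"
    using lebesgue_affine_measurable[where c = "\<lambda>_::real. -1" and t = T] by simp
  show "distr lebesgue lebesgue (\<lambda>t::real. T - t) = lebesgue"
    using lebesgue_real_affine[of "-1" T] by (simp add: density_1)
qed

lemma reflect_measurable: "(\<lambda>t. T - t) \<in> measurable (leb 0 T) (leb 0 T)"
  by (intro measurable_restrict_space3 reflect_lebesgue(1)) auto

lemma reflect_leb: "distr (leb 0 T) (leb 0 T) (\<lambda>t. T - t) = leb 0 T"
proof (rule measure_eqI)
  fix A assume "A \<in> sets (distr (leb 0 T) (leb 0 T) (\<lambda>t. T - t))"
  then have A: "A \<in> sets (leb 0 T)" by simp
  then have A': "A \<in> sets lebesgue" "A \<subseteq> {0<..<T}" by (auto simp: sets_leb_iff)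
  have "emeasure (distr (leb 0 T) (leb 0 T) (\<lambda>t. T - t)) A = emeasure (leb 0 T) ((\<lambda>t. T - t) -` A \<inter> {0<..<T})"
    using emeasure_distr[OF reflect_measurable A] by simp
  also have "(\<lambda>t. T - t) -` A \<inter> {0<..<T} = (\<lambda>t. T - t) -` A" using A' by force
  also have "emeasure (leb 0 T) ((\<lambda>t. T - t) -` A) = emeasure lebesgue ((\<lambda>t. T - t) -` A)"
    using A' by (intro emeasure_restrict_space) force+
  also have "\<dots> = emeasure (distr lebesgue lebesgue (\<lambda>t. T - t)) A"
    using emeasure_distr[OF reflect_lebesgue(1) A'(1)] by simp
  also have "\<dots> = emeasure (leb 0 T) A"
    using A' by (simp only: reflect_lebesgue) (intro emeasure_restrict_space[symmetric]; simp)
  finally show "emeasure (distr (leb 0 T) (leb 0 T) (\<lambda>t. T - t)) A = emeasure (leb 0 T) A" .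
qed simp

lemma AE_reflect: "(AE t in leb 0 T. P t) \<Longrightarrow> (AE t in leb 0 T. P (T - t))"
  using AE_distrD[OF reflect_measurable, of P T] unfolding reflect_leb .

lemma simple_function_reflect:
  assumes s: "simple_function (leb 0 T) s" shows "simple_function (leb 0 T) (\<lambda>t. s (T - t))"
proof -
  have "(\<lambda>t. s (T - t)) ` {0<..<T} \<subseteq> s ` {0<..<T}" by auto
  then have "finite ((\<lambda>t. s (T - t)) ` {0<..<T})"
    by (rule finite_subset) (use s in \<open>auto simp: simple_function_def\<close>)
  moreover have "(\<lambda>t. s (T - t)) -` {s (T - t)} \<inter> {0<..<T} \<in> sets (leb 0 T)" if t: "t \<in> {0<..<T}" for t
  proof -
    have "s -` {s (T - t)} \<inter> {0<..<T} \<in> sets (leb 0 T)"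
      using s t by (auto simp: simple_function_def)
    then have "(\<lambda>t. T - t) -` (s -` {s (T - t)} \<inter> {0<..<T}) \<inter> space (leb 0 T) \<in> sets (leb 0 T)"
      by (rule measurable_sets[OF reflect_measurable])
    moreover have "(\<lambda>t. T - t) -` (s -` {s (T - t)} \<inter> {0<..<T}) \<inter> space (leb 0 T)
      = (\<lambda>t. s (T - t)) -` {s (T - t)} \<inter> {0<..<T}" by auto
    ultimately show ?thesis by simp
  qed
  ultimately show ?thesis unfolding simple_function_def by auto
qed

lemma strongly_measurable_reflect:
  assumes "strongly_measurable (leb 0 T) f" shows "strongly_measurable (leb 0 T) (\<lambda>t. f (T - t))"
proof -
  obtain s where s: "\<And>n::nat. simple_function (leb 0 T) (s n)" "AE t in leb 0 T. (\<lambda>n. s n t) \<longlonglongrightarrow> f t"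
    using assms unfolding strongly_measurable_def by blast
  then show ?thesis unfolding strongly_measurable_def
    by (intro exI[of _ "\<lambda>n t. s n (T - t)"] conjI allI simple_function_reflect AE_reflect[OF s(2)])
qed

lemma integral_reflect:
  fixes f :: "real \<Rightarrow> real"
  shows "f \<in> borel_measurable (leb 0 T) \<Longrightarrow> (\<integral>t. f (T - t) \<partial>leb 0 T) = (\<integral>t. f t \<partial>leb 0 T)"
  using integral_distr[OF reflect_measurable, of f T] unfolding reflect_leb by simp

lemma integrable_reflect:
  fixes f :: "real \<Rightarrow> real"
  assumes "integrable (leb 0 T) f" shows "integrable (leb 0 T) (\<lambda>t. f (T - t))"
  using integrable_distr[OF reflect_measurable, of T f] assms unfolding reflect_leb by simp

lemma nn_integral_leb:
  "(\<integral>\<^sup>+t. f t \<partial>leb a b) = (\<integral>\<^sup>+t. f t * indicator {a<..<b} t \<partial>lebesgue)"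
  by (rule nn_integral_restrict_space) simp

lemma nn_integral_leb_mono_set:
  assumes "{a<..<b} \<subseteq> {c<..<d}"
  shows "(\<integral>\<^sup>+t. f t \<partial>leb a b) \<le> (\<integral>\<^sup>+t. f t \<partial>leb c d)"
  unfolding nn_integral_leb by (intro nn_integral_mono) (use assms in \<open>auto split: split_indicator\<close>)

lemma integrable_continuous_leb:
  fixes f :: "real \<Rightarrow> real"
  assumes "continuous_on {a..b} f" shows "integrable (leb a b) f"
proof -
  obtain K where K: "\<And>t. t \<in> {a..b} \<Longrightarrow> norm (f t) \<le> K"
    using compact_imp_bounded[OF compact_continuous_image[OF assms compact_Icc]]
    unfolding bounded_iff by (metis imageI)
  interpret finite_measure "leb a b" by (rule finite_measure_leb)
  show ?thesis
    by (rule integrable_const_bound[where B = K])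
      (use K in \<open>auto intro!: leb_borel_measurable strongly_measurable_continuous assms\<close>)
qed

section \<open>Strong convergence from convexity in \<open>L\<^sup>1\<close>\<close>

text \<open>The area integrand grows linearly, yet its midpoint convexity defect controls \<open>norm (x - y)\<close> on
  bounded sets.\<close>

definition area :: "'b::real_normed_vector \<Rightarrow> real" where
  "area x = sqrt (1 + (norm x)\<^sup>2)"

lemma area_bounds: "0 \<le> area x" "norm x \<le> area x" "1 \<le> area x" "area x \<le> 1 + norm x"
proof -
  show "0 \<le> area x" "1 \<le> area x" by (auto simp: area_def)
  show "norm x \<le> area x" unfolding area_def by (rule real_le_rsqrt) simp
  show "area x \<le> 1 + norm x" unfolding area_def by (rule real_le_lsqrt) (auto simp: power2_sum)
qed

lemma continuous_on_area [continuous_intros]: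
  "continuous_on S f \<Longrightarrow> continuous_on S (\<lambda>t. area (f t))"
  unfolding area_def by (intro continuous_intros)

text \<open>\<open>area x\<close> is the norm of the lift (1, x). With p and q the norms of the two
  lifts, s the norm of their sum and c their inner product, (p+q)^2 - s^2 = 2 (pq - c). The Gram
  determinant p^2 q^2 - c^2 dominates |x-y|^2. Dividing by (p+q+s) and pq, which are at most 4r and
  r^2, gives the cubic constant.\<close>

lemma area_midpoint_gap:
  fixes x y :: "'b::real_inner"
  assumes "1 + norm x \<le> r" "1 + norm y \<le> r"
  shows "(norm (x - y))\<^sup>2 / (8 * r ^ 3) \<le> area x / 2 + area y / 2 - area ((1/2) *\<^sub>R (x + y))"
proof -
  define p q s where "p = area x" and "q = area y" and "s = 2 * area ((1/2) *\<^sub>R (x + y))"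
  have p2: "p\<^sup>2 = 1 + (norm x)\<^sup>2" and q2: "q\<^sup>2 = 1 + (norm y)\<^sup>2" by (simp_all add: p_def q_def area_def)
  have s2: "s\<^sup>2 = 4 + (norm (x + y))\<^sup>2"
    by (simp add: s_def area_def power_mult_distrib power_divide)
  have pos: "1 \<le> p" "1 \<le> q" "0 \<le> s" using area_bounds by (auto simp: p_def q_def s_def)
  have le: "p \<le> r" "q \<le> r" using area_bounds(4) assms unfolding p_def q_def by (meson order_trans)+
  define c where "c = 1 + x \<bullet> y"
  have CS: "\<bar>x \<bullet> y\<bar> \<le> norm x * norm y" by (rule Cauchy_Schwarz_ineq2)
  \<comment> \<open>The Gram determinant of the lifts is |x-y|^2 plus the Gram determinant of x and
    y, which is nonnegative by Cauchy-Schwarz.\<close>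
  have gram: "(norm (x - y))\<^sup>2 + c\<^sup>2 \<le> (p * q)\<^sup>2"
  proof -
    have "(x \<bullet> y)\<^sup>2 \<le> (norm x)\<^sup>2 * (norm y)\<^sup>2"
      using CS by (metis abs_ge_zero power2_abs power_mono power_mult_distrib)
    moreover have "(norm (x - y))\<^sup>2 = (norm x)\<^sup>2 + (norm y)\<^sup>2 - 2 * (x \<bullet> y)"
      by (simp add: power2_norm_eq_inner inner_diff_left inner_diff_right inner_commute)
    ultimately show ?thesis
      unfolding power_mult_distrib p2 q2 c_def by (simp add: power2_eq_square algebra_simps)
  qed
  have pq: "0 < p * q" using pos by simp
  have "\<bar>c\<bar> \<le> p * q"
    using gram by (intro abs_le_square_iff[THEN iffD2, of c "p * q", simplified abs_of_pos[OF pq]])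
      (metis add_increasing2 add.commute le_add_same_cancel1 order_trans zero_le_power2)
  then have cpq: "- (p * q) \<le> c" "c \<le> p * q" by auto
  have "(norm (x - y))\<^sup>2 \<le> (p * q - c) * (p * q + c)"
    using gram by (simp add: power2_eq_square algebra_simps)
  also have "\<dots> \<le> (p * q - c) * (2 * (p * q))" using cpq by (intro mult_left_mono) auto
  finally have n0: "(norm (x - y))\<^sup>2 \<le> (2 * (p * q - c)) * (p * q)" by (simp add: mult_ac)
  have id: "2 * (p * q - c) = (p + q)\<^sup>2 - s\<^sup>2"
  proof -
    have "(norm (x + y))\<^sup>2 = (norm x)\<^sup>2 + (norm y)\<^sup>2 + 2 * (x \<bullet> y)"
      by (simp add: power2_norm_eq_inner inner_add_left inner_add_right inner_commute)
    then show ?thesis by (simp add: power2_sum p2 q2 s2 c_def)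
  qed
  have n1: "(norm (x - y))\<^sup>2 \<le> ((p + q)\<^sup>2 - s\<^sup>2) * (p * q)" using n0 unfolding id .
  have sle: "s \<le> p + q"
  proof (rule power2_le_imp_le)
    show "s\<^sup>2 \<le> (p + q)\<^sup>2" using cpq id by simp
  qed (use pos in simp)
  have "((p + q)\<^sup>2 - s\<^sup>2) * (p * q) = (p + q - s) * ((p + q + s) * (p * q))"
    by (simp add: power2_eq_square algebra_simps)
  also have "\<dots> \<le> (p + q - s) * ((4 * r) * (r * r))"
    using sle pos le by (intro mult_left_mono mult_mono) auto
  finally have "(norm (x - y))\<^sup>2 \<le> (p + q - s) * (4 * r ^ 3)"
    using n1 by (simp add: power3_eq_cube mult_ac)
  moreover have "0 < r ^ 3" using pos le by simp
  ultimately have "(norm (x - y))\<^sup>2 / (8 * r ^ 3) \<le> (p + q - s) / 2"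
    by (simp add: divide_le_eq)
  then show ?thesis by (simp add: p_def q_def s_def add_divide_distrib diff_divide_distrib)
qed

lemma area_midpoint_convex:
  fixes x y :: "'b::real_inner"
  shows "0 \<le> area x / 2 + area y / 2 - area ((1/2) *\<^sub>R (x + y))"
proof -
  define r where "r = 1 + max (norm x) (norm y)"
  have "0 \<le> r" by (simp add: r_def le_max_iff_disj add_nonneg_nonneg)
  then have "0 \<le> (norm (x - y))\<^sup>2 / (8 * r ^ 3)" by simp
  also have "\<dots> \<le> area x / 2 + area y / 2 - area ((1/2) *\<^sub>R (x + y))"
    by (rule area_midpoint_gap) (auto simp: r_def)
  finally show ?thesis .
qed

text \<open>The gap bounds the square of the distance D, and D <= \<eta> + D^2 / (4 \<eta>) makes
  the estimate linear in the gap, so that it can be integrated. If a norm exceeds R, the larger one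
  does, and twice the larger one dominates the sum.\<close>

lemma norm_diff_le_area_gap:
  fixes x y :: "'b::real_inner"
  assumes "0 < \<eta>" "0 \<le> R"
  shows "norm (x - y) \<le> \<eta> + (2 * (1 + R) ^ 3 / \<eta>) * (area x / 2 + area y / 2 - area ((1/2) *\<^sub>R (x + y)))
    + 2 * norm x * indicator {R<..} (norm x) + 2 * norm y * indicator {R<..} (norm y)"
proof (cases "norm x \<le> R \<and> norm y \<le> R")
  case True
  define G where "G = area x / 2 + area y / 2 - area ((1/2) *\<^sub>R (x + y))"
  define D where "D = norm (x - y)"
  have r: "0 < (1 + R) ^ 3" using assms(2) by simp
  have "D\<^sup>2 / (8 * (1 + R) ^ 3) \<le> G"
    unfolding D_def G_def by (rule area_midpoint_gap) (use True in auto)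
  then have "D\<^sup>2 \<le> G * (8 * (1 + R) ^ 3)" using r by (simp add: divide_le_eq)
  then have "D\<^sup>2 / (4 * \<eta>) \<le> G * (8 * (1 + R) ^ 3) / (4 * \<eta>)" using assms(1) by (intro divide_right_mono) auto
  also have "\<dots> = (2 * (1 + R) ^ 3 / \<eta>) * G" by simp
  finally have "D\<^sup>2 / (4 * \<eta>) \<le> (2 * (1 + R) ^ 3 / \<eta>) * G" .
  moreover have "D \<le> \<eta> + D\<^sup>2 / (4 * \<eta>)"
  proof -
    have "0 \<le> (D - 2 * \<eta>)\<^sup>2 / (4 * \<eta>)" using assms(1) by simp
    also have "\<dots> = D\<^sup>2 / (4 * \<eta>) - D + \<eta>"
      using assms(1) by (simp add: power2_eq_square field_simps)
    finally show ?thesis by simp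
  qed
  ultimately show ?thesis using True unfolding G_def[symmetric] D_def[symmetric] by simp
next
  case False
  have *: "norm (x - y) \<le> norm x + norm y" by (rule norm_triangle_ineq4)
  have "0 \<le> (2 * (1 + R) ^ 3 / \<eta>) * (area x / 2 + area y / 2 - area ((1/2) *\<^sub>R (x + y)))"
    using assms by (intro mult_nonneg_nonneg area_midpoint_convex) auto
  moreover have "norm x + norm y \<le> 2 * norm x * indicator {R<..} (norm x) + 2 * norm y * indicator {R<..} (norm y)"
    using False assms(2) by (auto simp: not_le split: split_indicator)
  ultimately show ?thesis using * assms(1) by linarith
qed

text \<open>The Cauchy property is known only away from 0. The subsequence is fast on the growing
  intervals (\<open>\<alpha> k\<close>, b); a fixed t lies in all but finitely many of them, so the
  increments at almost every t are absolutely summable. Fatou's lemma then upgrades pointwise to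
  local \<open>L\<^sup>1\<close> convergence.\<close>

lemma L1_Cauchy_AE_convergent:
  fixes f :: "nat \<Rightarrow> real \<Rightarrow> 'b::{real_normed_vector,complete_space}"
  assumes b: "0 < b" and sm: "\<And>n. strongly_measurable (leb 0 b) (f n)"
    and Cau: "\<And>a e. 0 < a \<Longrightarrow> a < b \<Longrightarrow> 0 < e \<Longrightarrow>
      \<exists>N. \<forall>n\<ge>N. \<forall>m\<ge>n. (\<integral>\<^sup>+t. norm (f n t - f m t) \<partial>leb a b) \<le> ennreal e"
  obtains r F where "strict_mono r" "strongly_measurable (leb 0 b) F"
    "AE t in leb 0 b. (\<lambda>n. f (r n) t) \<longlonglongrightarrow> F t"
    "\<And>a. 0 < a \<Longrightarrow> a < b \<Longrightarrow> (\<lambda>n. \<integral>\<^sup>+t. norm (f (r n) t - F t) \<partial>leb a b) \<longlonglongrightarrow> 0"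
proof -
  \<comment> \<open>The offset 2 keeps every level strictly between 0 and b, the first one
    included.\<close>
  define \<alpha> where "\<alpha> k = b / (real k + 2)" for k
  have \<alpha>: "0 < \<alpha> k" "\<alpha> k < b" for k using b by (auto simp: \<alpha>_def divide_simps)
  have \<alpha>_lim: "\<alpha> \<longlonglongrightarrow> 0"
    using LIMSEQ_ignore_initial_segment[OF lim_const_over_n[of b], of 2] by (simp add: \<alpha>_def[abs_def] add.commute)
  have "\<exists>N. \<forall>n\<ge>N. \<forall>m\<ge>n. (\<integral>\<^sup>+t. norm (f n t - f m t) \<partial>leb (\<alpha> k) b) \<le> ennreal ((1/2) ^ k)" for k
    by (rule Cau) (use \<alpha> in auto)
  then obtain N where N: "\<And>k n m. n \<ge> N k \<Longrightarrow> m \<ge> n \<Longrightarrow>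
      (\<integral>\<^sup>+t. norm (f n t - f m t) \<partial>leb (\<alpha> k) b) \<le> ennreal ((1/2) ^ k)" by metis
  \<comment> \<open>The recursion enforces both strict growth and \<open>N k \<le> r k\<close>, so
    consecutive members are within 2^-k on (\<open>\<alpha> k\<close>, b).\<close>
  define r where "r = rec_nat (N 0) (\<lambda>k q. max (Suc q) (N (Suc k)))"
  have r_Suc: "r (Suc k) = max (Suc (r k)) (N (Suc k))" for k by (simp add: r_def)
  have mono: "strict_mono r" by (rule strict_mono_Suc_iff[THEN iffD2]) (simp add: r_Suc less_max_iff_disj)
  have rN: "N k \<le> r k" for k by (cases k) (simp_all add: r_Suc, simp add: r_def)
  define g where "g k = f (r k)" for k
  have smg: "strongly_measurable (leb 0 b) (g k)" for k by (simp add: g_def sm)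
  have gm: "(\<lambda>t. norm (g k t - g l t)) \<in> borel_measurable (leb 0 b)" for k l
    by (intro leb_norm_measurable strongly_measurable_diff smg)
  define D where "D k t = ennreal (norm (g k t - g (Suc k) t)) * indicator {\<alpha> k<..} t" for k t
  have Dm: "D k \<in> borel_measurable (leb 0 b)" for k
  proof -
    have [measurable]: "(\<lambda>t. t) \<in> borel_measurable (leb 0 b)"
      by (intro leb_borel_measurable strongly_measurable_continuous continuous_intros)
    show ?thesis unfolding D_def using gm[of k "Suc k"] by measurable
  qed
  have "(\<integral>\<^sup>+t. D k t \<partial>leb 0 b) \<le> ennreal ((1/2) ^ k)" for k
  proof -
    have "(\<integral>\<^sup>+t. D k t \<partial>leb 0 b) = (\<integral>\<^sup>+t. norm (g k t - g (Suc k) t) \<partial>leb (\<alpha> k) b)"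
      unfolding nn_integral_leb D_def using \<alpha>[of k]
      by (intro nn_integral_cong) (auto split: split_indicator)
    also have "\<dots> \<le> ennreal ((1/2) ^ k)" unfolding g_def by (rule N) (auto simp: rN r_Suc)
    finally show ?thesis .
  qed
  then have "(\<Sum>k. \<integral>\<^sup>+t. D k t \<partial>leb 0 b) \<le> (\<Sum>k. ennreal ((1/2) ^ k))" by (intro suminf_le) auto
  also have "\<dots> = ennreal (\<Sum>k. (1/2) ^ k)" by (rule suminf_ennreal2) (auto simp: summable_geometric)
  also have "\<dots> < \<infinity>" by simp
  finally have "(\<integral>\<^sup>+t. (\<Sum>k. D k t) \<partial>leb 0 b) \<noteq> \<infinity>"
    by (subst nn_integral_suminf) (auto intro: Dm)
  then have "AE t in leb 0 b. (\<Sum>k. D k t) \<noteq> \<infinity>"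
    by (rule nn_integral_PInf_AE[rotated]) (intro borel_measurable_suminf_order Dm)
  moreover have "AE t in leb 0 b. t \<in> {0<..<b}" by (rule AE_I2) simp
  ultimately have conv: "AE t in leb 0 b. convergent (\<lambda>k. g k t)"
  proof eventually_elim
    case (elim t)
    have "summable (\<lambda>k. norm (g k t - g (Suc k) t) * indicator {\<alpha> k<..} t)"
    proof (rule summable_suminf_not_top)
      have "(\<lambda>k. ennreal (norm (g k t - g (Suc k) t) * indicator {\<alpha> k<..} t)) = (\<lambda>k. D k t)"
        by (auto simp: D_def split: split_indicator)
      then show "(\<Sum>k. ennreal (norm (g k t - g (Suc k) t) * indicator {\<alpha> k<..} t)) \<noteq> top"
        using elim(1) by simp
    qed simp
    moreover have "\<forall>\<^sub>F k in sequentially. norm (g k t - g (Suc k) t) * indicator {\<alpha> k<..} t = norm (g (Suc k) t - g k t)"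
    proof -
      have "\<forall>\<^sub>F k in sequentially. \<alpha> k < t" using \<alpha>_lim by (rule order_tendstoD(2)) (use elim in simp)
      then show ?thesis by eventually_elim (simp add: norm_minus_commute)
    qed
    ultimately have "summable (\<lambda>k. norm (g (Suc k) t - g k t))" by (simp cong: summable_cong)
    then have "summable (\<lambda>k. g (Suc k) t - g k t)" by (rule absolutely_summable_complete)
    then show ?case by (simp add: summable_iff_convergent sum_lessThan_telescope[of "\<lambda>i. g i t"] convergent_diff_const_right_iff)
  qed
  define F where "F t = lim (\<lambda>k. g k t)" for t
  have lim: "AE t in leb 0 b. (\<lambda>k. g k t) \<longlonglongrightarrow> F t"
    using conv by eventually_elim (simp add: F_def convergent_LIMSEQ_iff)
  have smF: "strongly_measurable (leb 0 b) F" by (rule leb_strongly_measurable_AE_limit[OF smg lim])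
  have "(\<lambda>n. \<integral>\<^sup>+t. norm (g n t - F t) \<partial>leb a b) \<longlonglongrightarrow> 0" if a: "0 < a" "a < b" for a
  proof (rule order_tendstoI)
    fix y :: ennreal assume "0 < y"
    then obtain e where e: "0 < e" "ennreal e < y" 
      by (metis ennreal_0 ennreal_less_iff ennreal_rat_dense le_less_linear less_le_trans ennreal_neg order_less_irrefl less_le_not_le linorder_not_less)
    obtain M where M: "\<And>n m. n \<ge> M \<Longrightarrow> m \<ge> n \<Longrightarrow> (\<integral>\<^sup>+t. norm (f n t - f m t) \<partial>leb a b) \<le> ennreal e"
      using Cau[OF a e(1)] by blast
    have sub: "{a<..<b} \<subseteq> {0<..<b}" using a by auto
    have gm': "(\<lambda>t. norm (g k t - g l t)) \<in> borel_measurable (leb a b)" for k l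
      by (intro leb_norm_measurable strongly_measurable_diff strongly_measurable_leb_mono[OF smg sub])
    have "(\<integral>\<^sup>+t. norm (g n t - F t) \<partial>leb a b) \<le> ennreal e" if n: "n \<ge> M" for n
    proof -
      have "(\<integral>\<^sup>+t. norm (g n t - F t) \<partial>leb a b) = (\<integral>\<^sup>+t. liminf (\<lambda>m. ennreal (norm (g n t - g m t))) \<partial>leb a b)"
      proof (rule nn_integral_cong_AE)
        show "AE t in leb a b. ennreal (norm (g n t - F t)) = liminf (\<lambda>m. ennreal (norm (g n t - g m t)))"
          using AE_leb_mono[OF lim sub]
        proof eventually_elim
          case (elim t)
          then have "(\<lambda>m. ennreal (norm (g n t - g m t))) \<longlonglongrightarrow> ennreal (norm (g n t - F t))"
            by (intro tendsto_intros)
          then show ?case by (intro lim_imp_Liminf[symmetric]) auto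
        qed
      qed
      also have "\<dots> \<le> liminf (\<lambda>m. \<integral>\<^sup>+t. norm (g n t - g m t) \<partial>leb a b)"
        by (rule nn_integral_liminf) (rule measurable_compose[OF gm' measurable_ennreal])
      also have "\<dots> \<le> limsup (\<lambda>m. \<integral>\<^sup>+t. norm (g n t - g m t) \<partial>leb a b)"
        by (rule Liminf_le_Limsup) simp
      also have "\<dots> \<le> ennreal e"
      proof (rule Limsup_bounded)
        have "(\<integral>\<^sup>+t. norm (g n t - g m t) \<partial>leb a b) \<le> ennreal e" if "m \<ge> n" for m
          unfolding g_def
          using n seq_suble[OF mono, of n] that mono by (intro M) (auto simp: strict_mono_less_eq)
        then show "\<forall>\<^sub>F m in sequentially. (\<integral>\<^sup>+t. norm (g n t - g m t) \<partial>leb a b) \<le> ennreal e"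
          by (auto simp: eventually_sequentially)
      qed
      finally show ?thesis .
    qed
    then show "\<forall>\<^sub>F n in sequentially. (\<integral>\<^sup>+t. norm (g n t - F t) \<partial>leb a b) < y"
      using e(2) by (auto simp: eventually_sequentially intro: le_less_trans)
  qed simp
  then show thesis using that[OF mono smF] lim unfolding g_def by blast
qed

lemma ennreal_plus_twice:
  "0 \<le> u \<Longrightarrow> 0 \<le> x \<Longrightarrow> 0 \<le> y \<Longrightarrow>
    ennreal (u + 2 * x + 2 * y) = ennreal u + 2 * ennreal x + 2 * ennreal y"
  by (simp add: ennreal_mult)

text \<open>The infima of the area integral over the decreasing sets increase and stay below b + K,
  hence converge. Near-minimisers then have vanishing midpoint defect, and the defect controls the
  \<open>L\<^sup>1\<close> distance up to tails, which equi-integrability makes small on (a,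
  b).\<close>

lemma L1_convex_selection:
  fixes C :: "nat \<Rightarrow> (real \<Rightarrow> 'u::{real_inner,complete_space}) set"
  assumes b: "0 < b"
    and dec: "\<And>n. C (Suc n) \<subseteq> C n" and ne: "\<And>n. C n \<noteq> {}"
    and conv: "\<And>n f g. f \<in> C n \<Longrightarrow> g \<in> C n \<Longrightarrow> (\<lambda>t. (1/2) *\<^sub>R (f t + g t)) \<in> C n"
    and cont: "\<And>f. f \<in> C 0 \<Longrightarrow> continuous_on {0..b} f"
    and bnd: "\<And>f. f \<in> C 0 \<Longrightarrow> (\<integral>t. norm (f t) \<partial>leb 0 b) \<le> K"
    and equi: "\<And>a \<eta>. 0 < a \<Longrightarrow> a < b \<Longrightarrow> 0 < \<eta> \<Longrightarrow> \<exists>R\<ge>0. \<forall>f\<in>C 0.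
      (\<integral>\<^sup>+t. ennreal (norm (f t) * indicator {R<..} (norm (f t))) \<partial>leb a b) \<le> ennreal \<eta>"
  obtains f F where "\<And>n. f n \<in> C n" "strongly_measurable (leb 0 b) F"
    "AE t in leb 0 b. (\<lambda>n. f n t) \<longlonglongrightarrow> F t"
    "\<And>a. 0 < a \<Longrightarrow> a < b \<Longrightarrow> (\<lambda>n. \<integral>\<^sup>+t. norm (f n t - F t) \<partial>leb a b) \<longlonglongrightarrow> 0"
proof -
  have anti: "C m \<subseteq> C n" if "n \<le> m" for n m
    using that by (rule lift_Suc_antimono_le[of C, OF dec])
  have C0: "f \<in> C 0" if "f \<in> C n" for f n using that anti[of 0 n] by auto
  have cont': "continuous_on {0..b} f" if "f \<in> C n" for f n using cont[OF C0[OF that]] .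
  interpret finite_measure "leb 0 b" by (rule finite_measure_leb)
  have mb: "measure (leb 0 b) {0<..<b} = b"
    using b by (simp add: measure_restrict_space)
  define P where "P f = (\<integral>t. area (f t) \<partial>leb 0 b)" for f :: "real \<Rightarrow> 'u"
  have int_area: "integrable (leb 0 b) (\<lambda>t. area (f t))" if "f \<in> C n" for f n
    by (intro integrable_continuous_leb continuous_on_area cont'[OF that])
  have P0: "0 \<le> P f" for f unfolding P_def by (intro integral_nonneg_AE) (simp add: area_bounds)
  have PK: "P f \<le> b + K" if f: "f \<in> C n" for f n
  proof -
    have "P f \<le> (\<integral>t. 1 + norm (f t) \<partial>leb 0 b)"
      unfolding P_def using cont'[OF f]
      by (intro integral_mono int_area[OF f] integrable_continuous_leb continuous_intros) (auto simp: area_bounds)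
    also have "\<dots> = b + (\<integral>t. norm (f t) \<partial>leb 0 b)"
      using cont'[OF f] by (subst Bochner_Integration.integral_add)
        (auto intro!: integrable_continuous_leb continuous_intros simp: mb)
    also have "\<dots> \<le> b + K" using bnd[OF C0[OF f]] by simp
    finally show ?thesis .
  qed
  define d where "d n = Inf (P ` C n)" for n
  have bdd: "bdd_below (P ` C n)" for n by (rule bdd_belowI[of _ 0]) (auto simp: P0)
  have d_le: "d n \<le> P f" if "f \<in> C n" for f n unfolding d_def using that bdd by (intro cInf_lower) auto
  have "\<exists>f\<in>C n. P f < d n + 1 / real (Suc n)" for n
    using cInf_lessD[of "P ` C n" "d n + 1 / real (Suc n)"] ne[of n] by (auto simp: d_def)
  then obtain f where f: "\<And>n. f n \<in> C n" "\<And>n. P (f n) < d n + 1 / real (Suc n)" by metis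
  have "incseq d"
    unfolding incseq_Suc_iff d_def using dec ne bdd by (intro allI cInf_superset_mono) (auto intro: image_mono)
  moreover have "d n \<le> b + K" for n using d_le[OF f(1)] PK[OF f(1)] by (rule order_trans)
  ultimately have "convergent d" by (meson incseq_convergent convergentI)
  then have dC: "Cauchy d" by (rule convergent_Cauchy)
  define gap where "gap n m t = area (f n t) / 2 + area (f m t) / 2 - area ((1/2) *\<^sub>R (f n t + f m t))" for n m t
  have gap_cont: "continuous_on {0..b} (gap n m)" for n m
    unfolding gap_def using cont'[OF f(1)] by (intro continuous_intros) auto
  have gap_int: "(\<integral>t. gap n m t \<partial>leb 0 b) \<le> (d m - d n) / 2 + 1 / real (Suc n)" if nm: "n \<le> m" for n m
  proof -
    have fm: "f m \<in> C n" using f(1) anti[OF nm] by auto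
    \<comment> \<open>The midpoint is known to lie only in the larger set \<open>C n\<close>, so it
      is compared with \<open>d n\<close>; this is where the difference d m - d n comes
      from.\<close>
    have mid: "(\<lambda>t. (1/2) *\<^sub>R (f n t + f m t)) \<in> C n" by (rule conv[OF f(1) fm])
    have "(\<integral>t. gap n m t \<partial>leb 0 b) = P (f n) / 2 + P (f m) / 2 - P (\<lambda>t. (1/2) *\<^sub>R (f n t + f m t))"
      unfolding gap_def P_def using int_area[OF f(1)[of n]] int_area[OF f(1)[of m]] int_area[OF mid]
      by simp
    moreover have "d n \<le> P (\<lambda>t. (1/2) *\<^sub>R (f n t + f m t))" by (rule d_le[OF mid])
    moreover have "1 / real (Suc m) \<le> 1 / real (Suc n)" using nm by (simp add: frac_le)
    ultimately show ?thesis using f(2)[of n] f(2)[of m] by argo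
  qed
  have gap_small: "\<exists>N. \<forall>n\<ge>N. \<forall>m\<ge>n. (\<integral>t. gap n m t \<partial>leb 0 b) \<le> e" if e: "0 < e" for e
  proof -
    obtain N1 where N1: "\<And>m n. m \<ge> N1 \<Longrightarrow> n \<ge> N1 \<Longrightarrow> dist (d m) (d n) < e"
      using metric_CauchyD[OF dC e] by blast
    obtain N2 where N2: "inverse (real (Suc N2)) < e / 2" using reals_Archimedean[of "e/2"] e by auto
    have "(\<integral>t. gap n m t \<partial>leb 0 b) \<le> e" if "n \<ge> max N1 N2" "m \<ge> n" for n m
    proof -
      have "1 / real (Suc n) \<le> inverse (real (Suc N2))"
        using that by (simp add: field_simps)
      moreover have "d m - d n \<le> e" using N1[of m n] that by (auto simp: dist_real_def)
      ultimately show ?thesis using gap_int[OF that(2)] N2 by argo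
    qed
    then show ?thesis by blast
  qed
  have Cau: "\<exists>N. \<forall>n\<ge>N. \<forall>m\<ge>n. (\<integral>\<^sup>+t. norm (f n t - f m t) \<partial>leb a b) \<le> ennreal e"
    if a: "0 < a" "a < b" and e: "0 < e" for a e
  proof -
    \<comment> \<open>The estimate collects \<eta> b from the constant term, \<eta> from the gap,
      and 2 \<eta> from each of the two tails.\<close>
    define \<eta> where "\<eta> = e / (b + 5)"
    have \<eta>: "0 < \<eta>" using b e by (simp add: \<eta>_def)
    obtain R where R: "0 \<le> R" and Req: "\<And>f. f \<in> C 0 \<Longrightarrow>
      (\<integral>\<^sup>+t. ennreal (norm (f t) * indicator {R<..} (norm (f t))) \<partial>leb a b) \<le> ennreal \<eta>"
      using equi[OF a \<eta>] by blast
    define c where "c = 2 * (1 + R) ^ 3 / \<eta>"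
    have c: "0 < c" using R \<eta> by (simp add: c_def)
    obtain N where N: "\<And>n m. n \<ge> N \<Longrightarrow> m \<ge> n \<Longrightarrow> (\<integral>t. gap n m t \<partial>leb 0 b) \<le> \<eta> / c"
      using gap_small[of "\<eta> / c"] c \<eta> by auto
    have sub: "{a<..<b} \<subseteq> {0<..<b}" using a by auto
    have "(\<integral>\<^sup>+t. norm (f n t - f m t) \<partial>leb a b) \<le> ennreal e" if nm: "n \<ge> N" "m \<ge> n" for n m
    proof -
      define tl where "tl k t = norm (f k t) * indicator {R<..} (norm (f k t))" for k t
      have nf: "(\<lambda>t. norm (f k t)) \<in> borel_measurable (leb a b)" for k
        by (intro leb_norm_measurable strongly_measurable_leb_mono[OF strongly_measurable_continuous[OF cont'[OF f(1)]] sub])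
      have tlm: "tl k \<in> borel_measurable (leb a b)" for k
        unfolding tl_def using nf[of k] by measurable
      have gm: "gap n m \<in> borel_measurable (leb a b)"
        by (intro leb_borel_measurable strongly_measurable_leb_mono[OF strongly_measurable_continuous[OF gap_cont] sub])
      have gp: "0 \<le> \<eta> + c * gap n m t" for t
        using \<eta> c area_midpoint_convex[of "f n t" "f m t"] by (simp add: gap_def)
      have pt: "ennreal (norm (f n t - f m t)) \<le> (ennreal (\<eta> + c * gap n m t) + 2 * ennreal (tl n t)) + 2 * ennreal (tl m t)" for t
      proof -
        have tp: "0 \<le> tl k t" for k by (simp add: tl_def)
        have "norm (f n t - f m t) \<le> (\<eta> + c * gap n m t + 2 * tl n t) + 2 * tl m t"
          using norm_diff_le_area_gap[OF \<eta> R, of "f n t" "f m t"] by (simp add: gap_def c_def tl_def)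
        then have "ennreal (norm (f n t - f m t)) \<le> ennreal ((\<eta> + c * gap n m t + 2 * tl n t) + 2 * tl m t)"
          by (rule ennreal_leI)
        also have "\<dots> = (ennreal (\<eta> + c * gap n m t) + 2 * ennreal (tl n t)) + 2 * ennreal (tl m t)"
          by (intro ennreal_plus_twice gp tp)
        finally show ?thesis .
      qed
      have "(\<integral>\<^sup>+t. norm (f n t - f m t) \<partial>leb a b) \<le>
          (\<integral>\<^sup>+t. (ennreal (\<eta> + c * gap n m t) + 2 * ennreal (tl n t)) + 2 * ennreal (tl m t) \<partial>leb a b)"
        by (intro nn_integral_mono pt)
      also have "\<dots> = (\<integral>\<^sup>+t. ennreal (\<eta> + c * gap n m t) \<partial>leb a b) + 2 * (\<integral>\<^sup>+t. tl n t \<partial>leb a b)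
          + 2 * (\<integral>\<^sup>+t. tl m t \<partial>leb a b)"
      proof -
        have [measurable]: "gap n m \<in> borel_measurable (leb a b)" "tl k \<in> borel_measurable (leb a b)" for k
          by (rule gm tlm)+
        have m1: "(\<lambda>t. ennreal (\<eta> + c * gap n m t)) \<in> borel_measurable (leb a b)" by measurable
        have m2: "(\<lambda>t. ennreal (tl k t)) \<in> borel_measurable (leb a b)" for k by measurable
        have m3: "(\<lambda>t. 2 * ennreal (tl k t)) \<in> borel_measurable (leb a b)" for k by measurable
        show ?thesis
          by (simp only: nn_integral_add[OF borel_measurable_add[OF m1 m3] m3] nn_integral_add[OF m1 m3]
              nn_integral_cmult[OF m2])
      qed
      also have "\<dots> \<le> ennreal (\<eta> * b + \<eta>) + 2 * ennreal \<eta> + 2 * ennreal \<eta>"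
      proof (intro add_mono mult_left_mono)
        have "(\<integral>\<^sup>+t. ennreal (\<eta> + c * gap n m t) \<partial>leb a b) \<le> (\<integral>\<^sup>+t. ennreal (\<eta> + c * gap n m t) \<partial>leb 0 b)"
          by (rule nn_integral_leb_mono_set[OF sub])
        also have "\<dots> = ennreal (\<integral>t. \<eta> + c * gap n m t \<partial>leb 0 b)"
          using gap_cont[of n m] gp
          by (intro nn_integral_eq_integral integrable_continuous_leb continuous_intros AE_I2) auto
        also have "(\<integral>t. \<eta> + c * gap n m t \<partial>leb 0 b) = \<eta> * b + c * (\<integral>t. gap n m t \<partial>leb 0 b)"
          using integrable_continuous_leb[OF gap_cont[of n m]] by (simp add: mb)
        also have "\<dots> \<le> \<eta> * b + \<eta>"
          using mult_left_mono[OF N[OF nm], of c] c by simp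
        finally show "(\<integral>\<^sup>+t. ennreal (\<eta> + c * gap n m t) \<partial>leb a b) \<le> ennreal (\<eta> * b + \<eta>)"
          by (simp add: ennreal_leI)
      qed (use Req[OF C0[OF f(1)]] in \<open>auto simp: tl_def\<close>)
      also have "\<dots> = ennreal (\<eta> * b + \<eta> + 2 * \<eta> + 2 * \<eta>)"
        using \<eta> b by (intro ennreal_plus_twice[symmetric]) auto
      also have "\<eta> * b + \<eta> + 2 * \<eta> + 2 * \<eta> = \<eta> * (b + 5)"
        by (simp add: algebra_simps)
      also have "\<dots> = e" using b by (simp add: \<eta>_def)
      finally show ?thesis .
    qed
    then show ?thesis by blast
  qed
  show thesis
    using Cau
  proof (rule L1_Cauchy_AE_convergent[OF b strongly_measurable_continuous[OF cont'[OF f(1)]]])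
    fix r F assume r: "strict_mono r" and F: "strongly_measurable (leb 0 b) F"
      "AE t in leb 0 b. (\<lambda>n. f (r n) t) \<longlonglongrightarrow> F t"
      "\<And>a. 0 < a \<Longrightarrow> a < b \<Longrightarrow> (\<lambda>n. \<integral>\<^sup>+t. norm (f (r n) t - F t) \<partial>leb a b) \<longlonglongrightarrow> 0"
    have "f (r n) \<in> C n" for n using f(1) anti[OF seq_suble[OF r, of n]] by auto
    then show thesis using F by (rule that)
  qed
qed

section \<open>Semigroups and their adjoints\<close>

lemma C0_semigroup_simps:
  assumes "C0_semigroup S"
  shows "0 \<le> t \<Longrightarrow> bounded_linear (S t)" "S 0 x = x"
    "0 \<le> s \<Longrightarrow> 0 \<le> t \<Longrightarrow> S (s + t) x = S s (S t x)" "((\<lambda>t. S t x) \<longlongrightarrow> x) (at_right 0)"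
  using assms by (auto simp: C0_semigroup_def)

text \<open>Otherwise there are times \<open>t n\<close> tending to 0 with unbounded operator norms,
  although \<open>S (t n) x\<close> converges to x for each x; this contradicts uniform
  boundedness.\<close>

lemma C0_semigroup_bounded_near_0:
  fixes S :: "real \<Rightarrow> 'x::{real_inner,complete_space} \<Rightarrow> 'x"
  assumes S: "C0_semigroup S"
  shows "\<exists>\<delta>>0. \<exists>K\<ge>1. \<forall>t\<in>{0..\<delta>}. \<forall>x. norm (S t x) \<le> K * norm x"
proof (rule ccontr)
  assume c: "\<not> ?thesis"
  have "\<exists>t\<in>{0..1 / real (Suc n)}. \<not> onorm (S t) \<le> real (Suc n)" for n
  proof (rule ccontr)
    assume "\<not> ?thesis"
    then have "onorm (S t) \<le> real (Suc n)" if "t \<in> {0..1 / real (Suc n)}" for t using that by blast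
    then have "norm (S t x) \<le> real (Suc n) * norm x" if "t \<in> {0..1 / real (Suc n)}" for t x
      using onorm[OF C0_semigroup_simps(1)[OF S], of t x] that
      by (meson atLeastAtMost_iff mult_right_mono norm_ge_zero order_trans)
    moreover have "0 < 1 / real (Suc n)" "1 \<le> real (Suc n)" by auto
    ultimately show False using c by blast
  qed
  then obtain t where t: "\<And>n. t n \<in> {0..1 / real (Suc n)}" "\<And>n. \<not> onorm (S (t n)) \<le> real (Suc n)" by metis
  have t0: "t \<longlonglongrightarrow> 0"
    by (rule tendsto_sandwich[of "\<lambda>_. 0" _ _ "\<lambda>n. 1 / real (Suc n)"])
      (use t(1) in \<open>auto intro: LIMSEQ_Suc lim_1_over_n simp del: of_nat_Suc\<close>)
  have "\<exists>K. \<forall>n. onorm (S (t n)) \<le> K"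
  proof (rule uniform_boundedness)
    show "bounded_linear (S (t n))" for n using t(1)[of n] by (intro C0_semigroup_simps(1)[OF S]) auto
    fix x
    have "(\<lambda>n. S (t n) x) \<longlonglongrightarrow> x"
    proof (rule tendstoI)
      fix e :: real assume "0 < e"
      then have "\<forall>\<^sub>F h in at_right 0. dist (S h x) x < e"
        using C0_semigroup_simps(4)[OF S] by (rule tendstoD[rotated])
      then obtain d where d: "0 < d" "\<And>h. 0 < h \<Longrightarrow> h < d \<Longrightarrow> dist (S h x) x < e"
        unfolding eventually_at_right_field by auto
      have "\<forall>\<^sub>F n in sequentially. t n < d" using t0 d(1) by (rule order_tendstoD)
      then show "\<forall>\<^sub>F n in sequentially. dist (S (t n) x) x < e"
      proof eventually_elim
        case (elim n)
        then show ?case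
          using d(2)[of "t n"] t(1)[of n] C0_semigroup_simps(2)[OF S] \<open>0 < e\<close> by (cases "t n = 0") auto
      qed
    qed
    then have "Bseq (\<lambda>n. S (t n) x)" by (intro convergent_imp_Bseq) (auto simp: convergent_def)
    then show "\<exists>K. \<forall>n. norm (S (t n) x) \<le> K" by (auto simp: Bseq_def)
  qed
  then obtain K where K: "\<And>n. onorm (S (t n)) \<le> K" by blast
  obtain n where "K < real n" using reals_Archimedean2 by blast
  then show False using K[of n] t(2)[of n] by simp
qed

lemma C0_semigroup_bounded:
  fixes S :: "real \<Rightarrow> 'x::{real_inner,complete_space} \<Rightarrow> 'x"
  assumes S: "C0_semigroup S"
  obtains K where "1 \<le> K" "\<And>t x. 0 \<le> t \<Longrightarrow> t \<le> b \<Longrightarrow> norm (S t x) \<le> K * norm x"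
proof -
  obtain \<delta> K where \<delta>: "0 < \<delta>" and K1: "1 \<le> K"
    and K: "\<And>t x. 0 \<le> t \<Longrightarrow> t \<le> \<delta> \<Longrightarrow> norm (S t x) \<le> K * norm x"
    using C0_semigroup_bounded_near_0[OF S] by auto
  have "norm (S t x) \<le> K ^ n * norm x" if "0 \<le> t" "t \<le> real n * \<delta>" for n t x
    using that
  proof (induction n arbitrary: t x)
    case 0
    then show ?case using C0_semigroup_simps(2)[OF S] by simp
  next
    case (Suc n)
    show ?case
    proof (cases "t \<le> \<delta>")
      case True
      have "K \<le> K ^ Suc n" using K1 by (intro self_le_power) auto
      then show ?thesis using K[OF Suc.prems(1) True, of x] by (meson mult_right_mono norm_ge_zero order_trans)
    next
      case False
      have "S t x = S \<delta> (S (t - \<delta>) x)"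
        using C0_semigroup_simps(3)[OF S, of \<delta> "t - \<delta>" x] False \<delta> by simp
      also have "norm \<dots> \<le> K * norm (S (t - \<delta>) x)" using \<delta> by (intro K) auto
      also have "\<dots> \<le> K * (K ^ n * norm x)"
        using False Suc.prems K1 by (intro mult_left_mono Suc.IH) (auto simp: algebra_simps)
      finally show ?thesis by (simp add: mult_ac)
    qed
  qed
  moreover obtain n where "b / \<delta> \<le> real n" using real_arch_simple by blast
  moreover have "1 \<le> K ^ n" using K1 by simp
  ultimately show thesis
    using that[of "K ^ n"] \<delta> pos_divide_le_eq[OF \<delta>, of b "real n"] order_trans by blast
qed

text \<open>Factoring out the earlier of two times reduces both one-sided limits to the right limit
  at 0, at the cost of the local bound K.\<close>

lemma C0_semigroup_continuous:
  fixes S :: "real \<Rightarrow> 'x::{real_inner,complete_space} \<Rightarrow> 'x"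
  assumes S: "C0_semigroup S"
  shows "continuous_on {0..} (\<lambda>t. S t x)"
  unfolding continuous_on_iff
proof (intro ballI allI impI)
  fix t e :: real assume t: "t \<in> {0..}" and e: "0 < e"
  obtain K where K1: "1 \<le> K" and K: "\<And>s x. 0 \<le> s \<Longrightarrow> s \<le> t + 1 \<Longrightarrow> norm (S s x) \<le> K * norm x"
    using C0_semigroup_bounded[OF S, of "t + 1"] by metis
  have "\<forall>\<^sub>F h in at_right 0. dist (S h x) x < e / K"
    using C0_semigroup_simps(4)[OF S] e K1 by (intro tendstoD) auto
  then obtain d where d: "0 < d" "\<And>h. 0 < h \<Longrightarrow> h < d \<Longrightarrow> dist (S h x) x < e / K"
    unfolding eventually_at_right_field by auto
  have key: "dist (S r x) (S s x) < e" if "0 \<le> s" "s < r" "s \<le> t + 1" "r - s < d" for r s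
  proof -
    have "S r x = S s (S (r - s) x)" using C0_semigroup_simps(3)[OF S, of s "r - s" x] that by simp
    then have "S r x - S s x = S s (S (r - s) x - x)"
      using linear_simps(2)[OF C0_semigroup_simps(1)[OF S]] that by simp
    then have "dist (S r x) (S s x) \<le> K * dist (S (r - s) x) x"
      unfolding dist_norm using K that by simp
    also have "\<dots> < K * (e / K)" using d(2)[of "r - s"] that K1 by (intro mult_strict_left_mono) auto
    finally show ?thesis using K1 by simp
  qed
  show "\<exists>d>0. \<forall>s\<in>{0..}. dist s t < d \<longrightarrow> dist (S s x) (S t x) < e"
  proof (intro exI[of _ "min d 1"] conjI ballI impI)
    fix s assume s: "s \<in> {0..}" "dist s t < min d 1"
    consider "s = t" | "s < t" | "t < s" by linarith
    then show "dist (S s x) (S t x) < e"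
    proof cases
      case 1 then show ?thesis using e by simp
    next
      case 2 then show ?thesis using key[of s t] s by (simp add: dist_real_def dist_commute)
    next
      case 3 then show ?thesis using key[of t s] s t by (simp add: dist_real_def)
    qed
  qed (use d in simp)
qed

section \<open>The generator and weak integrals of orbits\<close>

locale hilbert_semigroup =
  fixes D :: "'x::{real_inner, complete_space} set" and A :: "'x \<Rightarrow> 'x" and S :: "real \<Rightarrow> 'x \<Rightarrow> 'x"
  assumes gen: "generates D A S"
begin

lemma S: "C0_semigroup S" using gen by (simp add: generates_def)

lemmas S_bl = C0_semigroup_simps(1)[OF S] and S_0 = C0_semigroup_simps(2)[OF S]
  and S_add = C0_semigroup_simps(3)[OF S] and S_right = C0_semigroup_simps(4)[OF S]
  and S_cont = C0_semigroup_continuous[OF S]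

lemma D_iff: "x \<in> D \<longleftrightarrow> (\<exists>y. ((\<lambda>h. (1 / h) *\<^sub>R (S h x - x)) \<longlongrightarrow> y) (at_right 0))"
  using gen by (auto simp: generates_def)

lemma A_lim: "x \<in> D \<Longrightarrow> ((\<lambda>h. (1 / h) *\<^sub>R (S h x - x)) \<longlongrightarrow> A x) (at_right 0)"
  using gen by (auto simp: generates_def)

lemma generatorI:
  assumes "((\<lambda>h. (1 / h) *\<^sub>R (S h x - x)) \<longlongrightarrow> y) (at_right 0)"
  shows "x \<in> D" "A x = y"
proof -
  show "x \<in> D" using assms D_iff by blast
  then show "A x = y" using tendsto_unique[OF _ A_lim assms] by simp
qed

lemma S_inner_cont: "continuous_on {0..} (\<lambda>s. S s x \<bullet> y)"
  by (intro continuous_intros S_cont)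

lemma S_inner_cont': "0 \<le> a \<Longrightarrow> continuous_on {a..b} (\<lambda>s. S s x \<bullet> y)"
  by (rule continuous_on_subset[OF S_inner_cont]) auto

lemma D_linear:
  assumes "x \<in> D" "y \<in> D"
  shows "a *\<^sub>R x + b *\<^sub>R y \<in> D" "A (a *\<^sub>R x + b *\<^sub>R y) = a *\<^sub>R A x + b *\<^sub>R A y"
proof -
  have "((\<lambda>h. a *\<^sub>R ((1 / h) *\<^sub>R (S h x - x)) + b *\<^sub>R ((1 / h) *\<^sub>R (S h y - y))) \<longlongrightarrow> a *\<^sub>R A x + b *\<^sub>R A y) (at_right 0)"
    by (intro tendsto_intros A_lim assms)
  moreover have "\<forall>\<^sub>F h in at_right 0. a *\<^sub>R ((1 / h) *\<^sub>R (S h x - x)) + b *\<^sub>R ((1 / h) *\<^sub>R (S h y - y))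
      = (1 / h) *\<^sub>R (S h (a *\<^sub>R x + b *\<^sub>R y) - (a *\<^sub>R x + b *\<^sub>R y))"
    using eventually_at_right_less[of 0]
  proof eventually_elim
    case (elim h)
    then have "S h (a *\<^sub>R x + b *\<^sub>R y) = a *\<^sub>R S h x + b *\<^sub>R S h y"
      using linear_simps(1,5)[OF S_bl[of h]] by simp
    then show ?case by (simp add: algebra_simps)
  qed
  ultimately have "((\<lambda>h. (1 / h) *\<^sub>R (S h (a *\<^sub>R x + b *\<^sub>R y) - (a *\<^sub>R x + b *\<^sub>R y))) \<longlongrightarrow> a *\<^sub>R A x + b *\<^sub>R A y) (at_right 0)"
    by (rule Lim_transform_eventually)
  then show "a *\<^sub>R x + b *\<^sub>R y \<in> D" "A (a *\<^sub>R x + b *\<^sub>R y) = a *\<^sub>R A x + b *\<^sub>R A y"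
    by (rule generatorI)+
qed

lemma S_D:
  assumes x: "x \<in> D" and t: "0 \<le> t"
  shows "S t x \<in> D" "A (S t x) = S t (A x)"
proof -
  have "((\<lambda>h. S t ((1 / h) *\<^sub>R (S h x - x))) \<longlongrightarrow> S t (A x)) (at_right 0)"
    by (rule bounded_linear.tendsto[OF S_bl[OF t] A_lim[OF x]])
  moreover have "\<forall>\<^sub>F h in at_right 0. S t ((1 / h) *\<^sub>R (S h x - x)) = (1 / h) *\<^sub>R (S h (S t x) - S t x)"
    using eventually_at_right_less[of 0]
  proof eventually_elim
    case (elim h)
    then have "S t (S h x) = S h (S t x)" using S_add[of t h x] S_add[of h t x] t by (simp add: add.commute)
    then show ?case using linear_simps(2,5)[OF S_bl[OF t]] by simp
  qed
  ultimately have "((\<lambda>h. (1 / h) *\<^sub>R (S h (S t x) - S t x)) \<longlongrightarrow> S t (A x)) (at_right 0)"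
    by (rule Lim_transform_eventually)
  then show "S t x \<in> D" "A (S t x) = S t (A x)" by (rule generatorI)+
qed

text \<open>The integral of an orbit is taken weakly: the integral of the library needs a codomain of
  class \<open>banach\<close>, which does not follow from the sort of the state space.\<close>

definition orbit_integral :: "real \<Rightarrow> 'x \<Rightarrow> 'x" where
  "orbit_integral t x = (SOME w. \<forall>y. w \<bullet> y = integral {0..t} (\<lambda>s. S s x \<bullet> y))"

lemma orbit_integral_inner:
  assumes t: "0 \<le> t"
  shows "orbit_integral t x \<bullet> y = integral {0..t} (\<lambda>s. S s x \<bullet> y)"
proof -
  obtain K where K: "1 \<le> K" "\<And>s x. 0 \<le> s \<Longrightarrow> s \<le> t \<Longrightarrow> norm (S s x) \<le> K * norm x"
    using C0_semigroup_bounded[OF S, of t] by metis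
  have io: "(\<lambda>s. S s x \<bullet> y) integrable_on {0..t}" for y
    by (intro integrable_continuous_interval S_inner_cont') simp
  have "\<exists>q\<in>UNIV. \<forall>y\<in>UNIV. integral {0..t} (\<lambda>s. S s x \<bullet> y) = q \<bullet> y"
  proof (rule Riesz_subspace)
    fix y z :: 'x and a b :: real
    show "integral {0..t} (\<lambda>s. S s x \<bullet> (a *\<^sub>R y + b *\<^sub>R z)) =
      a * integral {0..t} (\<lambda>s. S s x \<bullet> y) + b * integral {0..t} (\<lambda>s. S s x \<bullet> z)"
      using io by (simp add: inner_add_right integral_add integrable_on_mult_right)
    have "norm (integral {0..t} (\<lambda>s. S s x \<bullet> y)) \<le> (K * norm x * norm y) * (t - 0)"
    proof (rule integral_bound[OF t S_inner_cont'])
      fix s assume s: "s \<in> {0..t}"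
      have "norm (S s x \<bullet> y) \<le> norm (S s x) * norm y" by (simp add: Cauchy_Schwarz_ineq2)
      also have "\<dots> \<le> K * norm x * norm y" using s by (intro mult_right_mono K) auto
      finally show "norm (S s x \<bullet> y) \<le> K * norm x * norm y" .
    qed simp
    then show "\<bar>integral {0..t} (\<lambda>s. S s x \<bullet> y)\<bar> \<le> (K * norm x * t) * norm y" by (simp add: mult_ac)
  qed auto
  then have "\<exists>w. \<forall>y. w \<bullet> y = integral {0..t} (\<lambda>s. S s x \<bullet> y)" by (metis UNIV_I)
  then show ?thesis unfolding orbit_integral_def by (rule someI2_ex) simp
qed

lemma orbit_integral_diff_inner:
  assumes "0 \<le> a" "a \<le> b"
  shows "(orbit_integral b x - orbit_integral a x) \<bullet> y = integral {a..b} (\<lambda>s. S s x \<bullet> y)"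
  using Henstock_Kurzweil_Integration.integral_combine[of 0 a b "\<lambda>s. S s x \<bullet> y"] assms
  by (simp add: inner_diff_left orbit_integral_inner integrable_continuous_interval S_inner_cont')

text \<open>Pairing the weakly defined vector with itself recovers the norm estimate of a strong
  integral.\<close>

lemma orbit_integral_close:
  assumes ab: "0 \<le> a" "a \<le> b" and le: "\<And>s. s \<in> {a..b} \<Longrightarrow> norm (S s x - c) \<le> e"
  shows "norm (orbit_integral b x - orbit_integral a x - (b - a) *\<^sub>R c) \<le> (b - a) * e"
proof -
  define w where "w = orbit_integral b x - orbit_integral a x - (b - a) *\<^sub>R c"
  have cont: "continuous_on {a..b} (\<lambda>s. S s x \<bullet> w)" using ab(1) by (rule S_inner_cont')
  have "(norm w)\<^sup>2 = (orbit_integral b x - orbit_integral a x) \<bullet> w - (b - a) * (c \<bullet> w)"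
    unfolding power2_norm_eq_inner by (subst (1) w_def) (simp add: inner_diff_left)
  also have "\<dots> = integral {a..b} (\<lambda>s. S s x \<bullet> w) - integral {a..b} (\<lambda>s. c \<bullet> w)"
    using ab by (simp add: orbit_integral_diff_inner)
  also have "\<dots> = integral {a..b} (\<lambda>s. (S s x - c) \<bullet> w)"
    using cont by (subst integral_diff[symmetric]) (auto simp: inner_diff_left intro: integrable_continuous_interval)
  also have "\<dots> \<le> norm \<dots>" by simp
  also have "\<dots> \<le> (e * norm w) * (b - a)"
  proof (rule integral_bound[OF ab(2)])
    show "continuous_on {a..b} (\<lambda>s. (S s x - c) \<bullet> w)"
      using cont by (simp add: inner_diff_left continuous_on_diff)
    fix s assume s: "s \<in> {a..b}"
    have "norm ((S s x - c) \<bullet> w) \<le> norm (S s x - c) * norm w" by (simp add: Cauchy_Schwarz_ineq2)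
    also have "\<dots> \<le> e * norm w" using le[OF s] by (intro mult_right_mono) auto
    finally show "norm ((S s x - c) \<bullet> w) \<le> e * norm w" .
  qed
  finally have "norm w * norm w \<le> ((b - a) * e) * norm w" by (simp add: power2_eq_square mult_ac)
  moreover have "0 \<le> (b - a) * e"
    using ab order_trans[OF norm_ge_zero le[of a]] by (intro mult_nonneg_nonneg) auto
  ultimately show ?thesis unfolding w_def[symmetric] by (cases "w = 0") auto
qed

lemma orbit_integral_derivative:
  assumes t: "0 \<le> t"
  shows "((\<lambda>h. (1 / h) *\<^sub>R (orbit_integral (t + h) x - orbit_integral t x)) \<longlongrightarrow> S t x) (at_right 0)"
proof (rule tendstoI)
  fix e :: real assume e: "0 < e"
  obtain d where d: "0 < d" "\<And>s. 0 \<le> s \<Longrightarrow> dist s t < d \<Longrightarrow> dist (S s x) (S t x) < e / 2"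
    using S_cont[of x] t e unfolding continuous_on_iff
    by (metis atLeast_iff half_gt_zero)
  have "\<forall>\<^sub>F h in at_right 0. h < d" using d(1) eventually_at_right_real[of 0 d] by (auto elim: eventually_mono)
  then show "\<forall>\<^sub>F h in at_right 0. dist ((1 / h) *\<^sub>R (orbit_integral (t + h) x - orbit_integral t x)) (S t x) < e"
    using eventually_at_right_less[of 0]
  proof eventually_elim
    case (elim h)
    have "norm (orbit_integral (t + h) x - orbit_integral t x - (t + h - t) *\<^sub>R S t x) \<le> (t + h - t) * (e / 2)"
      using elim t d(2) by (intro orbit_integral_close) (auto simp: dist_norm less_imp_le)
    then have "norm (orbit_integral (t + h) x - orbit_integral t x - h *\<^sub>R S t x) / h \<le> e / 2"
      using elim by (simp add: pos_divide_le_eq mult_ac)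
    moreover have "(1 / h) *\<^sub>R (orbit_integral (t + h) x - orbit_integral t x) - S t x
        = (1 / h) *\<^sub>R (orbit_integral (t + h) x - orbit_integral t x - h *\<^sub>R S t x)"
      using elim by (simp add: scaleR_diff_right)
    ultimately have "dist ((1 / h) *\<^sub>R (orbit_integral (t + h) x - orbit_integral t x)) (S t x) \<le> e / 2"
      using elim by (simp only: dist_norm norm_scaleR) simp
    then show ?case by (rule le_less_trans) (use e in simp)
  qed
qed

lemma orbit_integral_0: "orbit_integral 0 x = 0"
proof -
  have "orbit_integral 0 x \<bullet> orbit_integral 0 x = 0" by (subst orbit_integral_inner) auto
  then show ?thesis by simp
qed

text \<open>The commutation form leads to \<open>orbit_integral_A\<close>; the form with shifted
  endpoints produces the difference quotient in \<open>orbit_integral_D\<close>.\<close>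

lemma S_orbit_integral:
  assumes "0 \<le> t" "0 \<le> h"
  shows "S h (orbit_integral t x) = orbit_integral t (S h x)"
    "S h (orbit_integral t x) = orbit_integral (t + h) x - orbit_integral h x"
proof -
  have *: "S h (orbit_integral t x) \<bullet> y = integral {0..t} (\<lambda>s. S h (S s x) \<bullet> y)" for y
    using assms by (simp add: adjoint_works_Hilbert[OF S_bl, symmetric] orbit_integral_inner)
  have **: "integral {0..t} (\<lambda>s. S h (S s x) \<bullet> y) = integral {0..t} (\<lambda>s. S (s + h) x \<bullet> y)" for y
    using assms S_add[of h _ x] by (intro Henstock_Kurzweil_Integration.integral_cong) (simp add: add.commute)
  have "integral {0..t} (\<lambda>s. S (s + h) x \<bullet> y) = orbit_integral t (S h x) \<bullet> y" for y
    unfolding orbit_integral_inner[OF assms(1)]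
    using assms S_add[of _ h x] by (intro Henstock_Kurzweil_Integration.integral_cong) simp
  then have "S h (orbit_integral t x) \<bullet> y = orbit_integral t (S h x) \<bullet> y" for y by (simp only: * **)
  then show "S h (orbit_integral t x) = orbit_integral t (S h x)" by (rule vector_eq_rdot[THEN iffD1, rule_format])
  have "integral {0..t} (\<lambda>s. S (s + h) x \<bullet> y) = (orbit_integral (t + h) x - orbit_integral h x) \<bullet> y" for y
    using assms Henstock_Kurzweil_Integration.integral_shift[of 0 h t "\<lambda>s. S s x \<bullet> y"]
    by (simp add: orbit_integral_diff_inner S_inner_cont' o_def add.commute)
  then have "S h (orbit_integral t x) \<bullet> y = (orbit_integral (t + h) x - orbit_integral h x) \<bullet> y" for y
    by (simp only: * **)
  then show "S h (orbit_integral t x) = orbit_integral (t + h) x - orbit_integral h x"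
    by (rule vector_eq_rdot[THEN iffD1, rule_format])
qed

lemma orbit_integral_D:
  assumes t: "0 \<le> t"
  shows "orbit_integral t x \<in> D" "A (orbit_integral t x) = S t x - x"
proof -
  have "((\<lambda>h. (1 / h) *\<^sub>R (orbit_integral (t + h) x - orbit_integral t x)
      - (1 / h) *\<^sub>R (orbit_integral (0 + h) x - orbit_integral 0 x)) \<longlongrightarrow> S t x - S 0 x) (at_right 0)"
    by (intro tendsto_diff orbit_integral_derivative t) simp
  moreover have "\<forall>\<^sub>F h in at_right 0. (1 / h) *\<^sub>R (orbit_integral (t + h) x - orbit_integral t x)
      - (1 / h) *\<^sub>R (orbit_integral (0 + h) x - orbit_integral 0 x)
      = (1 / h) *\<^sub>R (S h (orbit_integral t x) - orbit_integral t x)"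
    using eventually_at_right_less[of 0]
    by eventually_elim (use t in \<open>simp add: S_orbit_integral(2) orbit_integral_0 scaleR_diff_right\<close>)
  ultimately have "((\<lambda>h. (1 / h) *\<^sub>R (S h (orbit_integral t x) - orbit_integral t x)) \<longlongrightarrow> S t x - S 0 x) (at_right 0)"
    by (rule Lim_transform_eventually)
  then show "orbit_integral t x \<in> D" "A (orbit_integral t x) = S t x - x"
    using generatorI by (auto simp: S_0)
qed

lemma bounded_linear_orbit_integral:
  assumes t: "0 \<le> t"
  shows "bounded_linear (orbit_integral t)"
proof -
  obtain K where K: "1 \<le> K" "\<And>s x. 0 \<le> s \<Longrightarrow> s \<le> t \<Longrightarrow> norm (S s x) \<le> K * norm x"
    using C0_semigroup_bounded[OF S, of t] by metis
  have io: "(\<lambda>s. S s x \<bullet> y) integrable_on {0..t}" for x y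
    by (intro integrable_continuous_interval S_inner_cont') simp
  show ?thesis
  proof (rule bounded_linear_intro)
    fix x y :: 'x and r :: real
    have "orbit_integral t (x + y) \<bullet> z = (orbit_integral t x + orbit_integral t y) \<bullet> z" for z
    proof -
      have "integral {0..t} (\<lambda>s. S s (x + y) \<bullet> z) = integral {0..t} (\<lambda>s. S s x \<bullet> z + S s y \<bullet> z)"
        by (intro Henstock_Kurzweil_Integration.integral_cong)
          (simp add: linear_simps(1)[OF S_bl] inner_add_left)
      then show ?thesis using io by (simp add: orbit_integral_inner[OF t] inner_add_left integral_add)
    qed
    then show "orbit_integral t (x + y) = orbit_integral t x + orbit_integral t y"
      by (rule vector_eq_rdot[THEN iffD1, rule_format])
    have "orbit_integral t (r *\<^sub>R x) \<bullet> z = (r *\<^sub>R orbit_integral t x) \<bullet> z" for z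
    proof -
      have "integral {0..t} (\<lambda>s. S s (r *\<^sub>R x) \<bullet> z) = integral {0..t} (\<lambda>s. r * (S s x \<bullet> z))"
        by (intro Henstock_Kurzweil_Integration.integral_cong)
          (simp add: linear_simps(5)[OF S_bl])
      then show ?thesis by (simp add: orbit_integral_inner[OF t])
    qed
    then show "orbit_integral t (r *\<^sub>R x) = r *\<^sub>R orbit_integral t x"
      by (rule vector_eq_rdot[THEN iffD1, rule_format])
    have "norm (orbit_integral t x - orbit_integral 0 x - (t - 0) *\<^sub>R 0) \<le> (t - 0) * (K * norm x)"
      using t K(2) by (intro orbit_integral_close) auto
    then show "norm (orbit_integral t x) \<le> norm x * (t * K)" by (simp add: orbit_integral_0 mult_ac)
  qed
qed

text \<open>Together with \<open>orbit_integral_D\<close> this says that the generator commutes with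
  the orbit integral. It is what places the range of the adjoint of the orbit integral inside
  \<open>Ds\<close>.\<close>

lemma orbit_integral_A:
  assumes t: "0 \<le> t" and x: "x \<in> D"
  shows "orbit_integral t (A x) = S t x - x"
proof -
  have "((\<lambda>h. orbit_integral t ((1 / h) *\<^sub>R (S h x - x))) \<longlongrightarrow> orbit_integral t (A x)) (at_right 0)"
    by (rule bounded_linear.tendsto[OF bounded_linear_orbit_integral[OF t] A_lim[OF x]])
  moreover have "\<forall>\<^sub>F h in at_right 0. orbit_integral t ((1 / h) *\<^sub>R (S h x - x))
      = (1 / h) *\<^sub>R (S h (orbit_integral t x) - orbit_integral t x)"
    using eventually_at_right_less[of 0]
    by eventually_elim (use t in \<open>simp add: S_orbit_integral(1)
      linear_simps(2,5)[OF bounded_linear_orbit_integral[OF t]]\<close>)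
  ultimately have "((\<lambda>h. (1 / h) *\<^sub>R (S h (orbit_integral t x) - orbit_integral t x)) \<longlongrightarrow> orbit_integral t (A x)) (at_right 0)"
    by (rule Lim_transform_eventually)
  then show ?thesis using generatorI(2) orbit_integral_D(2)[OF t] by metis
qed

lemma orbit_integral_average: "((\<lambda>h. (1 / h) *\<^sub>R orbit_integral h x) \<longlongrightarrow> x) (at_right 0)"
  using orbit_integral_derivative[of 0 x] by (simp add: orbit_integral_0 S_0)

text \<open>The averages of the orbit of w over (0, h) lie in the domain and tend to w, so w is
  orthogonal to itself.\<close>

lemma D_orthogonal_trivial:
  assumes "\<And>x. x \<in> D \<Longrightarrow> x \<bullet> w = 0" shows "w = 0"
proof -
  have "((\<lambda>h. ((1 / h) *\<^sub>R orbit_integral h w) \<bullet> w) \<longlongrightarrow> w \<bullet> w) (at_right 0)"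
    by (intro tendsto_intros orbit_integral_average)
  moreover have "\<forall>\<^sub>F h in at_right 0. ((1 / h) *\<^sub>R orbit_integral h w) \<bullet> w = 0"
    using eventually_at_right_less[of 0] by eventually_elim (simp add: assms orbit_integral_D(1))
  ultimately have "((\<lambda>h. 0) \<longlongrightarrow> w \<bullet> w) (at_right (0::real))" by (rule Lim_transform_eventually)
  then show ?thesis by (simp add: tendsto_const_iff)
qed

end

section \<open>The adjoint generator and the adjoint semigroup\<close>

context hilbert_semigroup
begin

abbreviation "Ds \<equiv> adj_dom D A"
abbreviation "As \<equiv> adj_op D A"
abbreviation "Sa \<equiv> adj_semigroup S"

lemma S_bounded_at:
  assumes t: "0 \<le> t"
  shows "\<exists>K\<ge>1. \<forall>x. norm (S t x) \<le> K * norm x"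
proof -
  obtain K where "1 \<le> K" "\<And>s x. 0 \<le> s \<Longrightarrow> s \<le> t \<Longrightarrow> norm (S s x) \<le> K * norm x"
    using C0_semigroup_bounded[OF S, of t] by metis
  then show ?thesis using t by auto
qed

lemma Sa_inner: "0 \<le> t \<Longrightarrow> x \<bullet> Sa t y = S t x \<bullet> y"
  unfolding adj_semigroup_def by (rule adjoint_works_Hilbert[OF S_bl])

text \<open>Density of the domain, in its orthogonality form, makes the vector in the definite
  description of \<open>adj_op\<close> unique.\<close>

lemma adj_opI:
  assumes "\<And>x. x \<in> D \<Longrightarrow> A x \<bullet> z = x \<bullet> w"
  shows "z \<in> Ds" "As z = w"
proof -
  show "z \<in> Ds" using assms by (auto simp: adj_dom_def)
  show "As z = w" unfolding adj_op_def
  proof (rule the_equality)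
    show "\<forall>x\<in>D. A x \<bullet> z = x \<bullet> w" using assms by blast
    fix w' assume "\<forall>x\<in>D. A x \<bullet> z = x \<bullet> w'"
    then have "x \<bullet> (w' - w) = 0" if "x \<in> D" for x using assms that by (simp add: inner_diff_right)
    then show "w' = w" using D_orthogonal_trivial by (metis right_minus_eq)
  qed
qed

lemma As_inner: "z \<in> Ds \<Longrightarrow> x \<in> D \<Longrightarrow> A x \<bullet> z = x \<bullet> As z"
  using adj_opI(2) unfolding adj_dom_def by blast

lemma Ds_linear:
  assumes "z \<in> Ds" "w \<in> Ds"
  shows "a *\<^sub>R z + b *\<^sub>R w \<in> Ds" "As (a *\<^sub>R z + b *\<^sub>R w) = a *\<^sub>R As z + b *\<^sub>R As w"
proof -
  have "A x \<bullet> (a *\<^sub>R z + b *\<^sub>R w) = x \<bullet> (a *\<^sub>R As z + b *\<^sub>R As w)" if "x \<in> D" for x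
    using that assms by (simp add: inner_add_right As_inner)
  then show "a *\<^sub>R z + b *\<^sub>R w \<in> Ds" "As (a *\<^sub>R z + b *\<^sub>R w) = a *\<^sub>R As z + b *\<^sub>R As w"
    using adj_opI by blast+
qed

lemma Ds_0: "0 \<in> Ds" "As 0 = 0"
  using adj_opI[of 0 0] by auto

lemma Ds_subspace: "subspace Ds"
  unfolding subspace_def using Ds_0 Ds_linear(1)[of _ _ 1 1] Ds_linear(1)[of _ 0 _ 0] by auto

lemma Ds_diff: "z \<in> Ds \<Longrightarrow> w \<in> Ds \<Longrightarrow> z - w \<in> Ds" "z \<in> Ds \<Longrightarrow> w \<in> Ds \<Longrightarrow> As (z - w) = As z - As w"
  using Ds_linear[of z w 1 "-1"] by auto

lemma Ds_scale: "z \<in> Ds \<Longrightarrow> a *\<^sub>R z \<in> Ds" "z \<in> Ds \<Longrightarrow> As (a *\<^sub>R z) = a *\<^sub>R As z"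
  using Ds_linear[of z z a 0] by auto

lemma Sa_Ds:
  assumes "z \<in> Ds" "0 \<le> t"
  shows "Sa t z \<in> Ds" "As (Sa t z) = Sa t (As z)"
proof -
  have "A x \<bullet> Sa t z = x \<bullet> Sa t (As z)" if "x \<in> D" for x
    using that assms by (simp add: Sa_inner S_D(2)[symmetric] As_inner S_D(1))
  then show "Sa t z \<in> Ds" "As (Sa t z) = Sa t (As z)" using adj_opI by blast+
qed

lemma Sa_bound:
  assumes t: "0 \<le> t" and K: "\<And>x. norm (S t x) \<le> K * norm x"
  shows "norm (Sa t y) \<le> K * norm y"
proof -
  have "norm (Sa t y) * norm (Sa t y) = S t (Sa t y) \<bullet> y"
    using Sa_inner[OF t, of "Sa t y" y] by (simp add: power2_norm_eq_inner flip: power2_eq_square)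
  also have "\<dots> \<le> norm (S t (Sa t y)) * norm y" by (rule norm_cauchy_schwarz)
  also have "\<dots> \<le> (K * norm (Sa t y)) * norm y" by (intro mult_right_mono K) auto
  finally have "norm (Sa t y) * norm (Sa t y) \<le> (K * norm y) * norm (Sa t y)" by (simp add: mult_ac)
  moreover have "0 \<le> K * norm y"
  proof (cases "y = 0")
    case False
    have "0 \<le> K * norm y" using order_trans[OF norm_ge_zero K[of y]] .
    then show ?thesis .
  qed simp
  ultimately show ?thesis by (cases "Sa t y = 0") auto
qed

lemma Sa_linear:
  assumes "0 \<le> t"
  shows "Sa t (a *\<^sub>R x + b *\<^sub>R y) = a *\<^sub>R Sa t x + b *\<^sub>R Sa t y"
  by (rule vector_eq_ldot[THEN iffD1, rule_format]) (simp add: assms Sa_inner inner_add_right)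

lemma Sa_diff: "0 \<le> t \<Longrightarrow> Sa t (x - y) = Sa t x - Sa t y"
  using Sa_linear[of t 1 x "-1" y] by simp

lemma Sa_add: "0 \<le> s \<Longrightarrow> 0 \<le> t \<Longrightarrow> Sa (s + t) x = Sa s (Sa t x)"
  by (rule vector_eq_ldot[THEN iffD1, rule_format]) (simp add: Sa_inner S_add[symmetric] add.commute)

lemma Sa_0: "Sa 0 x = x"
  by (rule vector_eq_ldot[THEN iffD1, rule_format]) (simp add: Sa_inner S_0)

text \<open>Pairing x = \<open>Sa t z - z\<close> with itself produces \<open>S t x - x\<close>,
  which is the generator applied to an orbit integral. Moving the generator onto z gives the rate
  without integrating adjoint orbits, whose continuity is not yet known.\<close>

lemma Sa_diff_bound:
  assumes z: "z \<in> Ds" and t: "0 \<le> t" and K: "\<And>s x. 0 \<le> s \<Longrightarrow> s \<le> t \<Longrightarrow> norm (S s x) \<le> K * norm x"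
  shows "norm (Sa t z - z) \<le> t * K * norm (As z)"
proof -
  define x where "x = Sa t z - z"
  have "norm x * norm x = x \<bullet> Sa t z - x \<bullet> z" 
    by (simp add: x_def power2_norm_eq_inner inner_diff_right flip: power2_eq_square)
  also have "\<dots> = A (orbit_integral t x) \<bullet> z"
    using t by (simp add: Sa_inner orbit_integral_D(2) inner_diff_left)
  also have "\<dots> = orbit_integral t x \<bullet> As z" by (rule As_inner[OF z orbit_integral_D(1)[OF t]])
  also have "\<dots> \<le> norm (orbit_integral t x) * norm (As z)" by (rule norm_cauchy_schwarz)
  also have "\<dots> \<le> (t * (K * norm x)) * norm (As z)"
  proof (intro mult_right_mono)
    have "norm (orbit_integral t x - orbit_integral 0 x - (t - 0) *\<^sub>R 0) \<le> (t - 0) * (K * norm x)"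
      using t K by (intro orbit_integral_close) auto
    then show "norm (orbit_integral t x) \<le> t * (K * norm x)" by (simp add: orbit_integral_0)
  qed simp
  finally have "norm x * norm x \<le> (t * K * norm (As z)) * norm x" by (simp add: mult_ac)
  moreover have "0 \<le> t * (K * norm (As z))"
    by (intro mult_nonneg_nonneg[OF t] order_trans[OF norm_ge_zero K[of 0 "As z"]]) (use t in auto)
  ultimately show ?thesis unfolding x_def[symmetric] by (cases "x = 0") (auto simp: mult_ac)
qed

text \<open>The adjoint of the orbit integral maps into \<open>Ds\<close>. A vector y orthogonal to
  \<open>Ds\<close> thus has vanishing orbit integrals, while their averages tend to y.\<close>

lemma Ds_dense: "closure Ds = UNIV"
proof (rule subspace_dense_iff_orthogonal_trivial[OF Ds_subspace])
  fix y assume y: "\<And>z. z \<in> Ds \<Longrightarrow> y \<bullet> z = 0"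
  have "orbit_integral t y = 0" if t: "0 \<le> t" for t
  proof -
    have "orbit_integral t y \<bullet> x = 0" for x
    proof -
      have bl: "bounded_linear (orbit_integral t)" by (rule bounded_linear_orbit_integral[OF t])
      have "A w \<bullet> adjoint (orbit_integral t) x = w \<bullet> (Sa t x - x)" if "w \<in> D" for w
        using that t by (simp add: adjoint_works_Hilbert[OF bl] orbit_integral_A inner_diff_left inner_diff_right Sa_inner)
      then have "adjoint (orbit_integral t) x \<in> Ds" by (rule adj_opI(1))
      then show ?thesis using y adjoint_works_Hilbert[OF bl] by metis
    qed
    then show ?thesis by (metis inner_eq_zero_iff)
  qed
  then have "\<forall>\<^sub>F h in at_right 0. (1 / h) *\<^sub>R orbit_integral h y = 0"
    using eventually_at_right_less[of 0] by (auto elim: eventually_mono)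
  then have "((\<lambda>h. 0) \<longlongrightarrow> y) (at_right (0::real))" by (rule Lim_transform_eventually[OF orbit_integral_average])
  then show "y = 0" by (simp add: tendsto_const_iff)
qed

lemma Ds_orthogonal_trivial:
  assumes "\<And>z. z \<in> Ds \<Longrightarrow> w \<bullet> z = 0" shows "w = 0"
proof -
  have "closed {y. w \<bullet> y = 0}" by (intro closed_Collect_eq continuous_intros)
  then have "closure Ds \<subseteq> {y. w \<bullet> y = 0}" by (intro closure_minimal) (use assms in auto)
  then have "w \<bullet> w = 0" using Ds_dense by blast
  then show ?thesis by simp
qed

text \<open>Only strong continuity needs an argument. It holds on the dense set \<open>Ds\<close>
  with the rate \<open>t * K * norm (As z)\<close>, and the bound K near 0 carries it to all vectors
  in three steps of size e / 3.\<close>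

lemma Sa_C0: "C0_semigroup Sa"
  unfolding C0_semigroup_def
proof (intro conjI allI impI)
  fix t :: real assume t: "0 \<le> t"
  obtain K where K: "\<And>x. norm (S t x) \<le> K * norm x"
    using S_bounded_at[OF t] by blast
  show "bounded_linear (Sa t)"
    by (rule bounded_linear_intro[where K = K])
      (use Sa_linear[OF t, of 1 _ 1] Sa_linear[OF t, of _ _ 0 0] Sa_bound[OF t K] in \<open>auto simp: mult.commute\<close>)
next
  show "Sa 0 = id" by (auto simp: Sa_0)
next
  fix s t :: real assume "0 \<le> s" "0 \<le> t" then show "Sa (s + t) = Sa s \<circ> Sa t" by (auto simp: Sa_add)
next
  fix x
  show "((\<lambda>t. Sa t x) \<longlongrightarrow> x) (at_right 0)"
  proof (rule tendstoI)
    fix e :: real assume e: "0 < e"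
    obtain K where K1: "1 \<le> K" and K: "\<And>s x. 0 \<le> s \<Longrightarrow> s \<le> 1 \<Longrightarrow> norm (S s x) \<le> K * norm x"
      using C0_semigroup_bounded[OF S, of 1] by metis
    define \<delta> where "\<delta> = e / (3 * K)"
    have \<delta>: "0 < \<delta>" "K * \<delta> = e / 3" "\<delta> \<le> e / 3"
      using e K1 by (auto simp: \<delta>_def divide_simps)
    have "x \<in> closure Ds" by (simp add: Ds_dense)
    then obtain z where z: "z \<in> Ds" "dist z x < \<delta>" using \<delta>(1) closure_approachable by blast
    define r where "r = min 1 (e / (3 * (K * norm (As z) + 1)))"
    have N: "0 \<le> K * norm (As z)" using K1 by simp
    have r: "0 < r" using e N by (simp add: r_def)
    have "\<forall>\<^sub>F t in at_right 0. t < r" using eventually_at_right_real[OF r] by (auto elim: eventually_mono)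
    then show "\<forall>\<^sub>F t in at_right 0. dist (Sa t x) x < e"
      using eventually_at_right_less[of 0]
    proof eventually_elim
      case (elim t)
      have t1: "t \<le> 1" using elim by (simp add: r_def)
      have "norm (Sa t (x - z)) \<le> K * norm (x - z)"
        using elim t1 by (intro Sa_bound K) auto
      also have "\<dots> \<le> K * \<delta>" using z K1 by (intro mult_left_mono) (auto simp: dist_norm norm_minus_commute)
      finally have 1: "norm (Sa t (x - z)) \<le> e / 3" using \<delta> by simp
      have "norm (Sa t z - z) \<le> t * K * norm (As z)"
        using elim t1 by (intro Sa_diff_bound[OF z(1)] K) auto
      also have "\<dots> \<le> (e / (3 * (K * norm (As z) + 1))) * (K * norm (As z))"
        using elim N by (simp only: mult.assoc) (intro mult_right_mono, auto simp: r_def)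
      also have "\<dots> \<le> e / 3"
      proof -
        have "e / (3 * (q + 1)) * q \<le> e / 3" if "0 \<le> q" for q :: real
          using that e by (simp add: divide_simps)
        then show ?thesis using N by blast
      qed
      finally have 2: "norm (Sa t z - z) \<le> e / 3" .
      have 3: "norm (z - x) < e / 3" using z(2) \<delta>(3) by (simp add: dist_norm)
      have "Sa t x - x = Sa t (x - z) + (Sa t z - z) + (z - x)"
        using elim by (simp add: Sa_diff)
      then have "norm (Sa t x - x) \<le> norm (Sa t (x - z)) + norm (Sa t z - z) + norm (z - x)"
        using norm_triangle_ineq[of "Sa t (x - z) + (Sa t z - z)" "z - x"] norm_triangle_ineq[of "Sa t (x - z)" "Sa t z - z"]
        by simp
      then show ?case using 1 2 3 by (simp add: dist_norm)
    qed
  qed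
qed

lemma Sa_cont: "continuous_on {0..} (\<lambda>t. Sa t x)"
  by (rule C0_semigroup_continuous[OF Sa_C0])

section \<open>Functionals in the extrapolation space and the extended semigroup\<close>

lemma graph_norm_Pair: "graph_norm D A z = norm (z, As z)"
  by (simp add: graph_norm_def norm_Pair)

lemma graph_norm_nonneg: "0 \<le> graph_norm D A z"
  by (simp add: graph_norm_Pair)

lemma graph_norm_scale: "z \<in> Ds \<Longrightarrow> graph_norm D A (a *\<^sub>R z) = \<bar>a\<bar> * graph_norm D A z"
  unfolding graph_norm_Pair by (simp add: Ds_scale norm_scaleR[symmetric] del: norm_scaleR)

lemma graph_norm_bounds: "norm z \<le> graph_norm D A z" "norm (As z) \<le> graph_norm D A z"
  unfolding graph_norm_Pair using norm_fst_le[of z "As z"] norm_snd_le[of "As z" z] by simp_all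

lemma Xm1_lin: "\<phi> \<in> Xm1 D A \<Longrightarrow> z \<in> Ds \<Longrightarrow> w \<in> Ds \<Longrightarrow> \<phi> (a *\<^sub>R z + b *\<^sub>R w) = a * \<phi> z + b * \<phi> w"
  by (simp add: Xm1_def)

lemma Xm1_scale: "\<phi> \<in> Xm1 D A \<Longrightarrow> z \<in> Ds \<Longrightarrow> \<phi> (a *\<^sub>R z) = a * \<phi> z"
  using Xm1_lin[of \<phi> z z a 0] by simp

lemma Xm1_outside: "\<phi> \<in> Xm1 D A \<Longrightarrow> z \<notin> Ds \<Longrightarrow> \<phi> z = 0"
  by (simp add: Xm1_def)

lemma Xm1_I:
  assumes "\<And>z. z \<notin> Ds \<Longrightarrow> \<phi> z = 0"
    "\<And>z w a b. z \<in> Ds \<Longrightarrow> w \<in> Ds \<Longrightarrow> \<phi> (a *\<^sub>R z + b *\<^sub>R w) = a * \<phi> z + b * \<phi> w"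
    "\<And>z. z \<in> Ds \<Longrightarrow> \<bar>\<phi> z\<bar> \<le> C * graph_norm D A z"
  shows "\<phi> \<in> Xm1 D A"
  using assms unfolding Xm1_def by blast

lemma Xm1_bounded: "\<phi> \<in> Xm1 D A \<Longrightarrow> \<exists>C. \<forall>z\<in>Ds. \<bar>\<phi> z\<bar> \<le> C * graph_norm D A z"
  by (simp add: Xm1_def)

lemma Xm1_combine:
  assumes "\<phi> \<in> Xm1 D A" "\<psi> \<in> Xm1 D A"
  shows "(\<lambda>z. a * \<phi> z + b * \<psi> z) \<in> Xm1 D A"
proof -
  obtain C1 C2 where C: "\<And>z. z \<in> Ds \<Longrightarrow> \<bar>\<phi> z\<bar> \<le> C1 * graph_norm D A z" "\<And>z. z \<in> Ds \<Longrightarrow> \<bar>\<psi> z\<bar> \<le> C2 * graph_norm D A z"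
    using Xm1_bounded[OF assms(1)] Xm1_bounded[OF assms(2)] by blast
  have 1: "\<bar>a * \<phi> z + b * \<psi> z\<bar> \<le> (\<bar>a\<bar> * C1 + \<bar>b\<bar> * C2) * graph_norm D A z" if z: "z \<in> Ds" for z
  proof -
    have "\<bar>a * \<phi> z + b * \<psi> z\<bar> \<le> \<bar>a\<bar> * \<bar>\<phi> z\<bar> + \<bar>b\<bar> * \<bar>\<psi> z\<bar>"
      using abs_triangle_ineq[of "a * \<phi> z" "b * \<psi> z"] by (simp add: abs_mult)
    also have "\<dots> \<le> \<bar>a\<bar> * (C1 * graph_norm D A z) + \<bar>b\<bar> * (C2 * graph_norm D A z)"
      by (intro add_mono mult_left_mono C z) auto
    finally show ?thesis by (simp add: algebra_simps)
  qed
  have 2: "a * \<phi> (c *\<^sub>R z + d *\<^sub>R w) + b * \<psi> (c *\<^sub>R z + d *\<^sub>R w)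
      = c * (a * \<phi> z + b * \<psi> z) + d * (a * \<phi> w + b * \<psi> w)" if "z \<in> Ds" "w \<in> Ds" for z w c d
    using that by (simp add: Xm1_lin[OF assms(1)] Xm1_lin[OF assms(2)] algebra_simps)
  show ?thesis
    by (rule Xm1_I[where C = "\<bar>a\<bar> * C1 + \<bar>b\<bar> * C2"]) (auto simp: Xm1_outside[OF assms(1)] Xm1_outside[OF assms(2)] 2 1)
qed

lemma Xm1_diff: "\<phi> \<in> Xm1 D A \<Longrightarrow> \<psi> \<in> Xm1 D A \<Longrightarrow> (\<lambda>z. \<phi> z - \<psi> z) \<in> Xm1 D A"
  using Xm1_combine[of \<phi> \<psi> 1 "-1"] by simp

lemma Xm1_zero: "(\<lambda>z. 0) \<in> Xm1 D A"
  by (rule Xm1_I[of _ 0]) auto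

lemma Xm1_sum:
  "(\<And>i. i \<in> I \<Longrightarrow> \<phi> i \<in> Xm1 D A) \<Longrightarrow> (\<lambda>z. \<Sum>i\<in>I. c i * \<phi> i z) \<in> Xm1 D A"
proof (induction I rule: infinite_finite_induct)
  case (insert i I)
  then show ?case using Xm1_combine[of "\<phi> i" "\<lambda>z. \<Sum>i\<in>I. c i * \<phi> i z" "c i" 1] by simp
qed (auto simp: Xm1_zero)

lemma norm_Xm1_le:
  assumes "\<And>z. z \<in> Ds \<Longrightarrow> \<bar>\<phi> z\<bar> \<le> C * graph_norm D A z" "0 \<le> C"
  shows "norm_Xm1 D A \<phi> \<le> C"
  unfolding norm_Xm1_def
proof (rule cSUP_least)
  show "{z \<in> Ds. graph_norm D A z \<le> 1} \<noteq> {}" using Ds_0 by (auto simp: graph_norm_def intro!: exI[of _ 0])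
  fix z assume "z \<in> {z \<in> Ds. graph_norm D A z \<le> 1}"
  then show "\<bar>\<phi> z\<bar> \<le> C" using assms(1)[of z] mult_left_le[of "graph_norm D A z" C] assms(2) by auto
qed

lemma norm_Xm1_unit:
  assumes \<phi>: "\<phi> \<in> Xm1 D A" and z: "z \<in> Ds" "graph_norm D A z \<le> 1"
  shows "\<bar>\<phi> z\<bar> \<le> norm_Xm1 D A \<phi>"
proof -
  obtain C where C: "\<And>z. z \<in> Ds \<Longrightarrow> \<bar>\<phi> z\<bar> \<le> C * graph_norm D A z" using Xm1_bounded[OF \<phi>] by blast
  have "bdd_above ((\<lambda>z. \<bar>\<phi> z\<bar>) ` {z \<in> Ds. graph_norm D A z \<le> 1})"
  proof (rule bdd_aboveI2)
    fix w assume w: "w \<in> {z \<in> Ds. graph_norm D A z \<le> 1}"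
    then have "\<bar>\<phi> w\<bar> \<le> C * graph_norm D A w" using C by blast
    also have "\<dots> \<le> \<bar>C\<bar> * 1" using w graph_norm_nonneg by (intro mult_mono) auto
    finally show "\<bar>\<phi> w\<bar> \<le> \<bar>C\<bar>" by simp
  qed
  then show ?thesis unfolding norm_Xm1_def using z by (intro cSUP_upper) auto
qed

lemma norm_Xm1_nonneg: "\<phi> \<in> Xm1 D A \<Longrightarrow> 0 \<le> norm_Xm1 D A \<phi>"
  using norm_Xm1_unit[of \<phi> 0] Ds_0 by (simp add: graph_norm_def)

lemma norm_Xm1_bound:
  assumes \<phi>: "\<phi> \<in> Xm1 D A" and z: "z \<in> Ds"
  shows "\<bar>\<phi> z\<bar> \<le> norm_Xm1 D A \<phi> * graph_norm D A z"
proof (cases "graph_norm D A z = 0")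
  case True
  then have "z = 0" using graph_norm_bounds(1)[of z] by simp
  then show ?thesis using Xm1_scale[OF \<phi> z, of 0] True by simp
next
  case False
  define g where "g = graph_norm D A z"
  have g: "0 < g" using False graph_norm_nonneg[of z] by (simp add: g_def)
  have "graph_norm D A ((1 / g) *\<^sub>R z) \<le> 1" using g by (simp add: graph_norm_scale[OF z] g_def)
  then have "\<bar>\<phi> ((1 / g) *\<^sub>R z)\<bar> \<le> norm_Xm1 D A \<phi>" by (intro norm_Xm1_unit \<phi> Ds_scale z)
  then show ?thesis using g by (simp add: Xm1_scale[OF \<phi> z] abs_mult g_def[symmetric] field_simps)
qed

lemma emb_Xm1: "emb D A x \<in> Xm1 D A"
proof -
  have "\<bar>x \<bullet> z\<bar> \<le> norm x * graph_norm D A z" for z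
    using Cauchy_Schwarz_ineq2[of x z] mult_left_mono[OF graph_norm_bounds(1)[of z] norm_ge_zero[of x]]
    by (rule order_trans)
  then show ?thesis
    by (intro Xm1_I) (auto simp: emb_def Ds_linear(1) inner_add_right)
qed

text \<open>A functional bounded in the graph norm is a bounded functional on the graph of
  \<open>As\<close>, a closed subspace of the product space, and Riesz representation there yields a
  pair of vectors. Closedness of the graph follows by passing to the limit in the defining identity
  of the adjoint.\<close>

lemma Xm1_representation:
  assumes \<phi>: "\<phi> \<in> Xm1 D A"
  shows "\<exists>q1 q2. \<forall>z\<in>Ds. \<phi> z = q1 \<bullet> z + q2 \<bullet> As z"
proof -
  define G where "G = {(z, As z) | z. z \<in> Ds}"
  have sub: "subspace G"
    unfolding subspace_def G_def
    using Ds_0 Ds_linear[of _ _ 1 1] Ds_scale by (force simp: zero_prod_def)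
  have cl: "closed G"
    unfolding closed_sequential_limits
  proof (intro allI impI, elim conjE)
    fix p l assume p: "\<forall>n. p n \<in> G" "p \<longlonglongrightarrow> l"
    have p1: "fst (p n) \<in> Ds" "snd (p n) = As (fst (p n))" for n using p(1)[rule_format, of n] by (auto simp: G_def)
    have l1: "(\<lambda>n. fst (p n)) \<longlonglongrightarrow> fst l" by (rule tendsto_fst[OF p(2)])
    have l2: "(\<lambda>n. As (fst (p n))) \<longlonglongrightarrow> snd l" using tendsto_snd[OF p(2)] by (simp only: p1(2))
    have "A x \<bullet> fst l = x \<bullet> snd l" if x: "x \<in> D" for x
    proof (rule LIMSEQ_unique)
      show "(\<lambda>n. A x \<bullet> fst (p n)) \<longlonglongrightarrow> A x \<bullet> fst l" by (intro tendsto_intros l1)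
      have "(\<lambda>n. x \<bullet> As (fst (p n))) \<longlonglongrightarrow> x \<bullet> snd l" by (intro tendsto_intros l2)
      then show "(\<lambda>n. A x \<bullet> fst (p n)) \<longlonglongrightarrow> x \<bullet> snd l" using As_inner[OF p1(1) x] by simp
    qed
    then have "fst l \<in> Ds" "As (fst l) = snd l" using adj_opI by blast+
    then show "l \<in> G" unfolding G_def by (metis (mono_tags, lifting) mem_Collect_eq prod.collapse)
  qed
  obtain C where C: "\<And>z. z \<in> Ds \<Longrightarrow> \<bar>\<phi> z\<bar> \<le> C * graph_norm D A z" using Xm1_bounded[OF \<phi>] by blast
  have "\<exists>q\<in>G. \<forall>p\<in>G. \<phi> (fst p) = q \<bullet> p"
  proof (rule Riesz_subspace[OF cl sub])
    fix x y and a b :: real assume "x \<in> G" "y \<in> G"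
    then have "fst x \<in> Ds" "fst y \<in> Ds" by (auto simp: G_def)
    then show "\<phi> (fst (a *\<^sub>R x + b *\<^sub>R y)) = a * \<phi> (fst x) + b * \<phi> (fst y)"
      by (simp add: Xm1_lin[OF \<phi>])
  next
    fix x assume "x \<in> G"
    then show "\<bar>\<phi> (fst x)\<bar> \<le> C * norm x" using C by (auto simp: G_def graph_norm_Pair[symmetric])
  qed
  then obtain q where q: "\<And>p. p \<in> G \<Longrightarrow> \<phi> (fst p) = q \<bullet> p" by blast
  have "\<phi> z = fst q \<bullet> z + snd q \<bullet> As z" if "z \<in> Ds" for z
    using q[of "(z, As z)"] that by (auto simp: G_def inner_prod_def)
  then show ?thesis by blast
qed

text \<open>A functional \<open>z \<mapsto> \<langle>q\<^sub>1,z\<rangle> + \<langle>q\<^sub>2,A\<^sup>*z\<rangle>\<close> with \<open>q\<^sub>2 \<in> D(A)\<close> is the embedded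
  vector \<open>q\<^sub>1 + A q\<^sub>2\<close>, so that density of \<open>X\<close> in \<open>X\<^sub>-\<^sub>1\<close> reduces to density of \<open>D(A)\<close> in \<open>X\<close>.\<close>

lemma D_dense: "closure D = UNIV"
proof (rule subspace_dense_iff_orthogonal_trivial)
  show "subspace D"
    unfolding subspace_def
  proof (intro conjI ballI allI)
    have "orbit_integral 0 (0::'x) \<in> D" by (rule orbit_integral_D) simp
    then show z: "0 \<in> D" by (simp add: orbit_integral_0)
    show "x + y \<in> D" if "x \<in> D" "y \<in> D" for x y using D_linear(1)[OF that, of 1 1] by simp
    show "c *\<^sub>R x \<in> D" if "x \<in> D" for c x using D_linear(1)[OF that z, of c 0] by simp
  qed
  show "y = 0" if "\<And>x. x \<in> D \<Longrightarrow> y \<bullet> x = 0" for y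
    using that by (intro D_orthogonal_trivial) (simp add: inner_commute)
qed

text \<open>Replacing q2 by a nearby y in the domain approximates the functional by an embedded
  vector, with an error in \<open>norm_Xm1\<close> of at most |q2 - y|. Both maps are bounded and
  agree on embedded vectors.\<close>

lemma bounded_linear_Xm1_unique:
  assumes F: "bounded_linear_Xm1 D A F" and G: "bounded_linear_Xm1 D A G"
    and eq: "\<And>x. F (emb D A x) = G (emb D A x)" and \<phi>: "\<phi> \<in> Xm1 D A"
  shows "F \<phi> = G \<phi>"
proof (rule ext)
  fix z
  have FG: "F \<phi> \<in> Xm1 D A" "G \<phi> \<in> Xm1 D A" using F G \<phi> by (auto simp: bounded_linear_Xm1_def)
  show "F \<phi> z = G \<phi> z"
  proof (cases "z \<in> Ds")
    case False then show ?thesis by (simp add: Xm1_outside[OF FG(1)] Xm1_outside[OF FG(2)])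
  next
    case z: True
    obtain q1 q2 where q: "\<And>w. w \<in> Ds \<Longrightarrow> \<phi> w = q1 \<bullet> w + q2 \<bullet> As w"
      using Xm1_representation[OF \<phi>] by blast
    have bound: "\<exists>C\<ge>0. \<forall>\<psi>\<in>Xm1 D A. \<bar>H \<phi> z - H \<psi> z\<bar> \<le> C * norm_Xm1 D A (\<lambda>w. \<phi> w - \<psi> w)"
      if H: "bounded_linear_Xm1 D A H" for H
    proof -
      obtain C where C: "\<And>\<psi>. \<psi> \<in> Xm1 D A \<Longrightarrow> norm_Xm1 D A (H \<psi>) \<le> C * norm_Xm1 D A \<psi>"
        using H unfolding bounded_linear_Xm1_def by blast
      have "\<bar>H \<phi> z - H \<psi> z\<bar> \<le> (\<bar>C\<bar> * graph_norm D A z) * norm_Xm1 D A (\<lambda>w. \<phi> w - \<psi> w)" if \<psi>: "\<psi> \<in> Xm1 D A" for \<psi>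
      proof -
        have d: "(\<lambda>w. \<phi> w - \<psi> w) \<in> Xm1 D A" by (rule Xm1_diff[OF \<phi> \<psi>])
        have "H (\<lambda>w. 1 * \<phi> w + (-1) * \<psi> w) = (\<lambda>w. 1 * H \<phi> w + (-1) * H \<psi> w)"
          using H \<phi> \<psi> unfolding bounded_linear_Xm1_def by blast
        then have Hd: "H (\<lambda>w. \<phi> w - \<psi> w) = (\<lambda>w. H \<phi> w - H \<psi> w)" by simp
        have "H (\<lambda>w. \<phi> w - \<psi> w) \<in> Xm1 D A" using H d by (auto simp: bounded_linear_Xm1_def)
        then have "\<bar>H (\<lambda>w. \<phi> w - \<psi> w) z\<bar> \<le> norm_Xm1 D A (H (\<lambda>w. \<phi> w - \<psi> w)) * graph_norm D A z"
          by (rule norm_Xm1_bound[OF _ z])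
        also have "\<dots> \<le> (\<bar>C\<bar> * norm_Xm1 D A (\<lambda>w. \<phi> w - \<psi> w)) * graph_norm D A z"
        proof (intro mult_right_mono graph_norm_nonneg)
          show "norm_Xm1 D A (H (\<lambda>w. \<phi> w - \<psi> w)) \<le> \<bar>C\<bar> * norm_Xm1 D A (\<lambda>w. \<phi> w - \<psi> w)"
            using C[OF d] mult_right_mono[OF abs_ge_self[of C] norm_Xm1_nonneg[OF d]] by (rule order_trans)
        qed
        finally show ?thesis unfolding Hd by (simp add: mult_ac)
      qed
      then show ?thesis using graph_norm_nonneg by (intro exI[of _ "\<bar>C\<bar> * graph_norm D A z"]) auto
    qed
    obtain C1 where C1: "0 \<le> C1" "\<And>\<psi>. \<psi> \<in> Xm1 D A \<Longrightarrow> \<bar>F \<phi> z - F \<psi> z\<bar> \<le> C1 * norm_Xm1 D A (\<lambda>w. \<phi> w - \<psi> w)"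
      using bound[OF F] by blast
    obtain C2 where C2: "0 \<le> C2" "\<And>\<psi>. \<psi> \<in> Xm1 D A \<Longrightarrow> \<bar>G \<phi> z - G \<psi> z\<bar> \<le> C2 * norm_Xm1 D A (\<lambda>w. \<phi> w - \<psi> w)"
      using bound[OF G] by blast
    have small: "\<bar>F \<phi> z - G \<phi> z\<bar> \<le> (C1 + C2) * e" if e: "0 < e" for e
    proof -
      have "q2 \<in> closure D" by (simp add: D_dense)
      then obtain y where y: "y \<in> D" "dist y q2 < e" using e closure_approachable by blast
      define \<psi> where "\<psi> = emb D A (q1 + A y)"
      have \<psi>: "\<psi> \<in> Xm1 D A" by (simp add: \<psi>_def emb_Xm1)
      have "norm_Xm1 D A (\<lambda>w. \<phi> w - \<psi> w) \<le> e"
      proof (rule norm_Xm1_le)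
        fix w assume w: "w \<in> Ds"
        have "\<phi> w - \<psi> w = (q2 - y) \<bullet> As w"
          using w y by (simp add: q \<psi>_def emb_def inner_add_left inner_diff_left As_inner)
        then have "\<bar>\<phi> w - \<psi> w\<bar> \<le> norm (q2 - y) * norm (As w)" by (simp add: Cauchy_Schwarz_ineq2)
        also have "\<dots> \<le> e * graph_norm D A w"
          using y(2) e by (intro mult_mono graph_norm_bounds) (auto simp: dist_norm norm_minus_commute)
        finally show "\<bar>\<phi> w - \<psi> w\<bar> \<le> e * graph_norm D A w" .
      qed (use e in simp)
      then have "\<bar>F \<phi> z - F \<psi> z\<bar> \<le> C1 * e" "\<bar>G \<phi> z - G \<psi> z\<bar> \<le> C2 * e"
        using C1(2)[OF \<psi>] C2(2)[OF \<psi>] mult_left_mono[OF _ C1(1)] mult_left_mono[OF _ C2(1)] order_trans by blast+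
      moreover have "F \<psi> z = G \<psi> z" by (simp add: \<psi>_def eq)
      ultimately show ?thesis unfolding distrib_right by linarith
    qed
    have "\<bar>F \<phi> z - G \<phi> z\<bar> \<le> 0"
    proof (rule field_le_epsilon)
      fix e :: real assume "0 < e"
      \<comment> \<open>The added 1 keeps the divisor positive when both constants are 0.\<close>
      then have "(C1 + C2) * (e / (C1 + C2 + 1)) \<le> e" "0 < e / (C1 + C2 + 1)"
        using C1(1) C2(1) by (auto simp: divide_simps algebra_simps)
      then show "\<bar>F \<phi> z - G \<phi> z\<bar> \<le> 0 + e" using small[of "e / (C1 + C2 + 1)"] by simp
    qed
    then show ?thesis by simp
  qed
qed

text \<open>Composition with \<open>Sa t\<close> on \<open>Ds\<close> is a bounded map extending
  S(t), so by uniqueness it is the extension. This lemma is the only access to the definite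
  description in \<open>S_m1\<close>.\<close>

lemma S_m1_apply:
  assumes t: "0 \<le> t" and \<phi>: "\<phi> \<in> Xm1 D A" and z: "z \<in> Ds"
  shows "S_m1 D A S t \<phi> z = \<phi> (Sa t z)"
proof -
  obtain K where K1: "1 \<le> K" and K: "\<And>x. norm (S t x) \<le> K * norm x"
    using S_bounded_at[OF t] by blast
  have gn: "graph_norm D A (Sa t z) \<le> K * graph_norm D A z" if z: "z \<in> Ds" for z
  proof -
    have "(norm (Sa t z))\<^sup>2 \<le> (K * norm z)\<^sup>2" "(norm (Sa t (As z)))\<^sup>2 \<le> (K * norm (As z))\<^sup>2"
      by (intro power_mono Sa_bound[OF t K] norm_ge_zero)+
    then have "sqrt ((norm (Sa t z))\<^sup>2 + (norm (As (Sa t z)))\<^sup>2) \<le> sqrt (K\<^sup>2 * ((norm z)\<^sup>2 + (norm (As z))\<^sup>2))"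
      by (intro real_sqrt_le_mono) (simp add: Sa_Ds[OF z t] power_mult_distrib distrib_left)
    then show ?thesis using K1 by (simp add: graph_norm_def real_sqrt_mult)
  qed
  define E where "E = (\<lambda>\<phi>\<in>Xm1 D A. \<lambda>z. if z \<in> Ds then \<phi> (Sa t z) else 0)"
  have E_bd: "\<bar>\<psi> (Sa t z)\<bar> \<le> (K * norm_Xm1 D A \<psi>) * graph_norm D A z" if \<psi>: "\<psi> \<in> Xm1 D A" and z: "z \<in> Ds" for \<psi> z
  proof -
    have "\<bar>\<psi> (Sa t z)\<bar> \<le> norm_Xm1 D A \<psi> * graph_norm D A (Sa t z)"
      by (rule norm_Xm1_bound[OF \<psi> Sa_Ds(1)[OF z t]])
    also have "\<dots> \<le> norm_Xm1 D A \<psi> * (K * graph_norm D A z)"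
      by (intro mult_left_mono gn z norm_Xm1_nonneg \<psi>)
    finally show ?thesis by (simp add: mult_ac)
  qed
  have E_in: "E \<psi> \<in> Xm1 D A" if \<psi>: "\<psi> \<in> Xm1 D A" for \<psi>
  proof -
    have "\<psi> (Sa t (a *\<^sub>R z + b *\<^sub>R w)) = a * \<psi> (Sa t z) + b * \<psi> (Sa t w)" if "z \<in> Ds" "w \<in> Ds" for z w a b
      using that t by (simp add: Sa_linear Xm1_lin[OF \<psi>] Sa_Ds(1))
    then have "(\<lambda>z. if z \<in> Ds then \<psi> (Sa t z) else 0) \<in> Xm1 D A"
      by (intro Xm1_I[where C = "K * norm_Xm1 D A \<psi>"]) (auto simp: Ds_linear(1) E_bd[OF \<psi>])
    then show ?thesis using \<psi> by (simp add: E_def)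
  qed
  have E_emb: "E (emb D A x) = emb D A (S t x)" for x
  proof -
    have "E (emb D A x) = (\<lambda>z. if z \<in> Ds then emb D A x (Sa t z) else 0)"
      using emb_Xm1[of x] by (simp add: E_def)
    also have "\<dots> = emb D A (S t x)"
      using Sa_Ds(1)[OF _ t] by (auto simp: emb_def Sa_inner[OF t])
    finally show ?thesis .
  qed
  have E_bl: "bounded_linear_Xm1 D A E"
    unfolding bounded_linear_Xm1_def
  proof (intro conjI ballI allI)
    fix \<psi> \<xi> a b assume "\<psi> \<in> Xm1 D A" "\<xi> \<in> Xm1 D A"
    then show "E (\<lambda>z. a * \<psi> z + b * \<xi> z) = (\<lambda>z. a * E \<psi> z + b * E \<xi> z)"
      using Xm1_combine by (auto simp: E_def)
  next
    show "\<exists>C. \<forall>\<psi>\<in>Xm1 D A. norm_Xm1 D A (E \<psi>) \<le> C * norm_Xm1 D A \<psi>"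
    proof (intro exI[of _ K] ballI norm_Xm1_le)
      fix \<psi> z assume "\<psi> \<in> Xm1 D A" "z \<in> Ds"
      then show "\<bar>E \<psi> z\<bar> \<le> (K * norm_Xm1 D A \<psi>) * graph_norm D A z" using E_bd by (simp add: E_def)
    qed (use K1 norm_Xm1_nonneg in simp)
  qed (rule E_in)
  have "S_m1 D A S t = E"
    unfolding S_m1_def
  proof (rule the_equality)
    show "E \<in> extensional (Xm1 D A) \<and> bounded_linear_Xm1 D A E \<and> (\<forall>x. E (emb D A x) = emb D A (S t x))"
      using E_bl E_emb by (simp add: E_def)
    fix F assume F: "F \<in> extensional (Xm1 D A) \<and> bounded_linear_Xm1 D A F \<and> (\<forall>x. F (emb D A x) = emb D A (S t x))"
    show "F = E"
    proof (rule extensionalityI)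
      show "F \<in> extensional (Xm1 D A)" using F by simp
      show "E \<in> extensional (Xm1 D A)" by (simp add: E_def)
      show "F \<psi> = E \<psi>" if "\<psi> \<in> Xm1 D A" for \<psi>
        using bounded_linear_Xm1_unique[OF _ E_bl _ that, of F] F E_emb by simp
    qed
  qed
  then show ?thesis using \<phi> z by (simp add: E_def)
qed

end

section \<open>Control systems and observability\<close>

lemma Lp_measurable: "f \<in> Lp p a b \<Longrightarrow> strongly_measurable (leb a b) f"
  by (simp add: Lp_def)

lemma powr_two_norm: "norm x powr 2 = (norm x)\<^sup>2"
  by (cases "x = 0") (auto simp: powr_numeral)

lemma Lp_two_iff: "f \<in> Lp 2 a b \<longleftrightarrow> strongly_measurable (leb a b) f \<and> integrable (leb a b) (\<lambda>t. (norm (f t))\<^sup>2)"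
  by (simp add: Lp_def powr_two_norm)

lemma Lp_two_norm: "Lp_norm 2 a b f = sqrt (\<integral>t. (norm (f t))\<^sup>2 \<partial>leb a b)"
  by (simp add: Lp_norm_def powr_two_norm powr_half_sqrt)

lemma has_integral_Xm1_cong:
  assumes "\<And>\<tau>. \<tau> \<in> {0<..<t} \<Longrightarrow> F \<tau> = G \<tau>"
  shows "has_integral_Xm1 D A t F I = has_integral_Xm1 D A t G I"
proof -
  have 1: "(AE \<tau> in leb 0 t. (\<lambda>n. norm_Xm1 D A (\<lambda>z. F \<tau> z - s n \<tau> z)) \<longlonglongrightarrow> 0) \<longleftrightarrow>
    (AE \<tau> in leb 0 t. (\<lambda>n. norm_Xm1 D A (\<lambda>z. G \<tau> z - s n \<tau> z)) \<longlonglongrightarrow> 0)" for s :: "nat \<Rightarrow> real \<Rightarrow> _ \<Rightarrow> real"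
    by (rule AE_cong) (simp add: assms)
  have 2: "(\<integral>\<^sup>+\<tau>. ennreal (norm_Xm1 D A (\<lambda>z. F \<tau> z - s n \<tau> z)) \<partial>leb 0 t) =
    (\<integral>\<^sup>+\<tau>. ennreal (norm_Xm1 D A (\<lambda>z. G \<tau> z - s n \<tau> z)) \<partial>leb 0 t)" for s :: "nat \<Rightarrow> real \<Rightarrow> _ \<Rightarrow> real" and n
    by (rule nn_integral_cong) (simp add: assms)
  show ?thesis unfolding has_integral_Xm1_def 1 2 using assms by auto
qed

section \<open>Evaluating integrals with values in the extrapolation space\<close>

context hilbert_semigroup
begin

lemma simple_integral_Xm1_apply:
  assumes s: "simple_function (leb 0 t) s"
  shows "integrable (leb 0 t) (\<lambda>\<tau>. s \<tau> z)" "simple_integral_Xm1 t s z = (\<integral>\<tau>. s \<tau> z \<partial>leb 0 t)"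
proof -
  interpret finite_measure "leb 0 t" by (rule finite_measure_leb)
  have fin: "finite (s ` {0<..<t})" and m: "\<And>\<phi>. \<phi> \<in> s ` {0<..<t} \<Longrightarrow> {\<tau> \<in> {0<..<t}. s \<tau> = \<phi>} \<in> sets (leb 0 t)"
  proof -
    show "finite (s ` {0<..<t})" using s by (simp add: simple_function_def)
    fix \<phi> assume "\<phi> \<in> s ` {0<..<t}"
    then have "s -` {\<phi>} \<inter> {0<..<t} \<in> sets (leb 0 t)" using s by (auto simp: simple_function_def)
    moreover have "s -` {\<phi>} \<inter> {0<..<t} = {\<tau> \<in> {0<..<t}. s \<tau> = \<phi>}" by auto
    ultimately show "{\<tau> \<in> {0<..<t}. s \<tau> = \<phi>} \<in> sets (leb 0 t)" by simp
  qed
  have eq: "s \<tau> z = (\<Sum>\<phi>\<in>s ` {0<..<t}. indicator {\<tau> \<in> {0<..<t}. s \<tau> = \<phi>} \<tau> * \<phi> z)" if \<tau>: "\<tau> \<in> {0<..<t}" for \<tau>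
  proof -
    have "(\<Sum>\<phi>\<in>s ` {0<..<t}. indicator {\<tau> \<in> {0<..<t}. s \<tau> = \<phi>} \<tau> * \<phi> z)
        = (\<Sum>\<phi>\<in>s ` {0<..<t}. if \<phi> = s \<tau> then s \<tau> z else 0)"
      by (intro sum.cong) (use \<tau> in auto)
    also have "\<dots> = s \<tau> z" using fin \<tau> by simp
    finally show ?thesis by simp
  qed
  have int: "integrable (leb 0 t) (\<lambda>\<tau>. indicator {\<tau> \<in> {0<..<t}. s \<tau> = \<phi>} \<tau> * \<phi> z)" if "\<phi> \<in> s ` {0<..<t}" for \<phi>
    by (intro integrable_mult_left integrable_real_indicator m[OF that]) (simp add: less_top[symmetric])
  have int': "integrable (leb 0 t) (\<lambda>\<tau>. \<Sum>\<phi>\<in>s ` {0<..<t}. indicator {\<tau> \<in> {0<..<t}. s \<tau> = \<phi>} \<tau> * \<phi> z)"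
    using int by (rule Bochner_Integration.integrable_sum)
  have "integrable (leb 0 t) (\<lambda>\<tau>. s \<tau> z) =
      integrable (leb 0 t) (\<lambda>\<tau>. \<Sum>\<phi>\<in>s ` {0<..<t}. indicator {\<tau> \<in> {0<..<t}. s \<tau> = \<phi>} \<tau> * \<phi> z)"
    by (rule Bochner_Integration.integrable_cong[OF refl], rule eq) (simp only: space_leb)
  then show "integrable (leb 0 t) (\<lambda>\<tau>. s \<tau> z)" using int' by blast
  have "(\<integral>\<tau>. s \<tau> z \<partial>leb 0 t) = (\<integral>\<tau>. (\<Sum>\<phi>\<in>s ` {0<..<t}. indicator {\<tau> \<in> {0<..<t}. s \<tau> = \<phi>} \<tau> * \<phi> z) \<partial>leb 0 t)"
    by (rule Bochner_Integration.integral_cong[OF refl], rule eq) (simp only: space_leb)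
  also have "\<dots> = (\<Sum>\<phi>\<in>s ` {0<..<t}. \<integral>\<tau>. indicator {\<tau> \<in> {0<..<t}. s \<tau> = \<phi>} \<tau> * \<phi> z \<partial>leb 0 t)"
    using int by (rule Bochner_Integration.integral_sum)
  also have "\<dots> = simple_integral_Xm1 t s z"
    unfolding simple_integral_Xm1_def
  proof (rule sum.cong)
    fix \<phi> assume "\<phi> \<in> s ` {0<..<t}"
    then have "{\<tau> \<in> {0<..<t}. s \<tau> = \<phi>} \<in> sets (leb 0 t)" by (rule m)
    then show "(\<integral>\<tau>. indicator {\<tau> \<in> {0<..<t}. s \<tau> = \<phi>} \<tau> * \<phi> z \<partial>leb 0 t) =
      measure (leb 0 t) {\<tau> \<in> {0<..<t}. s \<tau> = \<phi>} * \<phi> z"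
    proof -
      have "{\<tau> \<in> {0<..<t}. s \<tau> = \<phi>} \<inter> {0<..<t} = {\<tau> \<in> {0<..<t}. s \<tau> = \<phi>}" by auto
      then show ?thesis by simp
    qed
  qed simp
  finally show "simple_integral_Xm1 t s z = (\<integral>\<tau>. s \<tau> z \<partial>leb 0 t)" by simp
qed

lemma simple_integral_Xm1_in:
  assumes "\<And>\<tau>. \<tau> \<in> {0<..<t} \<Longrightarrow> s \<tau> \<in> Xm1 D A"
  shows "simple_integral_Xm1 t s \<in> Xm1 D A"
  unfolding simple_integral_Xm1_def by (rule Xm1_sum) (use assms in auto)

text \<open>\<open>norm_Xm1\<close> is a supremum over the unit ball of the graph norm, so
  evaluation at a point of that ball does not increase it. The approximating simple functions thus
  become scalar functions converging in \<open>L\<^sup>1\<close>, and so do their integrals.\<close>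

lemma has_integral_Xm1_apply_unit:
  assumes F: "has_integral_Xm1 D A t F I" and z: "z \<in> Ds" and z1: "graph_norm D A z \<le> 1"
  shows "integrable (leb 0 t) (\<lambda>\<tau>. F \<tau> z)" "I z = (\<integral>\<tau>. F \<tau> z \<partial>leb 0 t)"
proof -
  obtain s where FX: "\<And>\<tau>. \<tau> \<in> {0<..<t} \<Longrightarrow> F \<tau> \<in> Xm1 D A" and I: "I \<in> Xm1 D A"
    and s: "\<And>n::nat. simple_function (leb 0 t) (s n)" "\<And>n \<tau>. \<tau> \<in> {0<..<t} \<Longrightarrow> s n \<tau> \<in> Xm1 D A"
    and ae: "AE \<tau> in leb 0 t. (\<lambda>n. norm_Xm1 D A (\<lambda>z. F \<tau> z - s n \<tau> z)) \<longlonglongrightarrow> 0"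
    and nn: "(\<lambda>n. \<integral>\<^sup>+\<tau>. ennreal (norm_Xm1 D A (\<lambda>z. F \<tau> z - s n \<tau> z)) \<partial>leb 0 t) \<longlonglongrightarrow> 0"
    and lim: "(\<lambda>n. norm_Xm1 D A (\<lambda>z. simple_integral_Xm1 t (s n) z - I z)) \<longlonglongrightarrow> 0"
    using F unfolding has_integral_Xm1_def by blast
  have le: "\<bar>F \<tau> z - s n \<tau> z\<bar> \<le> norm_Xm1 D A (\<lambda>z. F \<tau> z - s n \<tau> z)" if "\<tau> \<in> {0<..<t}" for n \<tau>
    using norm_Xm1_unit[OF Xm1_diff[OF FX[OF that] s(2)[OF that]] z z1] .
  have in_sp: "AE \<tau> in leb 0 t. \<tau> \<in> {0<..<t}" by (rule AE_I2) simp
  have ae': "AE \<tau> in leb 0 t. (\<lambda>n. s n \<tau> z) \<longlonglongrightarrow> F \<tau> z"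
    using ae in_sp
  proof eventually_elim
    case (elim \<tau>)
    have "(\<lambda>n. F \<tau> z - s n \<tau> z) \<longlonglongrightarrow> 0"
      by (rule Lim_null_comparison[OF _ elim(1)]) (use le[OF elim(2)] in simp)
    then have "(\<lambda>n. F \<tau> z - (F \<tau> z - s n \<tau> z)) \<longlonglongrightarrow> F \<tau> z - 0" by (intro tendsto_intros)
    then show ?case by simp
  qed
  have sz: "integrable (leb 0 t) (\<lambda>\<tau>. s n \<tau> z)" for n by (rule simple_integral_Xm1_apply(1)[OF s(1)])
  have Fm: "(\<lambda>\<tau>. F \<tau> z) \<in> borel_measurable (leb 0 t)"
    by (rule complete_measure.borel_measurable_AE_limit[OF complete_leb borel_measurable_integrable[OF sz] ae'])
  have dm: "(\<lambda>\<tau>. F \<tau> z - s n \<tau> z) \<in> borel_measurable (leb 0 t)" for n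
    using Fm borel_measurable_integrable[OF sz] by (rule borel_measurable_diff)
  have nz: "(\<lambda>n. \<integral>\<^sup>+\<tau>. ennreal \<bar>F \<tau> z - s n \<tau> z\<bar> \<partial>leb 0 t) \<longlonglongrightarrow> 0"
  proof (rule tendsto_sandwich[OF _ _ tendsto_const nn])
    show "\<forall>\<^sub>F n in sequentially. (\<integral>\<^sup>+\<tau>. ennreal \<bar>F \<tau> z - s n \<tau> z\<bar> \<partial>leb 0 t)
        \<le> (\<integral>\<^sup>+\<tau>. ennreal (norm_Xm1 D A (\<lambda>z. F \<tau> z - s n \<tau> z)) \<partial>leb 0 t)"
      by (intro always_eventually allI nn_integral_mono ennreal_leI le) simp
  qed simp
  then have "\<forall>\<^sub>F n in sequentially. (\<integral>\<^sup>+\<tau>. ennreal \<bar>F \<tau> z - s n \<tau> z\<bar> \<partial>leb 0 t) < 1"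
    by (rule order_tendstoD(2)) simp
  then obtain N where N: "\<And>n. n \<ge> N \<Longrightarrow> (\<integral>\<^sup>+\<tau>. ennreal \<bar>F \<tau> z - s n \<tau> z\<bar> \<partial>leb 0 t) < 1"
    unfolding eventually_sequentially by blast
  have di: "integrable (leb 0 t) (\<lambda>\<tau>. F \<tau> z - s n \<tau> z)" if "n \<ge> N" for n
    using N[OF that] dm[of n] by (intro integrableI_bounded) (auto intro: less_trans)
  show Fi: "integrable (leb 0 t) (\<lambda>\<tau>. F \<tau> z)"
    using Bochner_Integration.integrable_add[OF di[of N] sz[of N]] by simp
  have di': "integrable (leb 0 t) (\<lambda>\<tau>. F \<tau> z - s n \<tau> z)" for n using Fi sz by (rule Bochner_Integration.integrable_diff)
  have "(\<lambda>n. (\<integral>\<tau>. F \<tau> z \<partial>leb 0 t) - (\<integral>\<tau>. s n \<tau> z \<partial>leb 0 t)) \<longlonglongrightarrow> 0"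
  proof (rule Lim_null_comparison)
    have "norm ((\<integral>\<tau>. F \<tau> z \<partial>leb 0 t) - (\<integral>\<tau>. s n \<tau> z \<partial>leb 0 t)) \<le> (\<integral>\<tau>. \<bar>F \<tau> z - s n \<tau> z\<bar> \<partial>leb 0 t)" for n
      using integral_abs_bound[of "leb 0 t" "\<lambda>\<tau>. F \<tau> z - s n \<tau> z"] Fi sz[of n] by simp
    then show "\<forall>\<^sub>F n in sequentially. norm ((\<integral>\<tau>. F \<tau> z \<partial>leb 0 t) - (\<integral>\<tau>. s n \<tau> z \<partial>leb 0 t))
        \<le> (\<integral>\<tau>. \<bar>F \<tau> z - s n \<tau> z\<bar> \<partial>leb 0 t)" by simp
    have "(\<integral>\<^sup>+\<tau>. ennreal \<bar>F \<tau> z - s n \<tau> z\<bar> \<partial>leb 0 t) = ennreal (\<integral>\<tau>. \<bar>F \<tau> z - s n \<tau> z\<bar> \<partial>leb 0 t)" for n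
      using di'[of n] by (intro nn_integral_eq_integral integrable_abs) auto
    then have "(\<lambda>n. ennreal (\<integral>\<tau>. \<bar>F \<tau> z - s n \<tau> z\<bar> \<partial>leb 0 t)) \<longlonglongrightarrow> ennreal 0" using nz by simp
    then show "(\<lambda>n. \<integral>\<tau>. \<bar>F \<tau> z - s n \<tau> z\<bar> \<partial>leb 0 t) \<longlonglongrightarrow> 0"
      by (subst (asm) tendsto_ennreal_iff) (auto intro: integral_nonneg_AE)
  qed
  then have "(\<lambda>n. (\<integral>\<tau>. F \<tau> z \<partial>leb 0 t) - ((\<integral>\<tau>. F \<tau> z \<partial>leb 0 t) - (\<integral>\<tau>. s n \<tau> z \<partial>leb 0 t))) \<longlonglongrightarrow> (\<integral>\<tau>. F \<tau> z \<partial>leb 0 t) - 0"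
    by (intro tendsto_intros)
  then have "(\<lambda>n. \<integral>\<tau>. s n \<tau> z \<partial>leb 0 t) \<longlonglongrightarrow> (\<integral>\<tau>. F \<tau> z \<partial>leb 0 t)" by simp
  moreover have "(\<lambda>n. \<integral>\<tau>. s n \<tau> z \<partial>leb 0 t) \<longlonglongrightarrow> I z"
  proof -
    have "(\<lambda>n. simple_integral_Xm1 t (s n) z - I z) \<longlonglongrightarrow> 0"
    proof (rule Lim_null_comparison[OF _ lim], intro always_eventually allI)
      show "norm (simple_integral_Xm1 t (s n) z - I z) \<le> norm_Xm1 D A (\<lambda>z. simple_integral_Xm1 t (s n) z - I z)" for n
        using norm_Xm1_unit[OF Xm1_diff[OF simple_integral_Xm1_in[OF s(2)] I] z z1] by simp
    qed
    then have "(\<lambda>n. (simple_integral_Xm1 t (s n) z - I z) + I z) \<longlonglongrightarrow> 0 + I z" by (intro tendsto_intros)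
    then show ?thesis by (simp add: simple_integral_Xm1_apply(2)[OF s(1)])
  qed
  ultimately show "I z = (\<integral>\<tau>. F \<tau> z \<partial>leb 0 t)" by (rule LIMSEQ_unique[rotated])
qed

lemma has_integral_Xm1_apply:
  assumes F: "has_integral_Xm1 D A t F I" and z: "z \<in> Ds"
  shows "integrable (leb 0 t) (\<lambda>\<tau>. F \<tau> z)" "I z = (\<integral>\<tau>. F \<tau> z \<partial>leb 0 t)"
proof -
  have FX: "F \<tau> \<in> Xm1 D A" if "\<tau> \<in> {0<..<t}" for \<tau>
    using F that by (simp add: has_integral_Xm1_def)
  have I: "I \<in> Xm1 D A" using F by (simp add: has_integral_Xm1_def)
  \<comment> \<open>The added 1 allows division even for z = 0 and still scales z into the unit
    ball.\<close>
  define g where "g = graph_norm D A z + 1"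
  have g: "0 < g" using graph_norm_nonneg[of z] by (simp add: g_def)
  define w where "w = (1 / g) *\<^sub>R z"
  have w: "w \<in> Ds" "graph_norm D A w \<le> 1"
    using g z by (auto simp: w_def Ds_scale graph_norm_scale g_def)
  have zw: "z = g *\<^sub>R w" using g by (simp add: w_def)
  have Fz: "F \<tau> z = g * F \<tau> w" if "\<tau> \<in> {0<..<t}" for \<tau>
    unfolding zw using Xm1_scale[OF FX[OF that] w(1)] .
  have "integrable (leb 0 t) (\<lambda>\<tau>. g * F \<tau> w)"
    by (intro integrable_mult_right has_integral_Xm1_apply_unit(1)[OF F w])
  then show "integrable (leb 0 t) (\<lambda>\<tau>. F \<tau> z)"
    by (rule Bochner_Integration.integrable_cong[THEN iffD1, rotated -1]) (auto simp: Fz)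
  have "I z = g * I w" unfolding zw using Xm1_scale[OF I w(1)] .
  also have "\<dots> = (\<integral>\<tau>. g * F \<tau> w \<partial>leb 0 t)"
    using has_integral_Xm1_apply_unit(2)[OF F w] by simp
  also have "\<dots> = (\<integral>\<tau>. F \<tau> z \<partial>leb 0 t)"
    by (rule Bochner_Integration.integral_cong) (auto simp: Fz)
  finally show "I z = (\<integral>\<tau>. F \<tau> z \<partial>leb 0 t)" .
qed

end

section \<open>Observations of adjoint orbits and their pairing with controls\<close>

locale control_system = hilbert_semigroup D A S
  for D :: "'x::{real_inner, complete_space} set" and A S +
  fixes B :: "'u::{real_inner, complete_space} \<Rightarrow> 'x \<Rightarrow> real"
  assumes ctrl: "control_operator D A B" and adm: "admissible D A S B"
begin

lemma B_Xm1: "B u \<in> Xm1 D A" using ctrl by (simp add: control_operator_def)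

lemma B_linear: "B (a *\<^sub>R u + b *\<^sub>R v) z = a * B u z + b * B v z"
  using ctrl by (simp add: control_operator_def)

lemma B_bounded: "\<exists>C\<ge>0. \<forall>u. \<forall>z\<in>Ds. \<bar>B u z\<bar> \<le> C * norm u * graph_norm D A z"
proof -
  obtain C where C: "\<And>u. norm_Xm1 D A (B u) \<le> C * norm u" using ctrl unfolding control_operator_def by blast
  have "\<bar>B u z\<bar> \<le> \<bar>C\<bar> * norm u * graph_norm D A z" if z: "z \<in> Ds" for u z
  proof -
    have "\<bar>B u z\<bar> \<le> norm_Xm1 D A (B u) * graph_norm D A z" by (rule norm_Xm1_bound[OF B_Xm1 z])
    also have "\<dots> \<le> (\<bar>C\<bar> * norm u) * graph_norm D A z"
    proof (intro mult_right_mono graph_norm_nonneg)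
      show "norm_Xm1 D A (B u) \<le> \<bar>C\<bar> * norm u"
        using C[of u] mult_right_mono[OF abs_ge_self[of C] norm_ge_zero[of u]] by (rule order_trans)
    qed
    finally show ?thesis .
  qed
  then show ?thesis by (intro exI[of _ "\<bar>C\<bar>"]) auto
qed

lemma adj_control_inner:
  assumes z: "z \<in> Ds" shows "u \<bullet> adj_control B z = B u z"
proof -
  obtain C where C: "\<And>u z. z \<in> Ds \<Longrightarrow> \<bar>B u z\<bar> \<le> C * norm u * graph_norm D A z" using B_bounded by blast
  have "\<exists>q\<in>UNIV. \<forall>u\<in>UNIV. B u z = q \<bullet> u"
    by (rule Riesz_subspace[where K = "C * graph_norm D A z"])
      (use C[OF z] in \<open>auto simp: B_linear mult_ac\<close>)
  then obtain q where q: "\<And>u. u \<bullet> q = B u z" by (metis UNIV_I inner_commute)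
  have "adj_control B z = q" unfolding adj_control_def
  proof (rule the_equality)
    show "\<forall>u. u \<bullet> q = B u z" using q by blast
    show "w = q" if "\<forall>u. u \<bullet> w = B u z" for w
      by (rule vector_eq_ldot[THEN iffD1, rule_format]) (use that q in simp)
  qed
  then show ?thesis using q by simp
qed

text \<open>The function called \<open>g z\<close> in the overview. The elements of
  \<open>X_T\<close> are its time reversals \<open>t \<mapsto> obs z (T - t)\<close>. Its properties
  are available for \<open>s \<ge> 0\<close> only.\<close>

definition obs :: "'x \<Rightarrow> real \<Rightarrow> 'u" where "obs z s = adj_control B (Sa s z)"

lemma obs_inner: "z \<in> Ds \<Longrightarrow> 0 \<le> s \<Longrightarrow> u \<bullet> obs z s = B u (Sa s z)"
  unfolding obs_def by (intro adj_control_inner Sa_Ds)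

lemma obs_linear:
  assumes "z \<in> Ds" "w \<in> Ds" "0 \<le> s"
  shows "obs (a *\<^sub>R z + b *\<^sub>R w) s = a *\<^sub>R obs z s + b *\<^sub>R obs w s"
proof (rule vector_eq_ldot[THEN iffD1, rule_format])
  fix u
  show "u \<bullet> obs (a *\<^sub>R z + b *\<^sub>R w) s = u \<bullet> (a *\<^sub>R obs z s + b *\<^sub>R obs w s)"
    using assms by (simp add: obs_inner Ds_linear(1) inner_add_right Sa_linear Xm1_lin[OF B_Xm1] Sa_Ds(1))
qed

lemma obs_shift: "0 \<le> s \<Longrightarrow> 0 \<le> e \<Longrightarrow> obs (Sa e z) s = obs z (s + e)"
  unfolding obs_def by (simp add: Sa_add)

text \<open>The adjoint of the control operator is bounded for the graph norm, and for z in
  \<open>Ds\<close> the orbit is continuous in that norm because \<open>As\<close> commutes with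
  \<open>Sa\<close>.\<close>

lemma obs_cont:
  assumes z: "z \<in> Ds"
  shows "continuous_on {0..} (obs z)"
proof -
  obtain C where C0: "0 \<le> C" and C: "\<And>u z. z \<in> Ds \<Longrightarrow> \<bar>B u z\<bar> \<le> C * norm u * graph_norm D A z" using B_bounded by blast
  have bd: "norm (adj_control B w) \<le> C * graph_norm D A w" if w: "w \<in> Ds" for w
  proof -
    have "norm (adj_control B w) * norm (adj_control B w) \<le> (C * graph_norm D A w) * norm (adj_control B w)"
      using C[OF w, of "adj_control B w"] adj_control_inner[OF w, of "adj_control B w"]
      by (simp add: power2_norm_eq_inner mult_ac flip: power2_eq_square)
    then show ?thesis
      using C0 graph_norm_nonneg[of w] by (cases "adj_control B w = 0") auto
  qed
  have diff: "norm (obs z s - obs z t) \<le> C * norm (Sa s z - Sa t z, Sa s (As z) - Sa t (As z))" if st: "0 \<le> s" "0 \<le> t" for s t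
  proof -
    have d: "Sa s z - Sa t z \<in> Ds" using st z by (intro Ds_diff Sa_Ds)
    have "obs z s - obs z t = adj_control B (Sa s z - Sa t z)"
    proof (rule vector_eq_ldot[THEN iffD1, rule_format])
      fix u
      have "B u (Sa s z - Sa t z) = B u (Sa s z) - B u (Sa t z)"
        using Xm1_lin[OF B_Xm1 Sa_Ds(1)[OF z st(1)] Sa_Ds(1)[OF z st(2)], of u 1 "-1"] by simp
      then show "u \<bullet> (obs z s - obs z t) = u \<bullet> adj_control B (Sa s z - Sa t z)"
        using st z d by (simp add: inner_diff_right obs_inner adj_control_inner)
    qed
    moreover have "As (Sa s z - Sa t z) = Sa s (As z) - Sa t (As z)"
      using st z by (simp add: Ds_diff Sa_Ds)
    ultimately show ?thesis using bd[OF d] by (simp add: graph_norm_Pair)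
  qed
  have cP: "continuous_on {0..} (\<lambda>s. (Sa s z, Sa s (As z)))" by (intro continuous_on_Pair Sa_cont)
  show ?thesis
    unfolding continuous_on_def
  proof
    fix t :: real assume t: "t \<in> {0..}"
    have l: "((\<lambda>s. (Sa s z, Sa s (As z))) \<longlongrightarrow> (Sa t z, Sa t (As z))) (at t within {0..})"
      using cP t by (simp add: continuous_on_def)
    have "((\<lambda>s. obs z s - obs z t) \<longlongrightarrow> 0) (at t within {0..})"
    proof (rule Lim_null_comparison)
      show "\<forall>\<^sub>F s in at t within {0..}. norm (obs z s - obs z t) \<le> C * norm ((Sa s z, Sa s (As z)) - (Sa t z, Sa t (As z)))"
        using t diff by (auto simp: eventually_at_filter intro!: always_eventually)
      have "((\<lambda>s. C * norm ((Sa s z, Sa s (As z)) - (Sa t z, Sa t (As z)))) \<longlongrightarrow> C * norm ((Sa t z, Sa t (As z)) - (Sa t z, Sa t (As z)))) (at t within {0..})"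
        by (intro tendsto_intros l)
      then show "((\<lambda>s. C * norm ((Sa s z, Sa s (As z)) - (Sa t z, Sa t (As z)))) \<longlongrightarrow> 0) (at t within {0..})" by simp
    qed
    then show "(obs z \<longlongrightarrow> obs z t) (at t within {0..})" by (rule LIM_zero_cancel)
  qed
qed

lemma obs_cont': "z \<in> Ds \<Longrightarrow> 0 \<le> a \<Longrightarrow> continuous_on {a..b} (obs z)"
  by (rule continuous_on_subset[OF obs_cont]) auto

text \<open>Evaluating the integral at z in \<open>Ds\<close> gives the pairing, and by density of
  \<open>Ds\<close> the pairings determine the state. The definite description in
  \<open>yhat\<close> is therefore the vector supplied by admissibility, whose norm bound it
  inherits.\<close>

lemma reachable:
  assumes T: "0 < T"
  shows "\<exists>C>0. \<forall>v\<in>Lp 2 0 T. norm (yhat D A S B T 0 v) \<le> C * Lp_norm 2 0 T v \<and>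
    (\<forall>z\<in>Ds. integrable (leb 0 T) (\<lambda>t. v t \<bullet> obs z (T - t)) \<and>
      yhat D A S B T 0 v \<bullet> z = (\<integral>t. v t \<bullet> obs z (T - t) \<partial>leb 0 T))"
proof -
  obtain C where C: "0 < C" "\<And>u. u \<in> L2_loc \<Longrightarrow> \<exists>x.
     has_integral_Xm1 D A T (\<lambda>\<tau>. S_m1 D A S (T - \<tau>) (B (u \<tau>))) (emb D A x) \<and> norm x \<le> C * Lp_norm 2 0 T u"
    using adm T unfolding admissible_def by blast
  have "norm (yhat D A S B T 0 v) \<le> C * Lp_norm 2 0 T v \<and>
    (\<forall>z\<in>Ds. integrable (leb 0 T) (\<lambda>t. v t \<bullet> obs z (T - t)) \<and>
      yhat D A S B T 0 v \<bullet> z = (\<integral>t. v t \<bullet> obs z (T - t) \<partial>leb 0 T))" if v: "v \<in> Lp 2 0 T" for v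
  proof -
    \<comment> \<open>Admissibility quantifies over \<open>L2_loc\<close>; the control is known only
      on (0, T) and is extended by zero.\<close>
    define u where "u t = (if t \<in> {0<..<T} then v t else 0)" for t
    have uv: "u t = v t" if "t \<in> {0<..<T}" for t using that by (simp add: u_def)
    have "u \<in> Lp 2 0 b" for b
      unfolding Lp_two_iff
    proof
      show "strongly_measurable (leb 0 b) u"
        unfolding u_def by (rule strongly_measurable_extend_zero[OF Lp_measurable[OF v]])
      have "integrable lebesgue (\<lambda>t. indicator {0<..<T} t *\<^sub>R (norm (v t))\<^sup>2)"
        using v unfolding Lp_two_iff by (intro integrable_restrict_space[THEN iffD1]) auto
      then have "integrable lebesgue (\<lambda>t. indicator {0<..<b} t *\<^sub>R (indicator {0<..<T} t *\<^sub>R (norm (v t))\<^sup>2))"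
        by (rule integrable_mult_indicator[rotated]) simp
      moreover have "(\<lambda>t. indicator {0<..<b} t *\<^sub>R (indicator {0<..<T} t *\<^sub>R (norm (v t))\<^sup>2)) =
          (\<lambda>t. indicator {0<..<b} t *\<^sub>R (norm (u t))\<^sup>2)"
        by (auto simp: u_def split: split_indicator)
      ultimately show "integrable (leb 0 b) (\<lambda>t. (norm (u t))\<^sup>2)"
        by (intro integrable_restrict_space[THEN iffD2]) (simp, simp only:)
    qed
    then have "u \<in> L2_loc" by (simp add: L2_loc_def)
    then obtain x where x: "has_integral_Xm1 D A T (\<lambda>\<tau>. S_m1 D A S (T - \<tau>) (B (u \<tau>))) (emb D A x)"
      "norm x \<le> C * Lp_norm 2 0 T u" using C(2) by blast
    have hv: "has_integral_Xm1 D A T (\<lambda>\<tau>. S_m1 D A S (T - \<tau>) (B (v \<tau>))) (emb D A x)"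
      using x(1) by (subst has_integral_Xm1_cong[of T _ "\<lambda>\<tau>. S_m1 D A S (T - \<tau>) (B (u \<tau>))"]) (auto simp: uv)
    have nu: "Lp_norm 2 0 T u = Lp_norm 2 0 T v"
      unfolding Lp_two_norm by (intro arg_cong[where f = sqrt] Bochner_Integration.integral_cong) (auto simp: uv)
    have pt: "S_m1 D A S (T - \<tau>) (B (v \<tau>)) z = v \<tau> \<bullet> obs z (T - \<tau>)" if "\<tau> \<in> {0<..<T}" "z \<in> Ds" for \<tau> z
      using that by (simp add: S_m1_apply B_Xm1 obs_inner)
    have int: "integrable (leb 0 T) (\<lambda>t. v t \<bullet> obs z (T - t))" if z: "z \<in> Ds" for z
      using has_integral_Xm1_apply(1)[OF hv z]
      by (rule Bochner_Integration.integrable_cong[THEN iffD1, rotated -1]) (auto simp: pt z)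
    have val: "x' \<bullet> z = (\<integral>t. v t \<bullet> obs z (T - t) \<partial>leb 0 T)"
      if z: "z \<in> Ds" and h: "has_integral_Xm1 D A T (\<lambda>\<tau>. S_m1 D A S (T - \<tau>) (B (v \<tau>))) (emb D A x')" for x' z
    proof -
      have "x' \<bullet> z = emb D A x' z" using z by (simp add: emb_def)
      also have "\<dots> = (\<integral>t. S_m1 D A S (T - t) (B (v t)) z \<partial>leb 0 T)" by (rule has_integral_Xm1_apply(2)[OF h z])
      also have "\<dots> = (\<integral>t. v t \<bullet> obs z (T - t) \<partial>leb 0 T)"
        by (rule Bochner_Integration.integral_cong) (auto simp: pt z)
      finally show ?thesis .
    qed
    have "(THE x. has_integral_Xm1 D A T (\<lambda>\<tau>. S_m1 D A S (T - \<tau>) (B (v \<tau>))) (emb D A x)) = x"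
    proof (rule the_equality)
      show "has_integral_Xm1 D A T (\<lambda>\<tau>. S_m1 D A S (T - \<tau>) (B (v \<tau>))) (emb D A x)" by (rule hv)
    next
      fix x' assume h: "has_integral_Xm1 D A T (\<lambda>\<tau>. S_m1 D A S (T - \<tau>) (B (v \<tau>))) (emb D A x')"
      have orth: "(x' - x) \<bullet> z = 0" if "z \<in> Ds" for z
        using val[OF that h] val[OF that hv] by (simp add: inner_diff_left)
      show "x' = x" using Ds_orthogonal_trivial[OF orth] by simp
    qed
    then have y: "yhat D A S B T 0 v = x"
      using linear_simps(3)[OF S_bl[of T]] T by (simp add: yhat_def)
    show ?thesis using x(2) nu int val[OF _ hv] by (simp add: y)
  qed
  then show ?thesis using C(1) by blast
qed

end

section \<open>Essentially bounded and p-integrable controls\<close>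

lemma emeasure_leb_space: "a \<le> b \<Longrightarrow> emeasure (leb a b) {a<..<b} = ennreal (b - a)"
  by (simp add: emeasure_restrict_space)

lemma measure_leb_space: "a \<le> b \<Longrightarrow> measure (leb a b) {a<..<b} = b - a"
  by (simp add: measure_restrict_space)

text \<open>The interval has positive measure, so the essential supremum of the norm is at least 0.
  Being finite as well, it survives \<open>real_of_ereal\<close>.\<close>

lemma Linf_AE:
  assumes v: "v \<in> Linf a b" and ab: "a < b"
  shows "AE t in leb a b. norm (v t) \<le> Linf_norm a b v" "0 \<le> Linf_norm a b v"
proof -
  define e where "e = esssup (leb a b) (\<lambda>t. ereal (norm (v t)))"
  have fin: "e < \<infinity>" using v by (simp add: Linf_def e_def)
  have "ereal 0 = esssup (leb a b) (\<lambda>t. ereal 0)"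
    using ab by (intro esssup_const[symmetric]) (simp add: emeasure_leb_space)
  also have "\<dots> \<le> e" unfolding e_def by (intro esssup_mono) auto
  finally have "0 \<le> e" by (simp add: zero_ereal_def)
  with fin obtain r where r: "e = ereal r" "0 \<le> r" by (cases e) auto
  have n: "Linf_norm a b v = r" using r by (simp add: Linf_norm_def e_def[symmetric])
  have "AE t in leb a b. ereal (norm (v t)) \<le> e" unfolding e_def by (rule esssup_AE)
  then show "AE t in leb a b. norm (v t) \<le> Linf_norm a b v" by (simp add: r n)
  show "0 \<le> Linf_norm a b v" by (simp add: n r)
qed

lemma Linf_I:
  assumes v: "strongly_measurable (leb a b) v" and ae: "AE t in leb a b. norm (v t) \<le> M" and ab: "a < b" and M: "0 \<le> M"
  shows "v \<in> Linf a b" "Linf_norm a b v \<le> M"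
proof -
  have m: "(\<lambda>t. ereal (norm (v t))) \<in> borel_measurable (leb a b)"
    using leb_norm_measurable[OF v] by measurable
  have le: "esssup (leb a b) (\<lambda>t. ereal (norm (v t))) \<le> ereal M"
    using ae by (intro esssup_I m) simp
  then show L: "v \<in> Linf a b" using v by (auto simp: Linf_def)
  define e where "e = esssup (leb a b) (\<lambda>t. ereal (norm (v t)))"
  have "e \<le> ereal M" using le by (simp add: e_def)
  then show "Linf_norm a b v \<le> M"
    unfolding Linf_norm_def e_def[symmetric] using M by (cases e) auto
qed

lemma bounded_integrable_leb:
  fixes f :: "real \<Rightarrow> real"
  assumes "f \<in> borel_measurable (leb a b)" "AE t in leb a b. \<bar>f t\<bar> \<le> M"
  shows "integrable (leb a b) f"
proof -
  interpret finite_measure "leb a b" by (rule finite_measure_leb)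
  show ?thesis by (rule integrable_const_bound[where B = M]) (use assms in auto)
qed

lemma Lp_two_bounded:
  assumes T: "0 < T" and w: "strongly_measurable (leb 0 T) w" and ae: "AE t in leb 0 T. norm (w t) \<le> M" and M: "0 \<le> M"
  shows "w \<in> Lp 2 0 T" "Lp_norm 2 0 T w \<le> M * sqrt T"
proof -
  interpret finite_measure "leb 0 T" by (rule finite_measure_leb)
  have m: "(\<lambda>t. (norm (w t))\<^sup>2) \<in> borel_measurable (leb 0 T)"
    using leb_norm_measurable[OF w] by measurable
  have ae': "AE t in leb 0 T. (norm (w t))\<^sup>2 \<le> M\<^sup>2"
    using ae by eventually_elim (auto intro: power_mono)
  have int: "integrable (leb 0 T) (\<lambda>t. (norm (w t))\<^sup>2)"
    by (rule bounded_integrable_leb[OF m, of "M\<^sup>2"]) (use ae' in simp)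
  then show "w \<in> Lp 2 0 T" using w by (simp add: Lp_two_iff)
  have "(\<integral>t. (norm (w t))\<^sup>2 \<partial>leb 0 T) \<le> (\<integral>t. M\<^sup>2 \<partial>leb 0 T)"
    using int ae' by (intro integral_mono_AE) auto
  also have "\<dots> = M\<^sup>2 * T" using T by (simp add: measure_leb_space)
  finally have "sqrt (\<integral>t. (norm (w t))\<^sup>2 \<partial>leb 0 T) \<le> sqrt (M\<^sup>2 * T)" by simp
  then show "Lp_norm 2 0 T w \<le> M * sqrt T" using M by (simp add: Lp_two_norm real_sqrt_mult)
qed

text \<open>Admissibility is an \<open>L\<^sup>2\<close> statement. The inequality x^2 <= 1 + x^p on
  a bounded interval brings the controls of the hypothesis under it.\<close>

lemma Lp_two_of_Lp:
  assumes w: "w \<in> Lp p a b" and p: "2 \<le> p"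
  shows "w \<in> Lp 2 a b"
  unfolding Lp_two_iff
proof
  interpret finite_measure "leb a b" by (rule finite_measure_leb)
  show sm: "strongly_measurable (leb a b) w" by (rule Lp_measurable[OF w])
  have int: "integrable (leb a b) (\<lambda>t. norm (w t) powr p)" using w by (simp add: Lp_def)
  show "integrable (leb a b) (\<lambda>t. (norm (w t))\<^sup>2)"
  proof (rule Bochner_Integration.integrable_bound)
    show "integrable (leb a b) (\<lambda>t. 1 + norm (w t) powr p)" using int by simp
    show "(\<lambda>t. (norm (w t))\<^sup>2) \<in> borel_measurable (leb a b)" using leb_norm_measurable[OF sm] by measurable
    have "x\<^sup>2 \<le> 1 + x powr p" if x: "0 \<le> x" for x :: real
    proof (cases "x \<le> 1")
      case True then have "x\<^sup>2 \<le> 1" using x by (simp add: power_le_one)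
      then show ?thesis using powr_ge_zero[of x p] by linarith
    next
      case False
      then have "x powr 2 \<le> x powr p" using p by (intro powr_mono) auto
      then show ?thesis using False by (simp add: powr_numeral)
    qed
    then show "AE t in leb a b. norm ((norm (w t))\<^sup>2) \<le> norm (1 + norm (w t) powr p)"
      by (intro AE_I2) (simp add: abs_of_nonneg add_nonneg_nonneg)
  qed
qed

lemma Lp_reflect:
  assumes w: "w \<in> Lp p 0 T"
  shows "(\<lambda>t. w (T - t)) \<in> Lp p 0 T" "Lp_norm p 0 T (\<lambda>t. w (T - t)) = Lp_norm p 0 T w"
proof -
  have sm: "strongly_measurable (leb 0 T) w" and int: "integrable (leb 0 T) (\<lambda>t. norm (w t) powr p)"
    using w by (auto simp: Lp_def)
  show "(\<lambda>t. w (T - t)) \<in> Lp p 0 T"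
    unfolding Lp_def using strongly_measurable_reflect[OF sm] integrable_reflect[OF int] by simp
  show "Lp_norm p 0 T (\<lambda>t. w (T - t)) = Lp_norm p 0 T w"
    unfolding Lp_norm_def using integral_reflect[OF borel_measurable_integrable[OF int]] by simp
qed

text \<open>The functions |u_k|^p / 4^k have a sum s^p that is integrable, hence finite almost
  everywhere. Since p is at least 1, |u_k| <= 4^k s, and the weights 8^-k leave a geometric series
  with sum at most 2 s. This pointwise majorant makes completeness of the space \<open>Lp\<close>
  dispensable.\<close>

lemma AE_suminf_Lp:
  fixes u :: "nat \<Rightarrow> real \<Rightarrow> 'b::{real_normed_vector,complete_space}"
  assumes p: "1 \<le> p" and sm: "\<And>k. strongly_measurable (leb a b) (u k)"
    and int: "\<And>k. integrable (leb a b) (\<lambda>t. norm (u k t) powr p)"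
    and le: "\<And>k. (\<integral>t. norm (u k t) powr p \<partial>leb a b) \<le> 1"
    and c: "\<And>k. \<bar>c k\<bar> = 1"
  shows "AE t in leb a b. summable (\<lambda>k. norm ((c k / 8 ^ k) *\<^sub>R u k t))"
    "(\<lambda>t. \<Sum>k. (c k / 8 ^ k) *\<^sub>R u k t) \<in> Lp p a b"
proof -
  define q where "q k t = norm (u k t) powr p / 4 ^ k" for k t
  have q0: "0 \<le> q k t" for k t by (simp add: q_def)
  have qi: "integrable (leb a b) (q k)" for k unfolding q_def using int by simp
  have q_le: "(\<integral>t. q k t \<partial>leb a b) \<le> (1/4) ^ k" for k
    unfolding q_def using divide_right_mono[OF le[of k], of "4 ^ k"] by (simp add: power_one_over)
  have sq: "summable (\<lambda>k. \<integral>t. norm (q k t) \<partial>leb a b)"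
  proof (rule summable_comparison_test')
    show "summable (\<lambda>k. (1/4::real) ^ k)" by (rule summable_geometric) simp
    show "norm (\<integral>t. norm (q k t) \<partial>leb a b) \<le> (1/4) ^ k" for k
      using q_le[of k] q0 by (simp add: abs_of_nonneg integral_nonneg_AE)
  qed
  have aeq: "AE t in leb a b. summable (\<lambda>k. norm (q k t))"
  proof -
    have "(\<integral>\<^sup>+t. (\<Sum>k. ennreal (q k t)) \<partial>leb a b) = (\<Sum>k. \<integral>\<^sup>+t. ennreal (q k t) \<partial>leb a b)"
      using borel_measurable_integrable[OF qi] by (intro nn_integral_suminf) measurable
    also have "\<dots> = (\<Sum>k. ennreal (\<integral>t. q k t \<partial>leb a b))"
      using qi q0 by (simp add: nn_integral_eq_integral)
    also have "\<dots> = ennreal (\<Sum>k. \<integral>t. q k t \<partial>leb a b)"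
      using sq q0 by (intro suminf_ennreal2) (auto intro: integral_nonneg_AE simp: abs_of_nonneg)
    also have "\<dots> < \<infinity>" by simp
    finally have "(\<integral>\<^sup>+t. (\<Sum>k. ennreal (q k t)) \<partial>leb a b) \<noteq> \<infinity>" by simp
    then have "AE t in leb a b. (\<Sum>k. ennreal (q k t)) \<noteq> \<infinity>"
      by (rule nn_integral_PInf_AE[rotated])
        (intro borel_measurable_suminf_order measurable_compose[OF borel_measurable_integrable[OF qi] measurable_ennreal])
    then show ?thesis
    proof eventually_elim
      case (elim t)
      then have "summable (\<lambda>k. q k t)" by (intro summable_suminf_not_top) (auto simp: q0)
      then show ?case by (simp add: q0)
    qed
  qed
  have Gi: "integrable (leb a b) (\<lambda>t. \<Sum>k. q k t)" by (rule integrable_suminf[OF qi aeq sq])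
  have pw: "summable (\<lambda>k. norm ((c k / 8 ^ k) *\<^sub>R u k t)) \<and>
      norm (\<Sum>k. (c k / 8 ^ k) *\<^sub>R u k t) powr p \<le> 2 powr p * (\<Sum>k. q k t)"
    if sm: "summable (\<lambda>k. norm (q k t))" for t
  proof -
    have sq': "summable (\<lambda>k. q k t)" using sm by (simp add: q0)
    define s where "s = (\<Sum>k. q k t) powr (1 / p)"
    have G0: "0 \<le> (\<Sum>k. q k t)" by (rule suminf_nonneg[OF sq' q0])
    have s0: "0 \<le> s" by (simp add: s_def)
    have sp: "s powr p = (\<Sum>k. q k t)" using p G0 by (simp add: s_def powr_powr)
    have each: "norm (u k t) \<le> 4 ^ k * s" for k
    proof -
      have "(norm (u k t) / 4 ^ k) powr p = norm (u k t) powr p / (4 ^ k) powr p"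
        by (simp add: powr_divide)
      also have "\<dots> \<le> norm (u k t) powr p / 4 ^ k"
      proof (intro divide_left_mono)
        have "(4 ^ k :: real) powr 1 \<le> (4 ^ k) powr p" using p by (intro powr_mono) auto
        then show "4 ^ k \<le> (4 ^ k :: real) powr p" by simp
      qed auto
      also have "\<dots> \<le> (\<Sum>k. q k t)"
        unfolding q_def[symmetric] using sum_le_suminf[OF sq', of "{k}"] q0 by simp
      finally have "(norm (u k t) / 4 ^ k) powr p \<le> s powr p" by (simp add: sp)
      then have "norm (u k t) / 4 ^ k \<le> s"
        using powr_less_mono2[of p s "norm (u k t) / 4 ^ k"] p s0 by (meson not_le less_le_trans zero_less_one)
      then show ?thesis by (simp add: divide_le_eq mult.commute)
    qed
    have trm: "norm ((c k / 8 ^ k) *\<^sub>R u k t) \<le> s * (1/2) ^ k" for k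
    proof -
      have "norm ((c k / 8 ^ k) *\<^sub>R u k t) = norm (u k t) / 8 ^ k" by (simp add: c)
      also have "\<dots> \<le> (4 ^ k * s) / 8 ^ k" by (intro divide_right_mono each) simp
      also have "\<dots> = s * (4 / 8) ^ k"
        by (simp only: power_divide times_divide_eq_right mult.commute)
      finally show ?thesis by simp
    qed
    have gs: "summable (\<lambda>k. s * (1/2) ^ k)" by (intro summable_mult summable_geometric) simp
    have st: "summable (\<lambda>k. norm ((c k / 8 ^ k) *\<^sub>R u k t))"
      by (rule summable_comparison_test'[OF gs]) (use trm in simp)
    have "norm (\<Sum>k. (c k / 8 ^ k) *\<^sub>R u k t) \<le> (\<Sum>k. s * (1/2) ^ k)"
    proof (rule LIMSEQ_le_const2)
      show "(\<lambda>n. norm (\<Sum>k<n. (c k / 8 ^ k) *\<^sub>R u k t)) \<longlonglongrightarrow> norm (\<Sum>k. (c k / 8 ^ k) *\<^sub>R u k t)"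
        by (rule tendsto_norm[OF summable_LIMSEQ[OF absolutely_summable_complete[OF st]]])
      have "norm (\<Sum>k<n. (c k / 8 ^ k) *\<^sub>R u k t) \<le> (\<Sum>k. s * (1/2) ^ k)" for n
      proof -
        have "norm (\<Sum>k<n. (c k / 8 ^ k) *\<^sub>R u k t) \<le> (\<Sum>k<n. s * (1/2) ^ k)"
          by (intro sum_norm_le trm)
        also have "\<dots> \<le> (\<Sum>k. s * (1/2) ^ k)" using s0 by (intro sum_le_suminf gs) auto
        finally show ?thesis .
      qed
      then show "\<exists>N. \<forall>n\<ge>N. norm (\<Sum>k<n. (c k / 8 ^ k) *\<^sub>R u k t) \<le> (\<Sum>k. s * (1/2) ^ k)" by blast
    qed
    also have "\<dots> = 2 * s" by (subst suminf_mult) (auto simp: suminf_geometric)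
    finally have "norm (\<Sum>k. (c k / 8 ^ k) *\<^sub>R u k t) powr p \<le> (2 * s) powr p"
      using p by (intro powr_mono2) auto
    also have "\<dots> = 2 powr p * (\<Sum>k. q k t)" using s0 by (simp add: powr_mult sp)
    finally show ?thesis using st by blast
  qed
  show ae: "AE t in leb a b. summable (\<lambda>k. norm ((c k / 8 ^ k) *\<^sub>R u k t))"
    using aeq by eventually_elim (use pw in blast)
  have lim: "AE t in leb a b. (\<lambda>n. \<Sum>k<n. (c k / 8 ^ k) *\<^sub>R u k t) \<longlonglongrightarrow> (\<Sum>k. (c k / 8 ^ k) *\<^sub>R u k t)"
    using ae by eventually_elim (rule summable_LIMSEQ[OF absolutely_summable_complete])
  have smU: "strongly_measurable (leb a b) (\<lambda>t. \<Sum>k. (c k / 8 ^ k) *\<^sub>R u k t)"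
    by (rule leb_strongly_measurable_AE_limit[OF _ lim])
      (intro strongly_measurable_sum strongly_measurable_scaleR sm strongly_measurable_const)
  show "(\<lambda>t. \<Sum>k. (c k / 8 ^ k) *\<^sub>R u k t) \<in> Lp p a b"
    unfolding Lp_def
  proof (intro CollectI conjI smU)
    show "integrable (leb a b) (\<lambda>t. norm (\<Sum>k. (c k / 8 ^ k) *\<^sub>R u k t) powr p)"
    proof (rule Bochner_Integration.integrable_bound)
      show "integrable (leb a b) (\<lambda>t. 2 powr p * (\<Sum>k. q k t))" using Gi by simp
      show "(\<lambda>t. norm (\<Sum>k. (c k / 8 ^ k) *\<^sub>R u k t) powr p) \<in> borel_measurable (leb a b)"
        using leb_norm_measurable[OF smU] by measurable
      show "AE t in leb a b. norm (norm (\<Sum>k. (c k / 8 ^ k) *\<^sub>R u k t) powr p) \<le> norm (2 powr p * (\<Sum>k. q k t))"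
        using aeq by eventually_elim (use pw in \<open>auto intro: order_trans[OF _ abs_ge_self]\<close>)
    qed
  qed
qed

section \<open>Observability from the inclusion of reachable sets\<close>

context control_system
begin

text \<open>Controls in reversed time, so that they meet the observation at the same argument and
  the final time sits at s = 0.\<close>

definition reach :: "real \<Rightarrow> (real \<Rightarrow> 'u) \<Rightarrow> 'x" where
  "reach T w = yhat D A S B T 0 (\<lambda>t. w (T - t))"

lemma yhat_reach: "yhat D A S B T 0 v = reach T (\<lambda>t. v (T - t))"
  by (simp add: reach_def)

lemma obs_sm: "z \<in> Ds \<Longrightarrow> 0 \<le> a \<Longrightarrow> strongly_measurable (leb a b) (obs z)"
  by (intro strongly_measurable_continuous obs_cont')

lemma obs_norm_int: "z \<in> Ds \<Longrightarrow> 0 \<le> a \<Longrightarrow> integrable (leb a b) (\<lambda>t. norm (obs z t))"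
  by (intro integrable_continuous_leb continuous_on_norm obs_cont')

lemma reach_bound:
  assumes T: "0 < T"
  shows "\<exists>C>0. \<forall>w\<in>Lp 2 0 T. norm (reach T w) \<le> C * Lp_norm 2 0 T w"
  using reachable[OF T] Lp_reflect[of _ 2 T] unfolding reach_def by metis

lemma reach_inner:
  assumes T: "0 < T" and w: "w \<in> Lp 2 0 T" and z: "z \<in> Ds"
  shows "integrable (leb 0 T) (\<lambda>s. w s \<bullet> obs z s)" "reach T w \<bullet> z = (\<integral>s. w s \<bullet> obs z s \<partial>leb 0 T)"
proof -
  have w': "(\<lambda>t. w (T - t)) \<in> Lp 2 0 T" by (rule Lp_reflect(1)[OF w])
  obtain C where C: "\<And>v. v \<in> Lp 2 0 T \<Longrightarrow> norm (yhat D A S B T 0 v) \<le> C * Lp_norm 2 0 T v \<and>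
    (\<forall>z\<in>Ds. integrable (leb 0 T) (\<lambda>t. v t \<bullet> obs z (T - t)) \<and>
      yhat D A S B T 0 v \<bullet> z = (\<integral>t. v t \<bullet> obs z (T - t) \<partial>leb 0 T))"
    using reachable[OF T] by blast
  have int: "integrable (leb 0 T) (\<lambda>t. w (T - t) \<bullet> obs z (T - t))"
    and val: "reach T w \<bullet> z = (\<integral>t. w (T - t) \<bullet> obs z (T - t) \<partial>leb 0 T)"
    using C[OF w'] z by (simp_all add: reach_def)
  from integrable_reflect[OF int] show "integrable (leb 0 T) (\<lambda>s. w s \<bullet> obs z s)" by simp
  have "(\<lambda>s. w s \<bullet> obs z s) \<in> borel_measurable (leb 0 T)"
    using w z by (intro leb_inner_measurable obs_sm) (auto simp: Lp_def)
  from integral_reflect[OF this] show "reach T w \<bullet> z = (\<integral>s. w s \<bullet> obs z s \<partial>leb 0 T)" using val by simp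
qed

text \<open>The hypothesis of the theorem for one exponent: whatever an early control produces at
  the final time, a later bounded control produces as well.\<close>

definition null_controlled :: "real \<Rightarrow> bool" where
  "null_controlled p \<longleftrightarrow> 2 \<le> p \<and> (\<forall>T th. 0 < th \<and> th < T \<longrightarrow> A_p D A S B p T th \<subseteq> A_inf D A S B T th)"

text \<open>The replacement control w reaches the same state as u, hence has the same pairing with
  every observation, and it lives on (0, a). The constant is the norm of w and so depends on
  u.\<close>

lemma observability_pointwise:
  assumes H: "null_controlled p" and ab: "0 < a" "a < b"
    and u: "u \<in> Lp p 0 b" "AE t in leb 0 a. u t = 0"
  shows "\<exists>M\<ge>0. \<forall>z\<in>Ds. \<bar>\<integral>t. u t \<bullet> obs z t \<partial>leb 0 b\<bar> \<le> M * (\<integral>t. norm (obs z t) \<partial>leb 0 a)"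
proof -
  \<comment> \<open>In forward time u acts before b - a and its replacement after it; under the
    reflection of (0, b) these become (a, b) and (0, a).\<close>
  have p: "2 \<le> p" and sub: "A_p D A S B p b (b - a) \<subseteq> A_inf D A S B b (b - a)"
    using H ab by (auto simp: null_controlled_def)
  have b: "0 < b" using ab by simp
  have "AE t in leb (b - a) b. u (b - t) = 0"
  proof -
    have "AE t in leb 0 b. t \<in> {0<..<a} \<longrightarrow> u t = 0"
      using u(2) ab unfolding AE_leb_iff by eventually_elim auto
    then have "AE t in leb 0 b. b - t \<in> {0<..<a} \<longrightarrow> u (b - t) = 0" by (rule AE_reflect)
    then show ?thesis unfolding AE_leb_iff by eventually_elim (use ab in auto)
  qed
  then have "reach b u \<in> A_p D A S B p b (b - a)"
    unfolding A_p_def reach_def using Lp_reflect(1)[OF u(1)] by blast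
  then have "reach b u \<in> A_inf D A S B b (b - a)" using sub by blast
  then obtain v where v: "v \<in> Linf 0 b" "AE t in leb 0 (b - a). v t = 0" "reach b u = yhat D A S B b 0 v"
    by (auto simp: A_inf_def)
  define w where "w t = v (b - t)" for t
  define M where "M = Linf_norm 0 b v"
  have M: "0 \<le> M" "AE t in leb 0 b. norm (v t) \<le> M" using Linf_AE[OF v(1) b] by (auto simp: M_def)
  have wM: "AE t in leb 0 b. norm (w t) \<le> M" unfolding w_def by (rule AE_reflect[OF M(2)])
  have smw: "strongly_measurable (leb 0 b) w"
    unfolding w_def using v(1) by (intro strongly_measurable_reflect) (simp add: Linf_def)
  have w2: "w \<in> Lp 2 0 b" by (rule Lp_two_bounded(1)[OF b smw wM M(1)])
  have w0: "AE t in leb 0 b. t \<in> {a<..<b} \<longrightarrow> w t = 0"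
  proof -
    have "AE t in leb 0 b. t \<in> {0<..<b - a} \<longrightarrow> v t = 0"
      using v(2) ab unfolding AE_leb_iff by eventually_elim auto
    then have "AE t in leb 0 b. b - t \<in> {0<..<b - a} \<longrightarrow> v (b - t) = 0" by (rule AE_reflect)
    then show ?thesis by eventually_elim (auto simp: w_def)
  qed
  \<comment> \<open>The point a lies in neither of the open intervals on which w is
    described.\<close>
  have a0: "AE t in leb 0 b. t \<noteq> a"
    unfolding AE_leb_iff by (rule AE_mp[OF AE_not_in[of "{a}"]]) (auto intro: AE_I2)
  have uw: "reach b u = reach b w" using v(3) by (simp add: yhat_reach w_def[abs_def])
  have "\<bar>\<integral>t. u t \<bullet> obs z t \<partial>leb 0 b\<bar> \<le> M * (\<integral>t. norm (obs z t) \<partial>leb 0 a)" if z: "z \<in> Ds" for z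
  proof -
    have "(\<integral>t. u t \<bullet> obs z t \<partial>leb 0 b) = (\<integral>t. w t \<bullet> obs z t \<partial>leb 0 b)"
      using reach_inner(2)[OF b Lp_two_of_Lp[OF u(1) p] z] reach_inner(2)[OF b w2 z] uw by simp
    also have "\<bar>\<dots>\<bar> \<le> (\<integral>t. \<bar>w t \<bullet> obs z t\<bar> \<partial>leb 0 b)" by (rule integral_abs_bound)
    also have "\<dots> \<le> (\<integral>t. M * (indicator {0<..<a} t *\<^sub>R norm (obs z t)) \<partial>leb 0 b)"
    proof (rule integral_mono_AE)
      show "integrable (leb 0 b) (\<lambda>t. \<bar>w t \<bullet> obs z t\<bar>)" using reach_inner(1)[OF b w2 z] by simp
      show "integrable (leb 0 b) (\<lambda>t. M * (indicator {0<..<a} t *\<^sub>R norm (obs z t)))"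
        using ab z by (intro integrable_mult_right integrable_mult_indicator obs_norm_int) (auto simp: sets_leb_iff)
      show "AE t in leb 0 b. \<bar>w t \<bullet> obs z t\<bar> \<le> M * (indicator {0<..<a} t *\<^sub>R norm (obs z t))"
        using wM w0 a0 AE_space
      proof eventually_elim
        case (elim t)
        have "\<bar>w t \<bullet> obs z t\<bar> \<le> norm (w t) * norm (obs z t)" by (rule Cauchy_Schwarz_ineq2)
        moreover have "\<dots> \<le> M * norm (obs z t)" using elim(1) by (intro mult_right_mono) auto
        ultimately show ?case using elim by (cases "t < a") auto
      qed
    qed
    also have "\<dots> = M * (\<integral>t. norm (obs z t) \<partial>leb 0 a)"
    proof -
      have "(\<integral>t. indicator {0<..<a} t *\<^sub>R norm (obs z t) \<partial>leb 0 b)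
          = (\<integral>t. indicator {0<..<b} t *\<^sub>R (indicator {0<..<a} t *\<^sub>R norm (obs z t)) \<partial>lebesgue)"
        by (rule integral_restrict_space) simp
      also have "\<dots> = (\<integral>t. indicator {0<..<a} t *\<^sub>R norm (obs z t) \<partial>lebesgue)"
        by (rule Bochner_Integration.integral_cong) (use ab in \<open>auto split: split_indicator\<close>)
      also have "\<dots> = (\<integral>t. norm (obs z t) \<partial>leb 0 a)"
        by (rule integral_restrict_space[symmetric]) simp
      finally show ?thesis by simp
    qed
    finally show ?thesis .
  qed
  then show ?thesis using M(1) by blast
qed

text \<open>The unit ball of \<open>Lp\<close> on (a, b), normalised by the p-th power integral.
  Vanishing up to a is pointwise, so it passes to infinite sums without a null-set argument.\<close>

definition unit_controls :: "real \<Rightarrow> real \<Rightarrow> real \<Rightarrow> (real \<Rightarrow> 'u) set" where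
  "unit_controls p a b = {u. strongly_measurable (leb 0 b) u \<and> (\<forall>t\<le>a. u t = 0) \<and>
      integrable (leb 0 b) (\<lambda>t. norm (u t) powr p) \<and> (\<integral>t. norm (u t) powr p \<partial>leb 0 b) \<le> 1}"

text \<open>Were there no uniform constant, normalised z n would have pairings with the unit ball
  exceeding 16^n. Near-maximisers u n, summed with hump signs and weights 8^-n, form one control
  whose pairing with \<open>z n\<close> is at least 2^n / 4, against the pointwise estimate for that
  control.\<close>

lemma observability:
  assumes H: "null_controlled p" and ab: "0 < a" "a < b"
  shows "\<exists>C\<ge>0. \<forall>z\<in>Ds. \<forall>u\<in>unit_controls p a b.
      \<bar>\<integral>t. u t \<bullet> obs z t \<partial>leb 0 b\<bar> \<le> C * (\<integral>t. norm (obs z t) \<partial>leb 0 a)"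
proof (rule ccontr)
  assume neg: "\<not> ?thesis"
  have p: "2 \<le> p" using H by (simp add: null_controlled_def)
  have b: "0 < b" using ab by simp
  let ?U = "unit_controls p a b"
  define N where "N z = (\<integral>t. norm (obs z t) \<partial>leb 0 a)" for z
  define J where "J u z = (\<integral>t. u t \<bullet> obs z t \<partial>leb 0 b)" for u z
  have neg': "\<exists>z\<in>Ds. \<exists>u\<in>?U. \<not> \<bar>J u z\<bar> \<le> C * N z" if "0 \<le> C" for C
    using neg that unfolding N_def J_def by blast
  have ULp: "u \<in> Lp p 0 b" if "u \<in> ?U" for u using that by (simp add: unit_controls_def Lp_def)
  have Uz: "AE t in leb 0 a. u t = 0" if "u \<in> ?U" for u using that by (intro AE_I2) (simp add: unit_controls_def)
  have N0: "0 \<le> N z" for z unfolding N_def by (rule integral_nonneg_AE) simp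
  have scaleN: "N (r *\<^sub>R z) = \<bar>r\<bar> * N z" "J u (r *\<^sub>R z) = r * J u z" if z: "z \<in> Ds" for r z u
  proof -
    have o: "obs (r *\<^sub>R z) t = r *\<^sub>R obs z t" if "0 \<le> t" for t
      using obs_linear[OF z z that, of r 0] by simp
    have "N (r *\<^sub>R z) = (\<integral>t. \<bar>r\<bar> * norm (obs z t) \<partial>leb 0 a)"
      unfolding N_def by (rule Bochner_Integration.integral_cong) (auto simp: o)
    then show "N (r *\<^sub>R z) = \<bar>r\<bar> * N z" by (simp add: N_def)
    have "J u (r *\<^sub>R z) = (\<integral>t. r * (u t \<bullet> obs z t) \<partial>leb 0 b)"
      unfolding J_def by (rule Bochner_Integration.integral_cong) (auto simp: o)
    then show "J u (r *\<^sub>R z) = r * J u z" by (simp add: J_def)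
  qed
  have "\<exists>z\<in>Ds. N z = 1 \<and> (\<exists>u\<in>?U. 16 ^ n < \<bar>J u z\<bar>)" for n :: nat
  proof -
    obtain z u where zu: "z \<in> Ds" "u \<in> ?U" "16 ^ n * N z < \<bar>J u z\<bar>" using neg'[of "16 ^ n"] by (auto simp: not_le)
    \<comment> \<open>If N z were 0, the pointwise bound would force J u z = 0; hence the violating
      z can be normalised.\<close>
    obtain M where "\<bar>J u z\<bar> \<le> M * N z"
      using observability_pointwise[OF H ab ULp[OF zu(2)] Uz[OF zu(2)]] zu(1) unfolding J_def N_def by blast
    then have "N z \<noteq> 0" using zu(3) by auto
    then have Npos: "0 < N z" using N0[of z] by simp
    have "16 ^ n < \<bar>J u ((1 / N z) *\<^sub>R z)\<bar>"
      using zu Npos by (simp add: scaleN abs_mult pos_less_divide_eq)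
    moreover have "N ((1 / N z) *\<^sub>R z) = 1" using zu(1) Npos by (simp add: scaleN)
    ultimately show ?thesis using zu Ds_scale(1)[OF zu(1)] by blast
  qed
  then obtain z where z: "\<And>n. z n \<in> Ds" "\<And>n. N (z n) = 1" "\<And>n::nat. \<exists>u\<in>?U. 16 ^ n < \<bar>J u (z n)\<bar>" by metis
  have Jint: "integrable (leb 0 b) (\<lambda>t. u t \<bullet> obs w t)" if "u \<in> ?U" "w \<in> Ds" for u w
    using reach_inner(1)[OF b Lp_two_of_Lp[OF ULp[OF that(1)] p] that(2)] .
  \<comment> \<open>\<open>obs w\<close> is bounded on the compact interval, so the absolute
    pairings with the unit ball have a common bound. It makes the suprema \<open>M n\<close> finite
    and later justifies exchanging sum and integral.\<close>
  have Uabs: "\<exists>K. \<forall>u\<in>?U. (\<integral>t. \<bar>u t \<bullet> obs w t\<bar> \<partial>leb 0 b) \<le> K" if w: "w \<in> Ds" for w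
  proof -
    obtain K where K: "\<And>t. t \<in> {0..b} \<Longrightarrow> norm (obs w t) \<le> K"
      using compact_imp_bounded[OF compact_continuous_image[OF obs_cont'[OF w order_refl] compact_Icc]]
      unfolding bounded_iff by (metis imageI)
    have K0: "0 \<le> K" using order_trans[OF norm_ge_zero K[of 0]] b by simp
    interpret finite_measure "leb 0 b" by (rule finite_measure_leb)
    have "(\<integral>t. \<bar>u t \<bullet> obs w t\<bar> \<partial>leb 0 b) \<le> K * (b + 1)" if u: "u \<in> ?U" for u
    proof -
      have "(\<integral>t. \<bar>u t \<bullet> obs w t\<bar> \<partial>leb 0 b) \<le> (\<integral>t. K * (1 + norm (u t) powr p) \<partial>leb 0 b)"
      proof (rule integral_mono)
        show "integrable (leb 0 b) (\<lambda>t. \<bar>u t \<bullet> obs w t\<bar>)" using Jint[OF u w] by simp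
        show "integrable (leb 0 b) (\<lambda>t. K * (1 + norm (u t) powr p))" using u by (simp add: unit_controls_def)
        fix t assume "t \<in> space (leb 0 b)"
        then have t: "t \<in> {0..b}" by simp
        have x: "x \<le> 1 + x powr p" if "0 \<le> x" for x :: real
        proof (cases "x \<le> 1")
          case True then show ?thesis using powr_ge_zero[of x p] by linarith
        next
          case False
          then have "x powr 1 \<le> x powr p" using p by (intro powr_mono) auto
          then show ?thesis using False by simp
        qed
        have "\<bar>u t \<bullet> obs w t\<bar> \<le> norm (u t) * norm (obs w t)" by (rule Cauchy_Schwarz_ineq2)
        also have "\<dots> \<le> (1 + norm (u t) powr p) * K" by (intro mult_mono K t x) auto
        finally show "\<bar>u t \<bullet> obs w t\<bar> \<le> K * (1 + norm (u t) powr p)" by (simp add: mult.commute)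
      qed
      also have "\<dots> = K * (b + (\<integral>t. norm (u t) powr p \<partial>leb 0 b))"
        using u b by (simp add: unit_controls_def measure_leb_space)
      also have "\<dots> \<le> K * (b + 1)" using u K0 by (intro mult_left_mono) (auto simp: unit_controls_def)
      finally show ?thesis .
    qed
    then show ?thesis by blast
  qed
  define M where "M n = (SUP u\<in>?U. \<bar>J u (z n)\<bar>)" for n
  have bdd: "bdd_above ((\<lambda>u. \<bar>J u (z n)\<bar>) ` ?U)" for n
  proof -
    obtain K where "\<And>u. u \<in> ?U \<Longrightarrow> (\<integral>t. \<bar>u t \<bullet> obs (z n) t\<bar> \<partial>leb 0 b) \<le> K" using Uabs[OF z(1)] by blast
    then show ?thesis unfolding J_def by (intro bdd_aboveI2[of _ _ K]) (rule order_trans[OF integral_abs_bound])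
  qed
  have M_ge: "\<bar>J u (z n)\<bar> \<le> M n" if "u \<in> ?U" for u n unfolding M_def using that bdd by (intro cSUP_upper)
  have M16: "16 ^ n < M n" for n using z(3)[of n] M_ge less_le_trans by blast
  have "\<exists>u\<in>?U. M n / 2 \<le> \<bar>J u (z n)\<bar>" for n
  proof -
    have "?U \<noteq> {}" using z(3) by blast
    moreover have "M n / 2 < M n" using M16[of n] by (smt (verit) field_sum_of_halves zero_less_power)
    ultimately show ?thesis using less_cSUP_iff[OF _ bdd, of "M n / 2" n] unfolding M_def by (meson less_imp_le)
  qed
  then obtain u where u: "\<And>n. u n \<in> ?U" "\<And>n. M n / 2 \<le> \<bar>J (u n) (z n)\<bar>" by metis
  define t where "t n k = J (u k) (z n)" for n k
  define c where "c = hump_sign t"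
  have c: "\<bar>c k\<bar> = 1" for k by (simp add: c_def hump_sign_abs)
  have hump: "2 ^ n / 4 \<le> norm (\<Sum>k. (c k / 8 ^ k) *\<^sub>R t n k)" for n
    unfolding c_def
    by (rule gliding_hump[of t M]) (use M_ge[OF u(1)] u(2) M16 in \<open>auto simp: t_def less_imp_le\<close>)
  \<comment> \<open>One control carrying all humps. It is again in \<open>Lp\<close> and vanishes up
    to a, so the pointwise estimate assigns it a single constant, although N (z n) = 1 for every
    n.\<close>
  define v where "v s = (\<Sum>k. (c k / 8 ^ k) *\<^sub>R u k s)" for s
  have aes: "AE s in leb 0 b. summable (\<lambda>k. norm ((c k / 8 ^ k) *\<^sub>R u k s))" and vLp: "v \<in> Lp p 0 b"
    using AE_suminf_Lp[of p 0 b u c] p u(1) c unfolding v_def unit_controls_def by auto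
  have v0: "AE s in leb 0 a. v s = 0" using u(1) by (intro AE_I2) (simp add: v_def unit_controls_def)
  obtain K where K: "\<And>w. w \<in> Ds \<Longrightarrow> \<bar>J v w\<bar> \<le> K * N w"
    using observability_pointwise[OF H ab vLp v0] unfolding J_def N_def by blast
  have Jv: "J v (z n) = (\<Sum>k. (c k / 8 ^ k) *\<^sub>R t n k)" for n
  proof -
    define f where "f k s = (c k / 8 ^ k) * (u k s \<bullet> obs (z n) s)" for k s
    have fi: "integrable (leb 0 b) (f k)" for k unfolding f_def by (intro integrable_mult_right Jint u z)
    have ptw: "AE s in leb 0 b. summable (\<lambda>k. norm (f k s)) \<and> v s \<bullet> obs (z n) s = (\<Sum>k. f k s)"
      using aes
    proof eventually_elim
      case (elim s)
      have "norm (f k s) \<le> norm ((c k / 8 ^ k) *\<^sub>R u k s) * norm (obs (z n) s)" for k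
        using Cauchy_Schwarz_ineq2[of "(c k / 8 ^ k) *\<^sub>R u k s" "obs (z n) s"] by (simp add: f_def)
      then have "summable (\<lambda>k. norm (f k s))"
        by (intro summable_comparison_test'[OF summable_mult2[OF elim]]) simp
      moreover have "v s \<bullet> obs (z n) s = (\<Sum>k. ((c k / 8 ^ k) *\<^sub>R u k s) \<bullet> obs (z n) s)"
        unfolding v_def by (rule bounded_linear.suminf[OF bounded_linear_inner_left absolutely_summable_complete[OF elim]])
      ultimately show ?case by (simp add: f_def)
    qed
    obtain K' where K': "\<And>u. u \<in> ?U \<Longrightarrow> (\<integral>t. \<bar>u t \<bullet> obs (z n) t\<bar> \<partial>leb 0 b) \<le> K'" using Uabs[OF z(1)] by blast
    have sumI: "summable (\<lambda>k. \<integral>s. norm (f k s) \<partial>leb 0 b)"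
    proof (rule summable_comparison_test')
      show "summable (\<lambda>k. K' * (1/8) ^ k)" by (intro summable_mult summable_geometric) simp
      show "norm (\<integral>s. norm (f k s) \<partial>leb 0 b) \<le> K' * (1/8) ^ k" for k
      proof -
        have "(\<integral>s. norm (f k s) \<partial>leb 0 b) = (1/8) ^ k * (\<integral>s. \<bar>u k s \<bullet> obs (z n) s\<bar> \<partial>leb 0 b)"
          by (simp add: f_def abs_mult c power_one_over)
        also have "\<dots> \<le> (1/8) ^ k * K'" by (intro mult_left_mono K' u) simp
        moreover have "0 \<le> (\<integral>s. norm (f k s) \<partial>leb 0 b)" by (rule integral_nonneg_AE) simp
        ultimately show ?thesis by (simp add: mult.commute)
      qed
    qed
    have "J v (z n) = (\<integral>s. (\<Sum>k. f k s) \<partial>leb 0 b)"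
    proof -
      have aev: "AE s in leb 0 b. v s \<bullet> obs (z n) s = (\<Sum>k. f k s)" using ptw by eventually_elim simp
      have m1: "(\<lambda>s. v s \<bullet> obs (z n) s) \<in> borel_measurable (leb 0 b)"
        using vLp by (intro leb_inner_measurable obs_sm z) (auto simp: Lp_def)
      have m2: "(\<lambda>s. \<Sum>k. f k s) \<in> borel_measurable (leb 0 b)"
        by (rule complete_measure.measurable_AE_cong[OF complete_leb m1 aev]) simp
      show ?thesis unfolding J_def by (rule integral_cong_AE[OF m1 m2 aev])
    qed
    also have "\<dots> = (\<Sum>k. \<integral>s. f k s \<partial>leb 0 b)"
      by (rule integral_suminf[OF fi _ sumI]) (use ptw in \<open>eventually_elim, simp\<close>)
    also have "\<dots> = (\<Sum>k. (c k / 8 ^ k) *\<^sub>R t n k)" by (simp add: f_def t_def J_def)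
    finally show ?thesis .
  qed
  have "2 ^ n / 4 \<le> K" for n using hump[of n] K[OF z(1), of n] z(2)[of n] by (simp add: Jv)
  then have "2 ^ n \<le> 4 * K" for n by (simp add: field_simps)
  moreover obtain n where "4 * K < 2 ^ n" using real_arch_pow[of 2 "4*K"] by auto
  ultimately show False by (metis not_le)
qed

lemma nn_integral_eq_integral_leb:
  fixes f :: "real \<Rightarrow> real"
  assumes "integrable (leb a b) f" "\<And>t. 0 \<le> f t"
  shows "(\<integral>\<^sup>+t. ennreal (f t) \<partial>leb a b) = ennreal (\<integral>t. f t \<partial>leb a b)"
  using assms by (intro nn_integral_eq_integral) auto

text \<open>The test control is the direction of the observation on (T, T + 1). The length 1 of that
  interval puts it in the unit ball for every p, and its pairing is exactly the mass of the
  observation there.\<close>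

lemma obs_L1_extend:
  assumes H: "null_controlled p" and T: "0 < T"
  shows "\<exists>K>0. \<forall>z\<in>Ds. (\<integral>t. norm (obs z t) \<partial>leb 0 T) \<le> 1 \<longrightarrow> (\<integral>t. norm (obs z t) \<partial>leb 0 (T + 1)) \<le> K"
proof -
  obtain C where C0: "0 \<le> C" and C: "\<And>z u. z \<in> Ds \<Longrightarrow> u \<in> unit_controls p T (T + 1) \<Longrightarrow>
      \<bar>\<integral>t. u t \<bullet> obs z t \<partial>leb 0 (T + 1)\<bar> \<le> C * (\<integral>t. norm (obs z t) \<partial>leb 0 T)"
    using observability[OF H T, of "T + 1"] by auto
  interpret finite_measure "leb 0 (T + 1)" by (rule finite_measure_leb)
  have p: "2 \<le> p" using H by (simp add: null_controlled_def)
  have "(\<integral>t. norm (obs z t) \<partial>leb 0 (T + 1)) \<le> 1 + C"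
    if z: "z \<in> Ds" and N: "(\<integral>t. norm (obs z t) \<partial>leb 0 T) \<le> 1" for z
  proof -
    \<comment> \<open>The convention \<open>inverse 0 = 0\<close> makes u vanish where the
      observation does, so measurability needs no case split.\<close>
    define \<phi> where "\<phi> t = indicator {T<..} t * inverse (norm (obs z t))" for t
    define u where "u t = \<phi> t *\<^sub>R obs z t" for t
    have idm [measurable]: "(\<lambda>t. t) \<in> borel_measurable (leb 0 (T + 1))"
      by (intro leb_borel_measurable strongly_measurable_continuous continuous_intros)
    have nm [measurable]: "(\<lambda>t. norm (obs z t)) \<in> borel_measurable (leb 0 (T + 1))"
      by (intro leb_norm_measurable obs_sm z) simp
    have "\<phi> \<in> borel_measurable (leb 0 (T + 1))" unfolding \<phi>_def by measurable
    then have smu: "strongly_measurable (leb 0 (T + 1)) u"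
      unfolding u_def by (intro strongly_measurable_scaleR borel_measurable_strongly obs_sm z) simp_all
    have u0: "u t = 0" if "t \<le> T" for t using that by (simp add: u_def \<phi>_def)
    have ule: "norm (u t) powr p \<le> indicator {T<..} t" for t
    proof -
      have "norm (u t) = (if T < t \<and> obs z t \<noteq> 0 then 1 else 0)" by (auto simp: u_def \<phi>_def)
      then show ?thesis by (auto split: split_indicator)
    qed
    have um: "(\<lambda>t. norm (u t) powr p) \<in> borel_measurable (leb 0 (T + 1))"
      using leb_norm_measurable[OF smu] by measurable
    have ui: "integrable (leb 0 (T + 1)) (\<lambda>t. norm (u t) powr p)"
      by (rule bounded_integrable_leb[OF um, of 1])
        (use ule in \<open>auto intro!: AE_I2 intro: order_trans simp: indicator_le_1\<close>)
    have im: "(\<lambda>t. indicator {T<..} t :: real) \<in> borel_measurable (leb 0 (T + 1))" by measurable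
    have ii: "integrable (leb 0 (T + 1)) (\<lambda>t. indicator {T<..} t :: real)"
      by (rule bounded_integrable_leb[OF im, of 1]) (auto split: split_indicator)
    have "(\<integral>t. norm (u t) powr p \<partial>leb 0 (T + 1)) \<le> (\<integral>t. indicator {T<..} t \<partial>leb 0 (T + 1))"
      by (intro integral_mono ui ii ule)
    also have "\<dots> = (\<integral>t. indicator {0<..<T + 1} t *\<^sub>R indicator {T<..} t \<partial>lebesgue)"
      by (rule integral_restrict_space) simp
    also have "\<dots> = (\<integral>t. indicator {T<..<T + 1} t \<partial>lebesgue)"
      by (rule Bochner_Integration.integral_cong) (use T in \<open>auto split: split_indicator\<close>)
    also have "\<dots> = 1" by simp
    finally have u1: "(\<integral>t. norm (u t) powr p \<partial>leb 0 (T + 1)) \<le> 1" .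
    have uU: "u \<in> unit_controls p T (T + 1)" using smu u0 ui u1 by (simp add: unit_controls_def)
    have uo: "u t \<bullet> obs z t = indicator {T<..} t * norm (obs z t)" for t
      by (cases "obs z t = 0") (auto simp: u_def \<phi>_def power2_norm_eq_inner[symmetric] power2_eq_square split: split_indicator)
    have le: "(\<integral>t. indicator {T<..} t * norm (obs z t) \<partial>leb 0 (T + 1)) \<le> C"
    proof -
      have "(\<integral>t. indicator {T<..} t * norm (obs z t) \<partial>leb 0 (T + 1)) \<le> C * (\<integral>t. norm (obs z t) \<partial>leb 0 T)"
        using C[OF z uU] by (simp add: uo)
      also have "\<dots> \<le> C * 1" by (intro mult_left_mono N C0)
      finally show ?thesis by simp
    qed
    have oi: "integrable (leb 0 (T + 1)) (\<lambda>t. norm (obs z t))" using z by (intro obs_norm_int) auto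
    have i1: "integrable (leb 0 (T + 1)) (\<lambda>t. indicator {T<..} t * norm (obs z t))"
      by (rule Bochner_Integration.integrable_bound[OF oi]) (measurable, auto split: split_indicator)
    have i2: "integrable (leb 0 (T + 1)) (\<lambda>t. indicator {..T} t * norm (obs z t))"
      by (rule Bochner_Integration.integrable_bound[OF oi]) (measurable, auto split: split_indicator)
    have "(\<integral>t. norm (obs z t) \<partial>leb 0 (T + 1)) = (\<integral>t. indicator {..T} t * norm (obs z t) + indicator {T<..} t * norm (obs z t) \<partial>leb 0 (T + 1))"
      by (rule Bochner_Integration.integral_cong) (auto split: split_indicator)
    also have "\<dots> = (\<integral>t. indicator {..T} t * norm (obs z t) \<partial>leb 0 (T + 1)) + (\<integral>t. indicator {T<..} t * norm (obs z t) \<partial>leb 0 (T + 1))"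
      by (rule Bochner_Integration.integral_add[OF i2 i1])
    also have "(\<integral>t. indicator {..T} t * norm (obs z t) \<partial>leb 0 (T + 1)) = (\<integral>t. norm (obs z t) \<partial>leb 0 T)"
    proof -
      have "(\<integral>t. indicator {..T} t * norm (obs z t) \<partial>leb 0 (T + 1)) = (\<integral>t. indicator {0<..<T + 1} t *\<^sub>R (indicator {..T} t * norm (obs z t)) \<partial>lebesgue)"
        by (rule integral_restrict_space) simp
      also have "\<dots> = (\<integral>t. indicator {0<..<T} t *\<^sub>R norm (obs z t) \<partial>lebesgue)"
      proof (rule integral_cong_AE)
        show "AE t in lebesgue. indicator {0<..<T + 1} t *\<^sub>R (indicator {..T} t * norm (obs z t)) = indicator {0<..<T} t *\<^sub>R norm (obs z t)"
          by (rule AE_mp[OF AE_not_in[of "{T}"]]) (auto intro!: AE_I2 split: split_indicator)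
        show "(\<lambda>t. indicator {0<..<T + 1} t *\<^sub>R (indicator {..T} t * norm (obs z t))) \<in> borel_measurable lebesgue"
          using borel_measurable_integrable[OF i2] by (subst (asm) borel_measurable_restrict_space_iff) auto
        show "(\<lambda>t. indicator {0<..<T} t *\<^sub>R norm (obs z t)) \<in> borel_measurable lebesgue"
          using leb_norm_measurable[OF obs_sm[OF z order_refl]] by (subst (asm) borel_measurable_restrict_space_iff) auto
      qed
      also have "\<dots> = (\<integral>t. norm (obs z t) \<partial>leb 0 T)" by (rule integral_restrict_space[symmetric]) simp
      finally show ?thesis .
    qed
    finally show ?thesis using N le by simp
  qed
  then show ?thesis using C0 by (intro exI[of _ "1 + C"]) auto
qed

text \<open>The test control has height c, points along the observation and is supported where the
  observation exceeds R. Such a set has measure at most K / R, so R can be raised until the control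
  lies in the unit ball; observability then bounds c times the tail by C K.\<close>

lemma obs_equiintegrable:
  assumes H: "null_controlled p" and ab: "0 < a" "a < b" and \<eta>: "0 < \<eta>" and K: "0 < K"
  shows "\<exists>R\<ge>0. \<forall>z\<in>Ds. (\<integral>t. norm (obs z t) \<partial>leb 0 b) \<le> K \<longrightarrow>
    (\<integral>\<^sup>+t. ennreal (norm (obs z t) * indicator {R<..} (norm (obs z t))) \<partial>leb a b) \<le> ennreal \<eta>"
proof -
  obtain C where C0: "0 \<le> C" and C: "\<And>z u. z \<in> Ds \<Longrightarrow> u \<in> unit_controls p a b \<Longrightarrow>
      \<bar>\<integral>t. u t \<bullet> obs z t \<partial>leb 0 b\<bar> \<le> C * (\<integral>t. norm (obs z t) \<partial>leb 0 a)"
    using observability[OF H ab] by auto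
  have p: "2 \<le> p" using H by (simp add: null_controlled_def)
  \<comment> \<open>Chosen so that C K <= c \<eta>; the added 1 keeps c positive when C = 0.\<close>
  define c where "c = (C * K + 1) / \<eta>"
  have c: "0 < c" using C0 K \<eta> by (simp add: c_def add_nonneg_pos)
  \<comment> \<open>Where |obs z| > R this gives c^p = R / K <= |obs z| / K, a majorant of the p-th
    power of u with integral at most 1.\<close>
  define R where "R = K * c powr p"
  have R: "0 < R" using K c by (simp add: R_def)
  have "(\<integral>\<^sup>+t. ennreal (norm (obs z t) * indicator {R<..} (norm (obs z t))) \<partial>leb a b) \<le> ennreal \<eta>"
    if z: "z \<in> Ds" and N: "(\<integral>t. norm (obs z t) \<partial>leb 0 b) \<le> K" for z
  proof -
    define \<chi>' where "\<chi>' t = (indicator {a<..} t * indicator {R<..} (norm (obs z t)) :: real)" for t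
    define \<phi> where "\<phi> t = c * \<chi>' t * inverse (norm (obs z t))" for t
    define u where "u t = \<phi> t *\<^sub>R obs z t" for t
    have idm [measurable]: "(\<lambda>t. t) \<in> borel_measurable (leb 0 b)"
      by (intro leb_borel_measurable strongly_measurable_continuous continuous_intros)
    have nm [measurable]: "(\<lambda>t. norm (obs z t)) \<in> borel_measurable (leb 0 b)"
      by (intro leb_norm_measurable obs_sm z) simp
    have \<chi>m [measurable]: "\<chi>' \<in> borel_measurable (leb 0 b)" unfolding \<chi>'_def by measurable
    have "\<phi> \<in> borel_measurable (leb 0 b)" unfolding \<phi>_def by measurable
    then have smu: "strongly_measurable (leb 0 b) u"
      unfolding u_def by (intro strongly_measurable_scaleR borel_measurable_strongly obs_sm z) simp_all
    have u0: "u t = 0" if "t \<le> a" for t using that by (simp add: u_def \<phi>_def \<chi>'_def)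
    have \<chi>01: "\<chi>' t = 0 \<or> (\<chi>' t = 1 \<and> R < norm (obs z t) \<and> a < t)" for t
      by (auto simp: \<chi>'_def split: split_indicator)
    have nu: "norm (u t) = c * \<chi>' t" for t
    proof (cases "\<chi>' t = 0")
      case False
      then have "\<chi>' t = 1" "0 < norm (obs z t)" using \<chi>01[of t] R by auto
      then show ?thesis using c by (simp add: u_def \<phi>_def)
    qed (simp add: u_def \<phi>_def)
    have ule: "norm (u t) powr p \<le> norm (obs z t) / K" for t
    proof -
      consider "\<chi>' t = 0" | "\<chi>' t = 1" "R < norm (obs z t)" using \<chi>01[of t] by blast
      then show ?thesis
      proof cases
        case 1 then show ?thesis using K p by (simp add: nu)
      next
        case 2
        have "c powr p = R / K" using K by (simp add: R_def)
        also have "\<dots> \<le> norm (obs z t) / K" using 2 K by (intro divide_right_mono) auto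
        finally show ?thesis using 2 by (simp add: nu)
      qed
    qed
    have oi: "integrable (leb 0 b) (\<lambda>t. norm (obs z t))" using z by (intro obs_norm_int) auto
    have ui: "integrable (leb 0 b) (\<lambda>t. norm (u t) powr p)"
    proof (rule Bochner_Integration.integrable_bound)
      show "integrable (leb 0 b) (\<lambda>t. norm (obs z t) / K)" using oi by simp
      show "(\<lambda>t. norm (u t) powr p) \<in> borel_measurable (leb 0 b)"
        using leb_norm_measurable[OF smu] by measurable
      show "AE t in leb 0 b. norm (norm (u t) powr p) \<le> norm (norm (obs z t) / K)"
        using ule K by (intro AE_I2) auto
    qed
    have "(\<integral>t. norm (u t) powr p \<partial>leb 0 b) \<le> (\<integral>t. norm (obs z t) / K \<partial>leb 0 b)"
      by (rule integral_mono[OF ui]) (use oi ule in auto)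
    also have "\<dots> \<le> 1" using N K by simp
    finally have u1: "(\<integral>t. norm (u t) powr p \<partial>leb 0 b) \<le> 1" .
    have uU: "u \<in> unit_controls p a b" using smu u0 ui u1 by (simp add: unit_controls_def)
    have uo: "u t \<bullet> obs z t = c * (\<chi>' t * norm (obs z t))" for t
      by (cases "obs z t = 0") (auto simp: u_def \<phi>_def power2_norm_eq_inner[symmetric] power2_eq_square)
    have N': "(\<integral>t. norm (obs z t) \<partial>leb 0 a) \<le> K"
    proof -
      have "ennreal (\<integral>t. norm (obs z t) \<partial>leb 0 a) = (\<integral>\<^sup>+t. norm (obs z t) \<partial>leb 0 a)"
        using z by (intro nn_integral_eq_integral_leb[symmetric] obs_norm_int) auto
      also have "\<dots> \<le> (\<integral>\<^sup>+t. norm (obs z t) \<partial>leb 0 b)" by (rule nn_integral_leb_mono_set) (use ab in auto)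
      also have "\<dots> = ennreal (\<integral>t. norm (obs z t) \<partial>leb 0 b)" using oi by (intro nn_integral_eq_integral_leb) auto
      also have "\<dots> \<le> ennreal K" using N by (rule ennreal_leI)
      finally show ?thesis using K by simp
    qed
    have "c * (\<integral>t. \<chi>' t * norm (obs z t) \<partial>leb 0 b) \<le> C * (\<integral>t. norm (obs z t) \<partial>leb 0 a)"
      using C[OF z uU] by (simp add: uo)
    also have "\<dots> \<le> C * K" by (intro mult_left_mono N' C0)
    also have "\<dots> \<le> c * \<eta>" using \<eta> by (simp add: c_def)
    finally have le: "(\<integral>t. \<chi>' t * norm (obs z t) \<partial>leb 0 b) \<le> \<eta>" using c by simp
    have i1: "integrable (leb 0 b) (\<lambda>t. \<chi>' t * norm (obs z t))"
    proof (rule Bochner_Integration.integrable_bound[OF oi])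
      show "AE t in leb 0 b. norm (\<chi>' t * norm (obs z t)) \<le> norm (norm (obs z t))"
        using \<chi>01 by (intro AE_I2) (metis abs_mult abs_norm_cancel abs_one abs_zero mult_1 mult_zero_left norm_ge_zero order_refl real_norm_def)
    qed measurable
    have "(\<integral>\<^sup>+t. ennreal (norm (obs z t) * indicator {R<..} (norm (obs z t))) \<partial>leb a b)
        = (\<integral>\<^sup>+t. ennreal (\<chi>' t * norm (obs z t)) \<partial>leb 0 b)"
      unfolding nn_integral_leb \<chi>'_def
      by (intro nn_integral_cong) (use ab in \<open>auto split: split_indicator\<close>)
    also have "\<dots> = ennreal (\<integral>t. \<chi>' t * norm (obs z t) \<partial>leb 0 b)"
      by (rule nn_integral_eq_integral_leb[OF i1]) (simp add: \<chi>'_def)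
    also have "\<dots> \<le> ennreal \<eta>" using le by (rule ennreal_leI)
    finally show ?thesis .
  qed
  then show ?thesis using R by (intro exI[of _ R]) auto
qed

section \<open>Duality for the minimal norm\<close>

lemma bounded_inner_integral:
  assumes T: "0 < T" and w: "strongly_measurable (leb 0 T) w" and ae: "AE t in leb 0 T. norm (w t) \<le> M" and M: "0 \<le> M"
    and g: "strongly_measurable (leb 0 T) g" "integrable (leb 0 T) (\<lambda>t. norm (g t))"
  shows "integrable (leb 0 T) (\<lambda>t. w t \<bullet> g t)" "\<bar>\<integral>t. w t \<bullet> g t \<partial>leb 0 T\<bar> \<le> M * (\<integral>t. norm (g t) \<partial>leb 0 T)"
proof -
  have ae': "AE t in leb 0 T. \<bar>w t \<bullet> g t\<bar> \<le> M * norm (g t)"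
    using ae by eventually_elim (rule order_trans[OF Cauchy_Schwarz_ineq2 mult_right_mono], auto)
  show int: "integrable (leb 0 T) (\<lambda>t. w t \<bullet> g t)"
  proof (rule Bochner_Integration.integrable_bound)
    show "integrable (leb 0 T) (\<lambda>t. M * norm (g t))" using g(2) by simp
    show "(\<lambda>t. w t \<bullet> g t) \<in> borel_measurable (leb 0 T)" by (rule leb_inner_measurable[OF w g(1)])
    show "AE t in leb 0 T. norm (w t \<bullet> g t) \<le> norm (M * norm (g t))"
      using ae' M by (auto simp: abs_mult)
  qed
  have "\<bar>\<integral>t. w t \<bullet> g t \<partial>leb 0 T\<bar> \<le> (\<integral>t. \<bar>w t \<bullet> g t\<bar> \<partial>leb 0 T)" by (rule integral_abs_bound)
  also have "\<dots> \<le> (\<integral>t. M * norm (g t) \<partial>leb 0 T)"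
    using int g(2) ae' by (intro integral_mono_AE) auto
  finally show "\<bar>\<integral>t. w t \<bullet> g t \<partial>leb 0 T\<bar> \<le> M * (\<integral>t. norm (g t) \<partial>leb 0 T)" by simp
qed

text \<open>Separation is applied to continuous controls only. If \<open>y\<close> lies in the closure of what they
  reach, then the selection lemma turns approximate controls into an exact one, which replaces weak-*
  compactness of the ball of \<open>L\<^sup>\<infinity>\<close>.\<close>

lemma minimal_norm_duality:
  assumes T: "0 < T" and M: "0 \<le> M"
    and no: "\<And>w. strongly_measurable (leb 0 T) w \<Longrightarrow> (AE t in leb 0 T. norm (w t) \<le> M) \<Longrightarrow> reach T w \<noteq> y"
  shows "\<exists>z\<in>Ds. M * (\<integral>t. norm (obs z t) \<partial>leb 0 T) < y \<bullet> z"
proof -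
  \<comment> \<open>Continuity is what the selection lemma asks of its functions, and it still
    allows controls nearly parallel to a given observation.\<close>
  define W where "W = {w :: real \<Rightarrow> 'u. continuous_on {0..T} w \<and> (\<forall>t\<in>{0..T}. norm (w t) \<le> M)}"
  have Wsm: "strongly_measurable (leb 0 T) w" if "w \<in> W" for w
    using that by (intro strongly_measurable_continuous) (simp add: W_def)
  have Wae: "AE t in leb 0 T. norm (w t) \<le> M" if "w \<in> W" for w
    using that by (intro AE_I2) (simp add: W_def)
  have W2: "w \<in> Lp 2 0 T" "Lp_norm 2 0 T w \<le> M * sqrt T" if "w \<in> W" for w
    using Lp_two_bounded[OF T Wsm[OF that] Wae[OF that] M] by auto
  have Wconv: "(\<lambda>t. a *\<^sub>R v t + b *\<^sub>R w t) \<in> W" if "v \<in> W" "w \<in> W" "0 \<le> a" "0 \<le> b" "a + b = 1" for v w a b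
  proof -
    have "norm (a *\<^sub>R v t + b *\<^sub>R w t) \<le> M" if t: "t \<in> {0..T}" for t
    proof -
      have "norm (a *\<^sub>R v t + b *\<^sub>R w t) \<le> a * norm (v t) + b * norm (w t)"
        using norm_triangle_ineq[of "a *\<^sub>R v t" "b *\<^sub>R w t"] that \<open>0 \<le> a\<close> \<open>0 \<le> b\<close> by simp
      also have "\<dots> \<le> a * M + b * M"
        using \<open>v \<in> W\<close> \<open>w \<in> W\<close> t \<open>0 \<le> a\<close> \<open>0 \<le> b\<close> by (intro add_mono mult_left_mono) (auto simp: W_def)
      also have "\<dots> = M" using \<open>a + b = 1\<close> by (simp flip: distrib_right)
      finally show ?thesis .
    qed
    then show ?thesis using that by (auto simp: W_def intro!: continuous_intros)
  qed
  have Wlin: "reach T (\<lambda>t. a *\<^sub>R v t + b *\<^sub>R w t) = a *\<^sub>R reach T v + b *\<^sub>R reach T w"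
    if "v \<in> W" "w \<in> W" "0 \<le> a" "0 \<le> b" "a + b = 1" for v w a b
  proof -
    have orth: "(reach T (\<lambda>t. a *\<^sub>R v t + b *\<^sub>R w t) - (a *\<^sub>R reach T v + b *\<^sub>R reach T w)) \<bullet> z = 0" if z: "z \<in> Ds" for z
      using reach_inner[OF T W2(1)[OF Wconv] z] reach_inner[OF T W2(1) z] \<open>v \<in> W\<close> \<open>w \<in> W\<close> \<open>0 \<le> a\<close> \<open>0 \<le> b\<close> \<open>a + b = 1\<close>
      by (simp add: inner_diff_left inner_add_left)
    show ?thesis using Ds_orthogonal_trivial[OF orth] by simp
  qed
  define Q where "Q = reach T ` W"
  have "convex Q"
    unfolding convex_def Q_def
  proof (intro ballI allI impI)
    fix x x' and a b :: real assume x: "x \<in> reach T ` W" "x' \<in> reach T ` W" and ab: "0 \<le> a" "0 \<le> b" "a + b = 1"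
    then obtain v w where vw: "v \<in> W" "w \<in> W" "x = reach T v" "x' = reach T w" by blast
    show "a *\<^sub>R x + b *\<^sub>R x' \<in> reach T ` W"
      unfolding vw(3,4) Wlin[OF vw(1,2) ab, symmetric] by (rule imageI[OF Wconv[OF vw(1,2) ab]])
  qed
  have W0: "(\<lambda>_. 0) \<in> W" using M by (simp add: W_def)
  then have "Q \<noteq> {}" by (auto simp: Q_def)
  show ?thesis
  proof (cases "y \<in> closure Q")
    case True
    \<comment> \<open>Controls nearly reaching y form decreasing convex sets. The almost everywhere
      limit provided by selection inherits the bound M, and dominated convergence against each
      observation shows that it reaches y.\<close>
    define C where "C n = {w \<in> W. norm (reach T w - y) \<le> 1 / real (Suc n)}" for n
    have "\<exists>f F. (\<forall>n. f n \<in> C n) \<and> strongly_measurable (leb 0 T) F \<and> (AE t in leb 0 T. (\<lambda>n. f n t) \<longlonglongrightarrow> F t)"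
    proof (rule L1_convex_selection[OF T, of C "M * T"])
      show "C (Suc n) \<subseteq> C n" for n
      proof -
        have "1 / real (Suc (Suc n)) \<le> 1 / real (Suc n)" by (intro divide_left_mono) auto
        then show ?thesis unfolding C_def by (auto intro: order_trans simp del: of_nat_Suc)
      qed
      show "C n \<noteq> {}" for n
      proof -
        have "0 < 1 / real (Suc n)" by simp
        then obtain x where "x \<in> Q" "dist x y < 1 / real (Suc n)" using True closure_approachable by blast
        then show ?thesis unfolding C_def Q_def dist_norm by (auto intro: less_imp_le simp del: of_nat_Suc)
      qed
      show "(\<lambda>t. (1/2) *\<^sub>R (f t + g t)) \<in> C n" if f: "f \<in> C n" and g: "g \<in> C n" for n f g
      proof -
        have fg: "f \<in> W" "g \<in> W" using f g by (auto simp: C_def)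
        have eq: "(\<lambda>t. (1/2) *\<^sub>R (f t + g t)) = (\<lambda>t. (1/2) *\<^sub>R f t + (1/2) *\<^sub>R g t)" by (simp add: scaleR_add_right)
        have "reach T (\<lambda>t. (1/2) *\<^sub>R f t + (1/2) *\<^sub>R g t) - y = (1/2) *\<^sub>R ((reach T f - y) + (reach T g - y))"
        proof -
          have "(1/2) *\<^sub>R ((reach T f - y) + (reach T g - y)) = (1/2) *\<^sub>R reach T f + (1/2) *\<^sub>R reach T g - ((1/2) *\<^sub>R (y + y))"
            by (simp add: scaleR_add_right scaleR_diff_right)
          then show ?thesis using Wlin[OF fg, of "1/2" "1/2"] by (simp add: scaleR_half_double)
        qed
        also have "norm \<dots> \<le> (1/2) * (norm (reach T f - y) + norm (reach T g - y))"
          by (simp add: norm_triangle_ineq)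
        also have "\<dots> \<le> 1 / real (Suc n)" using f g by (simp add: C_def)
        finally show ?thesis using Wconv[OF fg, of "1/2" "1/2"] by (simp add: C_def eq)
      qed
      show "continuous_on {0..T} f" if "f \<in> C 0" for f using that by (simp add: C_def W_def)
      show "(\<integral>t. norm (f t) \<partial>leb 0 T) \<le> M * T" if f: "f \<in> C 0" for f
      proof -
        interpret finite_measure "leb 0 T" by (rule finite_measure_leb)
        have fW: "f \<in> W" using f by (simp add: C_def)
        have "(\<integral>t. norm (f t) \<partial>leb 0 T) \<le> (\<integral>t. M \<partial>leb 0 T)"
          using fW by (intro integral_mono integrable_continuous_leb continuous_on_norm) (auto simp: W_def)
        then show ?thesis using T by (simp add: measure_leb_space mult.commute)
      qed
      \<comment> \<open>Members of W never exceed M, so the tail above level M is empty.\<close>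
      show "\<exists>R\<ge>0. \<forall>f\<in>C 0. (\<integral>\<^sup>+t. ennreal (norm (f t) * indicator {R<..} (norm (f t))) \<partial>leb a T) \<le> ennreal \<eta>"
        if "0 < a" for a \<eta>
      proof (intro exI[of _ M] conjI ballI M)
        fix f assume f: "f \<in> C 0"
        have "(\<integral>\<^sup>+t. ennreal (norm (f t) * indicator {M<..} (norm (f t))) \<partial>leb a T) = (\<integral>\<^sup>+t. 0 \<partial>leb a T)"
        proof (rule nn_integral_cong)
          fix t assume "t \<in> space (leb a T)"
          then have "norm (f t) \<le> M" using f that by (simp add: C_def W_def)
          then show "ennreal (norm (f t) * indicator {M<..} (norm (f t))) = 0" by simp
        qed
        then show "(\<integral>\<^sup>+t. ennreal (norm (f t) * indicator {M<..} (norm (f t))) \<partial>leb a T) \<le> ennreal \<eta>" by simp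
      qed
    qed blast
    then obtain f F where f: "\<And>n. f n \<in> C n" and F: "strongly_measurable (leb 0 T) F"
      and lim: "AE t in leb 0 T. (\<lambda>n. f n t) \<longlonglongrightarrow> F t" by blast
    have fW: "f n \<in> W" for n using f[of n] by (simp add: C_def)
    have FM: "AE t in leb 0 T. norm (F t) \<le> M"
      using lim AE_space
    proof eventually_elim
      case (elim t)
      have "(\<lambda>n. norm (f n t)) \<longlonglongrightarrow> norm (F t)" using elim(1) by (rule tendsto_norm)
      then show ?case by (rule LIMSEQ_le_const2) (use fW elim(2) in \<open>auto simp: W_def\<close>)
    qed
    have F2: "F \<in> Lp 2 0 T" by (rule Lp_two_bounded(1)[OF T F FM M])
    have ry: "(\<lambda>n. reach T (f n)) \<longlonglongrightarrow> y"
    proof (rule LIM_zero_cancel, rule Lim_null_comparison)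
      show "\<forall>\<^sub>F n in sequentially. norm (reach T (f n) - y) \<le> 1 / real (Suc n)"
        using f by (auto simp: C_def simp del: of_nat_Suc)
      show "(\<lambda>n. 1 / real (Suc n)) \<longlonglongrightarrow> 0" by (intro LIMSEQ_Suc lim_1_over_n)
    qed
    have orth: "(reach T F - y) \<bullet> z = 0" if z: "z \<in> Ds" for z
    proof -
      have "(\<lambda>n. \<integral>t. f n t \<bullet> obs z t \<partial>leb 0 T) \<longlonglongrightarrow> (\<integral>t. F t \<bullet> obs z t \<partial>leb 0 T)"
      proof (rule integral_dominated_convergence[where w = "\<lambda>t. M * norm (obs z t)"])
        show "(\<lambda>t. F t \<bullet> obs z t) \<in> borel_measurable (leb 0 T)" by (intro leb_inner_measurable F obs_sm z) simp
        show "(\<lambda>t. f n t \<bullet> obs z t) \<in> borel_measurable (leb 0 T)" for n by (intro leb_inner_measurable Wsm fW obs_sm z) simp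
        show "integrable (leb 0 T) (\<lambda>t. M * norm (obs z t))" using z by (intro integrable_mult_right obs_norm_int) auto
        show "AE t in leb 0 T. (\<lambda>n. f n t \<bullet> obs z t) \<longlonglongrightarrow> F t \<bullet> obs z t"
          using lim by eventually_elim (intro tendsto_intros)
        show "AE t in leb 0 T. norm (f n t \<bullet> obs z t) \<le> M * norm (obs z t)" for n
          using Wae[OF fW[of n]]
        proof eventually_elim
          case (elim t)
          show ?case
            using Cauchy_Schwarz_ineq2[of "f n t" "obs z t"] mult_right_mono[OF elim norm_ge_zero[of "obs z t"]] by simp
        qed
      qed
      then have "(\<lambda>n. reach T (f n) \<bullet> z) \<longlonglongrightarrow> reach T F \<bullet> z"
        by (simp add: reach_inner(2)[OF T W2(1)[OF fW] z] reach_inner(2)[OF T F2 z])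
      moreover have "(\<lambda>n. reach T (f n) \<bullet> z) \<longlonglongrightarrow> y \<bullet> z" by (intro tendsto_intros ry)
      ultimately have "reach T F \<bullet> z = y \<bullet> z" by (rule LIMSEQ_unique)
      then show ?thesis by (simp add: inner_diff_left)
    qed
    have "reach T F = y" using Ds_orthogonal_trivial[OF orth] by simp
    then show ?thesis using no[OF F FM] by blast
  next
    case False
    obtain p where p: "p \<in> closure Q" "\<And>x. x \<in> closure Q \<Longrightarrow> (y - p) \<bullet> (x - p) \<le> 0"
      using nearest_point_variational[of "closure Q" y] \<open>convex Q\<close> \<open>Q \<noteq> {}\<close> convex_closure by auto
    define z0 where "z0 = y - p"
    have "z0 \<noteq> 0" using p(1) False by (auto simp: z0_def)
    define e where "e = (norm z0)\<^sup>2"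
    have e: "0 < e" using \<open>z0 \<noteq> 0\<close> by (simp add: e_def)
    obtain C where C: "0 < C" "\<And>w. w \<in> Lp 2 0 T \<Longrightarrow> norm (reach T w) \<le> C * Lp_norm 2 0 T w" using reach_bound[OF T] by blast
    \<comment> \<open>By the \<open>L\<^sup>2\<close> estimate r bounds the distance of y to every
      state reached from W, which turns a small change of the separating vector into a uniform
      error.\<close>
    define r where "r = C * (M * sqrt T) + norm y + 1"
    have r: "0 < r" using C(1) M T by (simp add: r_def add_nonneg_pos)
    have Qr: "norm (reach T w) + norm y \<le> r" if "w \<in> W" for w
    proof -
      have "norm (reach T w) \<le> C * Lp_norm 2 0 T w" by (rule C(2)[OF W2(1)[OF that]])
      also have "\<dots> \<le> C * (M * sqrt T)" using W2(2)[OF that] C(1) by (intro mult_left_mono) auto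
      finally show ?thesis by (simp add: r_def)
    qed
    \<comment> \<open>The separating vector y - p need not lie in \<open>Ds\<close>, where pairings
      are integrals; a nearby z in \<open>Ds\<close> gives up at most half of the gap e.\<close>
    have "z0 \<in> closure Ds" by (simp add: Ds_dense)
    moreover have "0 < e / (2 * r)" using e r by simp
    ultimately obtain z where z: "z \<in> Ds" "dist z z0 < e / (2 * r)" using closure_approachable by blast
    have sep: "reach T w \<bullet> z \<le> y \<bullet> z - e / 2" if w: "w \<in> W" for w
    proof -
      have "reach T w \<in> closure Q" unfolding Q_def by (rule subsetD[OF closure_subset imageI[OF w]])
      then have "z0 \<bullet> (reach T w - p) \<le> 0" using p(2) z0_def by blast
      moreover have "reach T w - p = (reach T w - y) + z0" by (simp add: z0_def)
      ultimately have 1: "z0 \<bullet> (reach T w - y) \<le> - e" by (simp add: inner_add_right e_def power2_norm_eq_inner)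
      have "(z - z0) \<bullet> (reach T w - y) \<le> norm (z - z0) * norm (reach T w - y)" by (rule norm_cauchy_schwarz)
      also have "\<dots> \<le> (e / (2 * r)) * r"
      proof (intro mult_mono)
        show "norm (z - z0) \<le> e / (2 * r)" using z(2) by (simp add: dist_norm)
        show "norm (reach T w - y) \<le> r" using norm_triangle_ineq4[of "reach T w" y] Qr[OF w] by simp
      qed (use e r in auto)
      also have "\<dots> = e / 2" using r by simp
      finally have 2: "(z - z0) \<bullet> (reach T w - y) \<le> e / 2" .
      have "z \<bullet> (reach T w - y) = z0 \<bullet> (reach T w - y) + (z - z0) \<bullet> (reach T w - y)" by (simp add: inner_diff_left)
      then have "z \<bullet> (reach T w - y) \<le> - e + e / 2" using 1 2 by linarith
      then show ?thesis by (simp add: inner_diff_right inner_commute)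
    qed
    \<comment> \<open>k makes the normalised observation continuous where \<open>obs z\<close>
      vanishes. Since |g|^2 / (|g| + k) >= |g| - k, the loss is at most M k T, and this choice keeps
      it below e / 2.\<close>
    define k where "k = e / (2 * (M * T + 1))"
    have MT: "0 \<le> M * T" using M T by simp
    have k: "0 < k" using e MT by (simp add: k_def)
    define w where "w t = (M / (norm (obs z t) + k)) *\<^sub>R obs z t" for t
    have den: "0 < norm (obs z t) + k" for t using k by (simp add: add_nonneg_pos)
    have "w \<in> W"
      unfolding W_def
    proof (intro CollectI conjI ballI)
      show "continuous_on {0..T} w"
        unfolding w_def using obs_cont'[OF z(1) order_refl] den
        by (intro continuous_intros) (auto simp: less_imp_neq[THEN not_sym])
      fix t
      have "norm (w t) = M * (norm (obs z t) / (norm (obs z t) + k))" using M den[of t] by (simp add: w_def)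
      also have "\<dots> \<le> M * 1" using den[of t] k M by (intro mult_left_mono) auto
      finally show "norm (w t) \<le> M" by simp
    qed
    interpret finite_measure "leb 0 T" by (rule finite_measure_leb)
    have oi: "integrable (leb 0 T) (\<lambda>t. norm (obs z t))" using z(1) by (intro obs_norm_int) auto
    have "M * (\<integral>t. norm (obs z t) \<partial>leb 0 T) - M * k * T = (\<integral>t. M * (norm (obs z t) - k) \<partial>leb 0 T)"
      using oi T by (simp add: measure_leb_space right_diff_distrib)
    also have "\<dots> \<le> (\<integral>t. w t \<bullet> obs z t \<partial>leb 0 T)"
    proof (rule integral_mono)
      show "integrable (leb 0 T) (\<lambda>t. M * (norm (obs z t) - k))" using oi by simp
      show "integrable (leb 0 T) (\<lambda>t. w t \<bullet> obs z t)" by (rule reach_inner(1)[OF T W2(1)[OF \<open>w \<in> W\<close>] z(1)])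
      fix t
      have "(norm (obs z t) - k) * (norm (obs z t) + k) \<le> norm (obs z t) * norm (obs z t)"
        by (simp add: algebra_simps)
      then have "norm (obs z t) - k \<le> norm (obs z t) * norm (obs z t) / (norm (obs z t) + k)"
        using den[of t] by (simp add: pos_le_divide_eq)
      then have "M * (norm (obs z t) - k) \<le> M * (norm (obs z t) * norm (obs z t) / (norm (obs z t) + k))"
        using M by (rule mult_left_mono)
      also have "\<dots> = w t \<bullet> obs z t"
        by (simp add: w_def power2_norm_eq_inner flip: power2_eq_square)
      finally show "M * (norm (obs z t) - k) \<le> w t \<bullet> obs z t" .
    qed
    also have "\<dots> = reach T w \<bullet> z" by (rule reach_inner(2)[OF T W2(1)[OF \<open>w \<in> W\<close>] z(1), symmetric])
    also have "\<dots> \<le> y \<bullet> z - e / 2" by (rule sep[OF \<open>w \<in> W\<close>])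
    finally have "M * (\<integral>t. norm (obs z t) \<partial>leb 0 T) \<le> y \<bullet> z - e / 2 + M * k * T" by simp
    moreover have "M * k * T < e / 2"
    proof -
      have "M * k * T = (e / 2) * (M * T / (M * T + 1))" by (simp add: k_def)
      also have "\<dots> < (e / 2) * 1" using e MT by (intro mult_strict_left_mono) auto
      finally show ?thesis by simp
    qed
    ultimately have "M * (\<integral>t. norm (obs z t) \<partial>leb 0 T) < y \<bullet> z" by linarith
    then show ?thesis using z(1) by blast
  qed
qed

end

section \<open>The maximum principle\<close>

lemma nn_integral_leb_shift:
  assumes g: "g \<in> borel_measurable (leb e (d + e))"
  shows "(\<integral>\<^sup>+t. g (t + e) \<partial>leb 0 d) = (\<integral>\<^sup>+t. g t \<partial>leb e (d + e))"
proof -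
  define G where "G t = g t * indicator {e<..<d + e} t" for t
  have Gm: "G \<in> borel_measurable lebesgue"
    using g unfolding G_def by (subst (asm) borel_measurable_restrict_space_iff_ennreal) auto
  have m: "(\<lambda>t::real. e + t) \<in> measurable lebesgue lebesgue"
    using lebesgue_affine_measurable[where c = "\<lambda>_::real. 1" and t = e] by simp
  have distr: "distr lebesgue lebesgue (\<lambda>t::real. e + t) = lebesgue"
    using lebesgue_real_affine[of 1 e] by (simp add: density_1)
  have "(\<integral>\<^sup>+t. g (t + e) \<partial>leb 0 d) = (\<integral>\<^sup>+t. G (e + t) \<partial>lebesgue)"
    unfolding nn_integral_leb G_def by (intro nn_integral_cong) (auto simp: add.commute split: split_indicator)
  also have "\<dots> = (\<integral>\<^sup>+t. G t \<partial>lebesgue)"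
    using nn_integral_distr[OF m, of G] Gm by (simp add: distr)
  also have "\<dots> = (\<integral>\<^sup>+t. g t \<partial>leb e (d + e))" unfolding nn_integral_leb G_def ..
  finally show ?thesis .
qed

lemma nn_integral_leb_split:
  assumes g: "g \<in> borel_measurable (leb a c)" and abc: "a \<le> b" "b \<le> c"
  shows "(\<integral>\<^sup>+t. g t \<partial>leb a c) \<le> (\<integral>\<^sup>+t. g t \<partial>leb a b) + (\<integral>\<^sup>+t. g t \<partial>leb b c)"
proof -
  define G where "G t = g t * indicator {a<..<c} t" for t
  have Gm: "G \<in> borel_measurable lebesgue"
    using g unfolding G_def by (subst (asm) borel_measurable_restrict_space_iff_ennreal) auto
  have "(\<integral>\<^sup>+t. g t \<partial>leb a c) = (\<integral>\<^sup>+t. G t \<partial>lebesgue)" unfolding nn_integral_leb G_def ..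
  also have "\<dots> \<le> (\<integral>\<^sup>+t. G t * indicator {a<..<b} t + G t * indicator {b<..<c} t \<partial>lebesgue)"
    by (rule nn_integral_mono_AE, rule AE_mp[OF AE_not_in[of "{b}"]])
      (auto intro!: AE_I2 simp: G_def split: split_indicator)
  also have "\<dots> = (\<integral>\<^sup>+t. G t * indicator {a<..<b} t \<partial>lebesgue) + (\<integral>\<^sup>+t. G t * indicator {b<..<c} t \<partial>lebesgue)"
    using Gm by (intro nn_integral_add borel_measurable_times_ennreal borel_measurable_indicator) auto
  also have "\<dots> = (\<integral>\<^sup>+t. g t \<partial>leb a b) + (\<integral>\<^sup>+t. g t \<partial>leb b c)"
    unfolding nn_integral_leb G_def using abc
    by (intro arg_cong2[where f = "(+)"] nn_integral_cong) (auto split: split_indicator)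
  finally show ?thesis .
qed

lemma nn_integral_norm_triangle:
  assumes "strongly_measurable (leb a b) f" "strongly_measurable (leb a b) g" "strongly_measurable (leb a b) h"
  shows "(\<integral>\<^sup>+t. norm (f t - h t) \<partial>leb a b) \<le> (\<integral>\<^sup>+t. norm (f t - g t) \<partial>leb a b) + (\<integral>\<^sup>+t. norm (g t - h t) \<partial>leb a b)"
proof -
  have m: "(\<lambda>t. ennreal (norm (f t - g t))) \<in> borel_measurable (leb a b)" "(\<lambda>t. ennreal (norm (g t - h t))) \<in> borel_measurable (leb a b)"
    using assms by (auto intro!: measurable_compose[OF _ measurable_ennreal] leb_norm_measurable strongly_measurable_diff)
  have "(\<integral>\<^sup>+t. norm (f t - h t) \<partial>leb a b) \<le> (\<integral>\<^sup>+t. ennreal (norm (f t - g t)) + ennreal (norm (g t - h t)) \<partial>leb a b)"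
  proof (rule nn_integral_mono)
    fix t
    have "norm (f t - h t) \<le> norm (f t - g t) + norm (g t - h t)"
      using norm_triangle_ineq[of "f t - g t" "g t - h t"] by simp
    then show "ennreal (norm (f t - h t)) \<le> ennreal (norm (f t - g t)) + ennreal (norm (g t - h t))"
      by (simp add: ennreal_plus[symmetric] ennreal_leI del: ennreal_plus)
  qed
  also have "\<dots> = (\<integral>\<^sup>+t. norm (f t - g t) \<partial>leb a b) + (\<integral>\<^sup>+t. norm (g t - h t) \<partial>leb a b)"
    by (rule nn_integral_add[OF m])
  finally show ?thesis .
qed

text \<open>The factor 2 leaves room for translation: for h <= d the shifted interval (h, d + h)
  still lies in (0, 2d).\<close>

lemma nn_integral_small_interval:
  assumes F: "strongly_measurable (leb 0 T) F" and fin: "(\<integral>\<^sup>+t. norm (F t) \<partial>leb 0 T) < \<infinity>" and T: "0 < T" and e: "0 < e"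
  shows "\<exists>d>0. d \<le> T / 2 \<and> (\<integral>\<^sup>+t. norm (F t) \<partial>leb 0 (2 * d)) \<le> ennreal e"
proof -
  define d where "d n = T / real (Suc n) / 2" for n
  have d: "0 < d n" "d n \<le> T / 2" for n using T by (auto simp: d_def field_simps)
  have d_lim: "(\<lambda>n. 2 * d n) \<longlonglongrightarrow> 0"
  proof -
    have "(\<lambda>n. 2 * d n) = (\<lambda>n. T / real (Suc n))" by (simp add: d_def del: of_nat_Suc)
    then show ?thesis using LIMSEQ_Suc[OF lim_const_over_n[of T]] by (simp only:)
  qed
  have idm [measurable]: "(\<lambda>t. t) \<in> borel_measurable (leb 0 T)"
    by (intro leb_borel_measurable strongly_measurable_continuous continuous_intros)
  have nm [measurable]: "(\<lambda>t. norm (F t)) \<in> borel_measurable (leb 0 T)" by (rule leb_norm_measurable[OF F])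
  have "(\<lambda>n. \<integral>\<^sup>+t. ennreal (norm (F t)) * indicator {..<2 * d n} t \<partial>leb 0 T) \<longlonglongrightarrow> (\<integral>\<^sup>+t. 0 \<partial>leb 0 T)"
  proof (rule nn_integral_dominated_convergence[where w = "\<lambda>t. ennreal (norm (F t))"])
    show "AE t in leb 0 T. (\<lambda>n. ennreal (norm (F t)) * indicator {..<2 * d n} t) \<longlonglongrightarrow> 0"
      using AE_space
    proof eventually_elim
      case (elim t)
      have "\<forall>\<^sub>F n in sequentially. 2 * d n < t" using d_lim by (rule order_tendstoD(2)) (use elim in simp)
      then have "\<forall>\<^sub>F n in sequentially. ennreal (norm (F t)) * indicator {..<2 * d n} t = 0"
        by eventually_elim simp
      then show ?case by (rule tendsto_eventually)
    qed
    show "AE t in leb 0 T. ennreal (norm (F t)) * indicator {..<2 * d n} t \<le> ennreal (norm (F t))" for n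
      by (intro AE_I2) (auto split: split_indicator)
    show "(\<lambda>t. ennreal (norm (F t)) * indicator {..<2 * d n} t) \<in> borel_measurable (leb 0 T)" for n by measurable
    show "(\<lambda>t. ennreal (norm (F t))) \<in> borel_measurable (leb 0 T)" by measurable
    show "(\<integral>\<^sup>+t. norm (F t) \<partial>leb 0 T) < \<infinity>" by (rule fin)
  qed simp
  then have "(\<lambda>n. \<integral>\<^sup>+t. ennreal (norm (F t)) * indicator {..<2 * d n} t \<partial>leb 0 T) \<longlonglongrightarrow> 0" by simp
  then have "\<forall>\<^sub>F n in sequentially. (\<integral>\<^sup>+t. ennreal (norm (F t)) * indicator {..<2 * d n} t \<partial>leb 0 T) < ennreal e"
    by (rule order_tendstoD(2)) (use e in simp)
  then obtain n where n: "(\<integral>\<^sup>+t. ennreal (norm (F t)) * indicator {..<2 * d n} t \<partial>leb 0 T) < ennreal e"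
    unfolding eventually_sequentially by blast
  have "(\<integral>\<^sup>+t. norm (F t) \<partial>leb 0 (2 * d n)) = (\<integral>\<^sup>+t. ennreal (norm (F t)) * indicator {..<2 * d n} t \<partial>leb 0 T)"
    unfolding nn_integral_leb using d[of n] by (intro nn_integral_cong) (auto split: split_indicator)
  then show ?thesis using n d[of n] by (intro exI[of _ "d n"]) auto
qed

section \<open>The strong limit of nearly optimal observations\<close>

context control_system
begin

text \<open>Translating an orbit of the observation is observing \<open>S\<^sup>*(e)z\<close>; the translates avoid the
  endpoint \<open>0\<close>, near which only local convergence is available.\<close>

lemma local_limit_approximable:
  assumes T: "0 < T" and z: "\<And>n. z n \<in> Ds" and F: "strongly_measurable (leb 0 (T + 1)) F"
    and fin: "(\<integral>\<^sup>+t. norm (F t) \<partial>leb 0 T) < \<infinity>"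
    and lim: "\<And>a. 0 < a \<Longrightarrow> a < T + 1 \<Longrightarrow> (\<lambda>n. \<integral>\<^sup>+t. norm (obs (z n) t - F t) \<partial>leb a (T + 1)) \<longlonglongrightarrow> 0"
    and e: "0 < e"
  shows "\<exists>w\<in>Ds. (\<integral>\<^sup>+t. norm (F t - obs w t) \<partial>leb 0 T) \<le> ennreal e"
proof -
  \<comment> \<open>Three errors arise on (0, d) and four on (d, T).\<close>
  define \<eta> where "\<eta> = e / 7"
  have \<eta>: "0 < \<eta>" using e by (simp add: \<eta>_def)
  have FT: "strongly_measurable (leb a c) F" if "0 \<le> a" "c \<le> T + 1" for a c
    by (rule strongly_measurable_leb_mono[OF F]) (use that in auto)
  obtain d where d: "0 < d" "d \<le> T / 2" "(\<integral>\<^sup>+t. norm (F t) \<partial>leb 0 (2 * d)) \<le> ennreal \<eta>"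
    using nn_integral_small_interval[OF FT fin T \<eta>] by auto
  have near: "\<exists>n. (\<integral>\<^sup>+t. norm (obs (z n) t - F t) \<partial>leb a (T + 1)) \<le> ennreal \<eta>" if "0 < a" "a < T + 1" for a
  proof -
    have "\<forall>\<^sub>F n in sequentially. (\<integral>\<^sup>+t. norm (obs (z n) t - F t) \<partial>leb a (T + 1)) < ennreal \<eta>"
      by (rule order_tendstoD(2)[OF lim[OF that]]) (use \<eta> in simp)
    then show ?thesis unfolding eventually_sequentially by (meson less_imp_le order_refl)
  qed
  obtain n where n: "(\<integral>\<^sup>+t. norm (obs (z n) t - F t) \<partial>leb d (T + 1)) \<le> ennreal \<eta>"
    using near[of d] d T by auto
  have uc: "uniformly_continuous_on {0..T + 1} (obs (z n))"
    using obs_cont'[OF z[of n] order_refl] by (intro compact_uniformly_continuous) auto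
  have "0 < \<eta> / T" using \<eta> T by simp
  then obtain \<rho> where \<rho>: "0 < \<rho>" "\<forall>s\<in>{0..T + 1}. \<forall>t\<in>{0..T + 1}. dist t s < \<rho> \<longrightarrow> dist (obs (z n) t) (obs (z n) s) < \<eta> / T"
    using uc unfolding uniformly_continuous_on_def by blast
  \<comment> \<open>The order of choices matters: n and the modulus of continuity of
    \<open>obs (z n)\<close> fix the shift h, and only then is m chosen with
    \<open>obs (z m)\<close> close to F on (h, T + 1). The bound \<open>h \<le> 1\<close> keeps (h,
    T + h) inside the interval of convergence.\<close>
  define h where "h = min (\<rho> / 2) (min d 1)"
  have h: "0 < h" "h < \<rho>" "h \<le> d" "h \<le> 1" using \<rho>(1) d(1) by (auto simp: h_def)
  obtain m where m: "(\<integral>\<^sup>+t. norm (obs (z m) t - F t) \<partial>leb h (T + 1)) \<le> ennreal \<eta>"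
    using near[of h] h T by auto
  define w where "w = Sa h (z m)"
  have w: "w \<in> Ds" using z h by (simp add: w_def Sa_Ds)
  have ow: "obs w t = obs (z m) (t + h)" if "0 \<le> t" for t using that h by (simp add: w_def obs_shift)
  have osm: "strongly_measurable (leb a c) (obs (z k))" if "0 \<le> a" for a c k by (rule obs_sm[OF z that])
  have wsm: "strongly_measurable (leb a c) (obs w)" if "0 \<le> a" for a c by (rule obs_sm[OF w that])
  have mono: "(\<integral>\<^sup>+t. g t \<partial>leb a c) \<le> ennreal \<eta>"
    if "(\<integral>\<^sup>+t. g t \<partial>leb a' c') \<le> ennreal \<eta>" "a' \<le> a" "c \<le> c'" for g a c a' c'
    by (rule order_trans[OF nn_integral_leb_mono_set that(1)]) (use that in auto)
  have swap: "(\<integral>\<^sup>+t. norm (f t - g t) \<partial>leb a c) = (\<integral>\<^sup>+t. norm (g t - f t) \<partial>leb a c)" for f g :: "real \<Rightarrow> 'u" and a c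
    by (simp add: norm_minus_commute)
  have z0: "strongly_measurable (leb a c) (\<lambda>_. 0 :: 'u)" for a c by simp
  have F0: "(\<integral>\<^sup>+t. norm (F t - 0) \<partial>leb 0 (2 * d)) \<le> ennreal \<eta>" using d(3) by simp
  \<comment> \<open>On (0, d) both functions are shown to be small instead of close:
    \<open>obs w\<close> reads \<open>obs (z m)\<close> on (h, d + h), where it is near F, and F has
    little mass there.\<close>
  have left: "(\<integral>\<^sup>+t. norm (F t - obs w t) \<partial>leb 0 d) \<le> ennreal \<eta> + (ennreal \<eta> + ennreal \<eta>)"
  proof -
    have L1: "(\<integral>\<^sup>+t. norm (F t - obs w t) \<partial>leb 0 d) \<le> (\<integral>\<^sup>+t. norm (F t - 0) \<partial>leb 0 d) + (\<integral>\<^sup>+t. norm (0 - obs w t) \<partial>leb 0 d)"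
      using d T by (intro nn_integral_norm_triangle FT wsm z0) auto
    have L2: "(\<integral>\<^sup>+t. norm (0 - obs w t) \<partial>leb 0 d) \<le> ennreal \<eta> + ennreal \<eta>"
    proof -
    have "(\<integral>\<^sup>+t. norm (0 - obs w t) \<partial>leb 0 d) = (\<integral>\<^sup>+t. norm (obs (z m) (t + h)) \<partial>leb 0 d)"
      by (rule nn_integral_cong) (simp add: ow)
    also have "\<dots> = (\<integral>\<^sup>+t. norm (obs (z m) t) \<partial>leb h (d + h))"
      using h by (intro nn_integral_leb_shift measurable_compose[OF leb_norm_measurable[OF osm] measurable_ennreal]) simp
    also have "\<dots> = (\<integral>\<^sup>+t. norm (obs (z m) t - 0) \<partial>leb h (d + h))" by simp
    also have "\<dots> \<le> (\<integral>\<^sup>+t. norm (obs (z m) t - F t) \<partial>leb h (d + h)) + (\<integral>\<^sup>+t. norm (F t - 0) \<partial>leb h (d + h))"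
      using h d T by (intro nn_integral_norm_triangle FT osm z0) auto
    also have "\<dots> \<le> ennreal \<eta> + ennreal \<eta>"
      by (intro add_mono mono[OF m] mono[OF F0]) (use h d T in auto)
    finally show ?thesis .
    qed
    have L3: "(\<integral>\<^sup>+t. norm (F t - 0) \<partial>leb 0 d) \<le> ennreal \<eta>"
      by (rule mono[OF F0]) (use d in auto)
    show ?thesis by (rule order_trans[OF L1 add_mono[OF L3 L2]])
  qed
  \<comment> \<open>The chain runs from F to \<open>obs (z n)\<close>, to its translate by h, to the
    translate of \<open>obs (z m)\<close>. Comparing the two translates uses convergence up to T +
    h, beyond T.\<close>
  have right: "(\<integral>\<^sup>+t. norm (F t - obs w t) \<partial>leb d T) \<le> ennreal \<eta> + (ennreal \<eta> + (ennreal \<eta> + ennreal \<eta>))"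
  proof -
    define g where "g t = obs (z n) (t + h)" for t
    have gsm: "strongly_measurable (leb d T) g"
    proof -
      have "continuous_on {d..T} g"
        unfolding g_def by (rule continuous_on_compose2[OF obs_cont[OF z]]) (use d h in \<open>auto intro!: continuous_intros\<close>)
      then show ?thesis by (rule strongly_measurable_continuous)
    qed
    have R1: "(\<integral>\<^sup>+t. norm (F t - obs w t) \<partial>leb d T) \<le> (\<integral>\<^sup>+t. norm (F t - obs (z n) t) \<partial>leb d T) + (\<integral>\<^sup>+t. norm (obs (z n) t - obs w t) \<partial>leb d T)"
      using d T by (intro nn_integral_norm_triangle FT wsm osm) auto
    have R2: "(\<integral>\<^sup>+t. norm (obs (z n) t - obs w t) \<partial>leb d T) \<le> (\<integral>\<^sup>+t. norm (obs (z n) t - g t) \<partial>leb d T) + (\<integral>\<^sup>+t. norm (g t - obs w t) \<partial>leb d T)"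
      using d T by (intro nn_integral_norm_triangle gsm wsm osm) auto
    have R3: "(\<integral>\<^sup>+t. norm (obs (z n) t - g t) \<partial>leb d T) \<le> ennreal \<eta>"
    proof -
      have "(\<integral>\<^sup>+t. norm (obs (z n) t - g t) \<partial>leb d T) \<le> (\<integral>\<^sup>+t. ennreal (\<eta> / T) \<partial>leb d T)"
      proof (rule nn_integral_mono)
        fix t assume t: "t \<in> space (leb d T)"
        have "dist (obs (z n) t) (g t) < \<eta> / T"
          unfolding g_def by (rule \<rho>(2)[rule_format]) (use t d h T in \<open>auto simp: dist_real_def\<close>)
        then show "ennreal (norm (obs (z n) t - g t)) \<le> ennreal (\<eta> / T)" by (intro ennreal_leI) (simp add: dist_norm)
      qed
      also have "\<dots> = ennreal (\<eta> / T) * ennreal (T - d)" using d T by (simp add: emeasure_leb_space)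
      also have "\<dots> = ennreal (\<eta> / T * (T - d))" using \<eta> T d by (intro ennreal_mult[symmetric]) auto
      also have "\<dots> \<le> ennreal \<eta>" using \<eta> T d by (intro ennreal_leI) (simp add: field_simps)
      finally show ?thesis .
    qed
    have R4: "(\<integral>\<^sup>+t. norm (g t - obs w t) \<partial>leb d T) \<le> ennreal \<eta> + ennreal \<eta>"
    proof -
      have "(\<integral>\<^sup>+t. norm (g t - obs w t) \<partial>leb d T) = (\<integral>\<^sup>+t. norm (obs (z n) (t + h) - obs (z m) (t + h)) \<partial>leb d T)"
        by (rule nn_integral_cong) (use d in \<open>simp add: ow g_def\<close>)
      also have "\<dots> = (\<integral>\<^sup>+t. ennreal (norm (obs (z n) (t + h) - obs (z m) (t + h))) * indicator {d + h<..} (t + h) \<partial>leb 0 T)"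
        unfolding nn_integral_leb by (intro nn_integral_cong) (use d in \<open>auto split: split_indicator\<close>)
      also have "\<dots> = (\<integral>\<^sup>+t. ennreal (norm (obs (z n) t - obs (z m) t)) * indicator {d + h<..} t \<partial>leb h (T + h))"
      proof (rule nn_integral_leb_shift)
        have [measurable]: "(\<lambda>t. t) \<in> borel_measurable (leb h (T + h))"
          by (intro leb_borel_measurable strongly_measurable_continuous continuous_intros)
        have [measurable]: "(\<lambda>t. norm (obs (z n) t - obs (z m) t)) \<in> borel_measurable (leb h (T + h))"
          using h by (intro leb_norm_measurable strongly_measurable_diff osm) auto
        show "(\<lambda>t. ennreal (norm (obs (z n) t - obs (z m) t)) * indicator {d + h<..} t) \<in> borel_measurable (leb h (T + h))"
          by measurable
      qed
      also have "\<dots> = (\<integral>\<^sup>+t. norm (obs (z n) t - obs (z m) t) \<partial>leb (d + h) (T + h))"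
        unfolding nn_integral_leb by (intro nn_integral_cong) (use d h in \<open>auto split: split_indicator\<close>)
      also have "\<dots> \<le> (\<integral>\<^sup>+t. norm (obs (z n) t - F t) \<partial>leb (d + h) (T + h)) + (\<integral>\<^sup>+t. norm (F t - obs (z m) t) \<partial>leb (d + h) (T + h))"
        using h d T by (intro nn_integral_norm_triangle FT osm) auto
      also have "\<dots> \<le> ennreal \<eta> + ennreal \<eta>"
        unfolding swap[where f = F] by (intro add_mono mono[OF n] mono[OF m]) (use h d T in auto)
      finally show ?thesis .
    qed
    have R5: "(\<integral>\<^sup>+t. norm (F t - obs (z n) t) \<partial>leb d T) \<le> ennreal \<eta>"
      unfolding swap[where f = F] by (rule mono[OF n]) auto
    show ?thesis by (rule order_trans[OF R1 add_mono[OF R5 order_trans[OF R2 add_mono[OF R3 R4]]]])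
  qed
  have "(\<integral>\<^sup>+t. norm (F t - obs w t) \<partial>leb 0 T) \<le> (\<integral>\<^sup>+t. norm (F t - obs w t) \<partial>leb 0 d) + (\<integral>\<^sup>+t. norm (F t - obs w t) \<partial>leb d T)"
    using d T by (intro nn_integral_leb_split measurable_compose[OF leb_norm_measurable measurable_ennreal] strongly_measurable_diff FT wsm) auto
  also have "\<dots> \<le> (ennreal \<eta> + (ennreal \<eta> + ennreal \<eta>)) + (ennreal \<eta> + (ennreal \<eta> + (ennreal \<eta> + ennreal \<eta>)))"
    by (intro add_mono left right)
  also have "\<dots> = ennreal (7 * \<eta>)" using \<eta> by (simp flip: ennreal_plus)
  finally show ?thesis using w by (intro bexI[of _ w]) (auto simp: \<eta>_def)
qed

text \<open>Near 0 only the mass of the observations is controlled, but w is small there, so mass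
  escaping to 0 is nearly invisible to the pairing. Away from 0 the \<open>L\<^sup>1\<close>
  convergence is enough for bounded w.\<close>

lemma local_convergence_integral_le:
  assumes T: "0 < T" and z: "\<And>n. z n \<in> Ds" and zN: "\<And>n. (\<integral>t. norm (obs (z n) t) \<partial>leb 0 T) \<le> 1"
    and F: "strongly_measurable (leb 0 T) F" "integrable (leb 0 T) (\<lambda>t. norm (F t))" "(\<integral>t. norm (F t) \<partial>leb 0 T) \<le> 1"
    and lim: "\<And>a. 0 < a \<Longrightarrow> a < T + 1 \<Longrightarrow> (\<lambda>n. \<integral>\<^sup>+t. norm (obs (z n) t - F t) \<partial>leb a (T + 1)) \<longlonglongrightarrow> 0"
    and w: "strongly_measurable (leb 0 T) w" "AE t in leb 0 T. norm (w t) \<le> K" "0 \<le> K"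
    and small: "\<And>\<eta>. 0 < \<eta> \<Longrightarrow> \<exists>d>0. d < T \<and> (AE t in leb 0 d. norm (w t) \<le> \<eta>)"
    and low: "\<And>n. M - 1 / real (Suc n) \<le> (\<integral>t. w t \<bullet> obs (z n) t \<partial>leb 0 T)"
  shows "M \<le> (\<integral>t. w t \<bullet> F t \<partial>leb 0 T)"
proof (rule field_le_epsilon)
  fix e :: real assume e: "0 < e"
  \<comment> \<open>Two parts come from small values of w against a total mass of at most 2, K parts
    from the distance beyond d, and one part from the optimality defect 1 / (n+1).\<close>
  define \<eta> where "\<eta> = e / (3 + K)"
  have \<eta>: "0 < \<eta>" using e w(3) by (simp add: \<eta>_def)
  obtain d where d: "0 < d" "d < T" "AE t in leb 0 d. norm (w t) \<le> \<eta>" using small[OF \<eta>] by blast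
  have "\<forall>\<^sub>F n in sequentially. (\<integral>\<^sup>+t. norm (obs (z n) t - F t) \<partial>leb d (T + 1)) < ennreal \<eta>"
    by (rule order_tendstoD(2)[OF lim]) (use \<eta> d in auto)
  moreover have "\<forall>\<^sub>F n in sequentially. 1 / real (Suc n) < \<eta>"
    by (rule order_tendstoD(2)[OF LIMSEQ_Suc[OF lim_1_over_n] \<eta>])
  ultimately have "\<forall>\<^sub>F n in sequentially. (\<integral>\<^sup>+t. norm (obs (z n) t - F t) \<partial>leb d (T + 1)) < ennreal \<eta> \<and> 1 / real (Suc n) < \<eta>"
    by (rule eventually_conj)
  then obtain n where n: "(\<integral>\<^sup>+t. norm (obs (z n) t - F t) \<partial>leb d (T + 1)) < ennreal \<eta>" "1 / real (Suc n) < \<eta>"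
    unfolding eventually_sequentially by blast
  define g where "g t = obs (z n) t - F t" for t
  have osm: "strongly_measurable (leb 0 T) (obs (z n))" by (rule obs_sm[OF z order_refl])
  have oi: "integrable (leb 0 T) (\<lambda>t. norm (obs (z n) t))" by (rule obs_norm_int[OF z order_refl])
  have gsm: "strongly_measurable (leb 0 T) g" unfolding g_def by (intro strongly_measurable_diff osm F)
  have [measurable]: "(\<lambda>t. t) \<in> borel_measurable (leb 0 T)" "(\<lambda>t. norm (g t)) \<in> borel_measurable (leb 0 T)"
    by (intro leb_borel_measurable strongly_measurable_continuous continuous_intros) (rule leb_norm_measurable[OF gsm])
  have gle: "norm (g t) \<le> norm (obs (z n) t) + norm (F t)" for t unfolding g_def by (rule norm_triangle_ineq4)
  have gi: "integrable (leb 0 T) (\<lambda>t. norm (g t))"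
  proof (rule Bochner_Integration.integrable_bound)
    show "integrable (leb 0 T) (\<lambda>t. norm (obs (z n) t) + norm (F t))" using oi F(2) by simp
    show "AE t in leb 0 T. norm (norm (g t)) \<le> norm (norm (obs (z n) t) + norm (F t))" using gle by (intro AE_I2) simp
  qed measurable
  have hi: "integrable (leb 0 T) (\<lambda>t. norm (g t) * indicator {d<..} t)"
    by (rule Bochner_Integration.integrable_bound[OF gi]) (measurable, auto split: split_indicator)
  have tail: "(\<integral>t. norm (g t) * indicator {d<..} t \<partial>leb 0 T) \<le> \<eta>"
  proof -
    have "ennreal (\<integral>t. norm (g t) * indicator {d<..} t \<partial>leb 0 T) = (\<integral>\<^sup>+t. ennreal (norm (g t) * indicator {d<..} t) \<partial>leb 0 T)"
      by (rule nn_integral_eq_integral_leb[OF hi, symmetric]) simp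
    also have "\<dots> \<le> (\<integral>\<^sup>+t. norm (obs (z n) t - F t) \<partial>leb d (T + 1))"
      unfolding nn_integral_leb g_def by (intro nn_integral_mono) (use d in \<open>auto split: split_indicator\<close>)
    also have "\<dots> \<le> ennreal \<eta>" using n by simp
    finally show ?thesis using \<eta> by simp
  qed
  have wd: "AE t in leb 0 T. t \<in> {0<..<d} \<longrightarrow> norm (w t) \<le> \<eta>"
    using d(3) unfolding AE_leb_iff by eventually_elim auto
  have nd: "AE t in leb 0 T. t \<noteq> d"
    unfolding AE_leb_iff by (rule AE_mp[OF AE_not_in[of "{d}"]]) (auto intro: AE_I2)
  have gint: "(\<integral>t. norm (g t) \<partial>leb 0 T) \<le> 2"
  proof -
    have "(\<integral>t. norm (g t) \<partial>leb 0 T) \<le> (\<integral>t. norm (obs (z n) t) + norm (F t) \<partial>leb 0 T)"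
      using gi oi F(2) gle by (intro integral_mono) auto
    also have "\<dots> \<le> 2" using oi F(2) F(3) zN[of n] by simp
    finally show ?thesis .
  qed
  have wgi: "integrable (leb 0 T) (\<lambda>t. w t \<bullet> g t)" by (rule bounded_inner_integral(1)[OF T w gsm gi])
  have "(\<integral>t. w t \<bullet> g t \<partial>leb 0 T) \<le> (\<integral>t. \<eta> * norm (g t) + K * (norm (g t) * indicator {d<..} t) \<partial>leb 0 T)"
  proof (rule integral_mono_AE[OF wgi])
    show "integrable (leb 0 T) (\<lambda>t. \<eta> * norm (g t) + K * (norm (g t) * indicator {d<..} t))" using gi hi by simp
    show "AE t in leb 0 T. w t \<bullet> g t \<le> \<eta> * norm (g t) + K * (norm (g t) * indicator {d<..} t)"
      using wd nd w(2) AE_space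
    proof eventually_elim
      case (elim t)
      have 1: "w t \<bullet> g t \<le> norm (w t) * norm (g t)" by (rule norm_cauchy_schwarz)
      show ?case
      proof (cases "t < d")
        case True
        then have "norm (w t) * norm (g t) \<le> \<eta> * norm (g t)" using elim by (intro mult_right_mono) auto
        then show ?thesis using 1 True by simp
      next
        case False
        then have "norm (w t) * norm (g t) \<le> K * norm (g t)" "0 \<le> \<eta> * norm (g t)" "d < t"
          using elim \<eta> by (auto intro: mult_right_mono)
        then show ?thesis using 1 by simp
      qed
    qed
  qed
  also have "\<dots> = \<eta> * (\<integral>t. norm (g t) \<partial>leb 0 T) + K * (\<integral>t. norm (g t) * indicator {d<..} t \<partial>leb 0 T)"
    using gi hi by simp
  also have "\<dots> \<le> \<eta> * 2 + K * \<eta>"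
    using gint tail \<eta> w(3) by (intro add_mono mult_left_mono) auto
  finally have "(\<integral>t. w t \<bullet> g t \<partial>leb 0 T) \<le> \<eta> * 2 + K * \<eta>" .
  moreover have "(\<integral>t. w t \<bullet> g t \<partial>leb 0 T) = (\<integral>t. w t \<bullet> obs (z n) t \<partial>leb 0 T) - (\<integral>t. w t \<bullet> F t \<partial>leb 0 T)"
    unfolding g_def inner_diff_right
    by (intro Bochner_Integration.integral_diff bounded_inner_integral(1)[OF T w] osm oi F)
  moreover have "\<eta> * 2 + K * \<eta> + \<eta> = e"
  proof -
    have "\<eta> * 2 + K * \<eta> + \<eta> = \<eta> * (3 + K)" by (simp add: algebra_simps)
    then show ?thesis using w(3) by (simp add: \<eta>_def)
  qed
  ultimately show "M \<le> (\<integral>t. w t \<bullet> F t \<partial>leb 0 T) + e" using low[of n] n(2) by linarith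
qed

text \<open>The normalisation lives on (0, T) but the selection is made on (0, T + 1):
  \<open>obs_L1_extend\<close> supplies the bound there and \<open>obs_equiintegrable\<close> the
  tails. The sets of near-maximisers are convex because the constraint is a norm and the objective
  is linear.\<close>

lemma nearly_optimal_selection:
  assumes H: "null_controlled p" and T: "0 < T"
    and ex: "\<And>n. \<exists>z\<in>Ds. (\<integral>t. norm (obs z t) \<partial>leb 0 T) \<le> 1 \<and> M - 1 / real (Suc n) \<le> y \<bullet> z"
  shows "\<exists>z F. (\<forall>n. z n \<in> Ds \<and> (\<integral>t. norm (obs (z n) t) \<partial>leb 0 T) \<le> 1 \<and> M - 1 / real (Suc n) \<le> y \<bullet> z n) \<and>
    strongly_measurable (leb 0 (T + 1)) F \<and> (AE t in leb 0 (T + 1). (\<lambda>n. obs (z n) t) \<longlonglongrightarrow> F t) \<and>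
    (\<forall>a. 0 < a \<longrightarrow> a < T + 1 \<longrightarrow> (\<lambda>n. \<integral>\<^sup>+t. norm (obs (z n) t - F t) \<partial>leb a (T + 1)) \<longlonglongrightarrow> 0)"
proof -
  obtain K where K: "0 < K" "\<And>z. z \<in> Ds \<Longrightarrow> (\<integral>t. norm (obs z t) \<partial>leb 0 T) \<le> 1 \<Longrightarrow> (\<integral>t. norm (obs z t) \<partial>leb 0 (T + 1)) \<le> K"
    using obs_L1_extend[OF H T] by blast
  define Z where "Z n = {z \<in> Ds. (\<integral>t. norm (obs z t) \<partial>leb 0 T) \<le> 1 \<and> M - 1 / real (Suc n) \<le> y \<bullet> z}" for n
  \<comment> \<open>Agreement is required for \<open>t \<ge> 0\<close> only: linearity of
    \<open>obs\<close> in z is known just there, and the sets must contain midpoints of their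
    members.\<close>
  define C where "C n = {f. \<exists>z\<in>Z n. \<forall>t\<ge>0. f t = obs z t}" for n
  have b: "0 < T + 1" using T by simp
  have C_int: "(\<integral>t. norm (f t) \<partial>leb 0 (T + 1)) = (\<integral>t. norm (obs z t) \<partial>leb 0 (T + 1))" if "\<forall>t\<ge>0. f t = obs z t" for f z
    by (rule Bochner_Integration.integral_cong) (use that in auto)
  show ?thesis
  proof (rule L1_convex_selection[OF b, of C K])
    show "C (Suc n) \<subseteq> C n" for n
    proof -
      have "1 / real (Suc (Suc n)) \<le> 1 / real (Suc n)" by (intro divide_left_mono) auto
      then have "Z (Suc n) \<subseteq> Z n" unfolding Z_def by (auto simp del: of_nat_Suc)
      then show ?thesis by (auto simp: C_def)
    qed
    show "C n \<noteq> {}" for n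
    proof -
      obtain z where "z \<in> Z n" using ex[of n] by (auto simp: Z_def)
      then have "obs z \<in> C n" by (auto simp: C_def)
      then show ?thesis by blast
    qed
    show "(\<lambda>t. (1/2) *\<^sub>R (f t + g t)) \<in> C n" if fg: "f \<in> C n" "g \<in> C n" for n f g
    proof -
      obtain z w where z: "z \<in> Z n" "\<forall>t\<ge>0. f t = obs z t" and w: "w \<in> Z n" "\<forall>t\<ge>0. g t = obs w t"
        using fg by (auto simp: C_def)
      define v where "v = (1/2) *\<^sub>R z + (1/2) *\<^sub>R w"
      have zw: "z \<in> Ds" "w \<in> Ds" using z w by (auto simp: Z_def)
      have v: "v \<in> Ds" unfolding v_def by (rule Ds_linear(1)[OF zw])
      have ov: "obs v t = (1/2) *\<^sub>R (obs z t + obs w t)" if "0 \<le> t" for t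
        using obs_linear[OF zw that, of "1/2" "1/2"] by (simp add: v_def scaleR_add_right)
      have "(\<integral>t. norm (obs v t) \<partial>leb 0 T) \<le> (\<integral>t. norm (obs z t) / 2 + norm (obs w t) / 2 \<partial>leb 0 T)"
      proof (rule integral_mono)
        show "integrable (leb 0 T) (\<lambda>t. norm (obs v t))" by (rule obs_norm_int[OF v order_refl])
        show "integrable (leb 0 T) (\<lambda>t. norm (obs z t) / 2 + norm (obs w t) / 2)"
          using obs_norm_int[OF zw(1) order_refl] obs_norm_int[OF zw(2) order_refl] by simp
        fix t assume "t \<in> space (leb 0 T)"
        then have "norm (obs v t) = norm (obs z t + obs w t) / 2" by (simp add: ov)
        also have "\<dots> \<le> (norm (obs z t) + norm (obs w t)) / 2" by (intro divide_right_mono norm_triangle_ineq) simp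
        finally show "norm (obs v t) \<le> norm (obs z t) / 2 + norm (obs w t) / 2" by (simp add: add_divide_distrib)
      qed
      also have "\<dots> = (\<integral>t. norm (obs z t) \<partial>leb 0 T) / 2 + (\<integral>t. norm (obs w t) \<partial>leb 0 T) / 2"
        using obs_norm_int[OF zw(1) order_refl] obs_norm_int[OF zw(2) order_refl] by simp
      also have "\<dots> \<le> 1" using z(1) w(1) by (simp add: Z_def)
      finally have N: "(\<integral>t. norm (obs v t) \<partial>leb 0 T) \<le> 1" .
      have "M - 1 / real (Suc n) \<le> (y \<bullet> z) / 2 + (y \<bullet> w) / 2"
      proof -
        have "M - 1 / real (Suc n) \<le> y \<bullet> z" "M - 1 / real (Suc n) \<le> y \<bullet> w"
          using z(1) w(1) unfolding Z_def by blast+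
        then show ?thesis by linarith
      qed
      then have "M - 1 / real (Suc n) \<le> y \<bullet> v" by (simp add: v_def inner_add_right)
      then have "v \<in> Z n" using v N by (simp add: Z_def)
      moreover have "\<forall>t\<ge>0. (1/2) *\<^sub>R (f t + g t) = obs v t" using z(2) w(2) ov by simp
      ultimately show ?thesis by (auto simp: C_def)
    qed
    show "continuous_on {0..T + 1} f" if f: "f \<in> C 0" for f
    proof -
      obtain z where z: "z \<in> Z 0" "\<forall>t\<ge>0. f t = obs z t" using f by (auto simp: C_def)
      have "continuous_on {0..T + 1} (obs z)" using z(1) by (intro obs_cont') (auto simp: Z_def)
      then show ?thesis by (rule continuous_on_eq) (use z in auto)
    qed
    show "(\<integral>t. norm (f t) \<partial>leb 0 (T + 1)) \<le> K" if f: "f \<in> C 0" for f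
    proof -
      obtain z where z: "z \<in> Z 0" "\<forall>t\<ge>0. f t = obs z t" using f by (auto simp: C_def)
      then show ?thesis using C_int[OF z(2)] K(2)[of z] by (simp add: Z_def)
    qed
    show "\<exists>R\<ge>0. \<forall>f\<in>C 0. (\<integral>\<^sup>+t. ennreal (norm (f t) * indicator {R<..} (norm (f t))) \<partial>leb a (T + 1)) \<le> ennreal \<eta>"
      if a: "0 < a" "a < T + 1" "0 < \<eta>" for a \<eta>
    proof -
      obtain R where R: "0 \<le> R" "\<And>z. z \<in> Ds \<Longrightarrow> (\<integral>t. norm (obs z t) \<partial>leb 0 (T + 1)) \<le> K \<Longrightarrow>
        (\<integral>\<^sup>+t. ennreal (norm (obs z t) * indicator {R<..} (norm (obs z t))) \<partial>leb a (T + 1)) \<le> ennreal \<eta>"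
        using obs_equiintegrable[OF H a K(1)] by blast
      have "(\<integral>\<^sup>+t. ennreal (norm (f t) * indicator {R<..} (norm (f t))) \<partial>leb a (T + 1)) \<le> ennreal \<eta>" if f: "f \<in> C 0" for f
      proof -
        obtain z where z: "z \<in> Z 0" "\<forall>t\<ge>0. f t = obs z t" using f by (auto simp: C_def)
        have "(\<integral>\<^sup>+t. ennreal (norm (f t) * indicator {R<..} (norm (f t))) \<partial>leb a (T + 1))
            = (\<integral>\<^sup>+t. ennreal (norm (obs z t) * indicator {R<..} (norm (obs z t))) \<partial>leb a (T + 1))"
          by (rule nn_integral_cong) (use z(2) a in simp)
        also have "\<dots> \<le> ennreal \<eta>" using z(1) K(2)[of z] by (intro R(2)) (auto simp: Z_def)
        finally show ?thesis .
      qed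
      then show ?thesis using R(1) by blast
    qed
    fix f F assume f: "\<And>n. f n \<in> C n" and F: "strongly_measurable (leb 0 (T + 1)) F"
      and ae: "AE t in leb 0 (T + 1). (\<lambda>n. f n t) \<longlonglongrightarrow> F t"
      and lim: "\<And>a. 0 < a \<Longrightarrow> a < T + 1 \<Longrightarrow> (\<lambda>n. \<integral>\<^sup>+t. norm (f n t - F t) \<partial>leb a (T + 1)) \<longlonglongrightarrow> 0"
    have "\<exists>z. \<forall>n. z n \<in> Z n \<and> (\<forall>t\<ge>0. f n t = obs (z n) t)"
      using f by (intro choice) (auto simp: C_def)
    then obtain z where z: "\<And>n. z n \<in> Z n" "\<And>n t. 0 \<le> t \<Longrightarrow> f n t = obs (z n) t" by blast
    have "AE t in leb 0 (T + 1). (\<lambda>n. obs (z n) t) \<longlonglongrightarrow> F t"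
      using ae AE_space by eventually_elim (simp add: z(2))
    moreover have "(\<lambda>n. \<integral>\<^sup>+t. norm (obs (z n) t - F t) \<partial>leb a (T + 1)) \<longlonglongrightarrow> 0" if a: "0 < a" "a < T + 1" for a
    proof -
      have "(\<integral>\<^sup>+t. norm (f n t - F t) \<partial>leb a (T + 1)) = (\<integral>\<^sup>+t. norm (obs (z n) t - F t) \<partial>leb a (T + 1))" for n
        by (rule nn_integral_cong) (use a z(2) in simp)
      then show ?thesis using lim[OF a] by simp
    qed
    moreover have "z n \<in> Ds \<and> (\<integral>t. norm (obs (z n) t) \<partial>leb 0 T) \<le> 1 \<and> M - 1 / real (Suc n) \<le> y \<bullet> z n" for n
      using z(1)[of n] unfolding Z_def by blast
    ultimately show ?thesis using F by (intro exI[of _ z] exI[of _ F]) blast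
  qed
qed

section \<open>Minimal norm controls and the extremal direction\<close>

text \<open>The \<open>L\<^sup>2\<close> estimate gives |y| <= C sqrt T |v| for every admissible v.
  This makes the infimum positive and also provides the lower bound that lets \<open>Inf\<close> be
  compared with its members.\<close>

lemma reach_norm_props:
  assumes T: "0 < T" and y: "y \<noteq> 0" and ex: "admissible_control D A S B T y v0"
  shows "0 < reach_norm D A S B T y"
    "admissible_control D A S B T y v \<Longrightarrow> reach_norm D A S B T y \<le> Linf_norm 0 T v"
proof -
  define V where "V = {Linf_norm 0 T v | v. admissible_control D A S B T y v}"
  have rn: "reach_norm D A S B T y = Inf V" by (simp add: reach_norm_def V_def)
  obtain C where C: "0 < C" "\<And>w. w \<in> Lp 2 0 T \<Longrightarrow> norm (reach T w) \<le> C * Lp_norm 2 0 T w" using reach_bound[OF T] by blast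
  define m where "m = norm y / (C * sqrt T)"
  have m: "0 < m" using y C T by (simp add: m_def)
  have low: "m \<le> Linf_norm 0 T v" if v: "admissible_control D A S B T y v" for v
  proof -
    have vL: "v \<in> Linf 0 T" and yv: "y = yhat D A S B T 0 v" using v by (auto simp: admissible_control_def)
    define w where "w t = v (T - t)" for t
    have wsm: "strongly_measurable (leb 0 T) w"
      unfolding w_def using vL by (intro strongly_measurable_reflect) (simp add: Linf_def)
    have wae: "AE t in leb 0 T. norm (w t) \<le> Linf_norm 0 T v"
      unfolding w_def by (rule AE_reflect[OF Linf_AE(1)[OF vL T]])
    note L2 = Lp_two_bounded[OF T wsm wae Linf_AE(2)[OF vL T]]
    have "norm y = norm (reach T w)" by (simp add: yv yhat_reach w_def[abs_def])
    also have "\<dots> \<le> C * Lp_norm 2 0 T w" by (rule C(2)[OF L2(1)])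
    also have "\<dots> \<le> C * (Linf_norm 0 T v * sqrt T)" using C L2(2) by (intro mult_left_mono) auto
    finally show ?thesis using C T by (simp add: m_def divide_le_eq mult_ac)
  qed
  have ne: "V \<noteq> {}" using ex by (auto simp: V_def)
  have "m \<le> Inf V" by (rule cInf_greatest[OF ne]) (auto simp: V_def low)
  then show "0 < reach_norm D A S B T y" using m rn by simp
  have bdd: "bdd_below V" by (rule bdd_belowI[of _ m]) (auto simp: V_def low)
  show "reach_norm D A S B T y \<le> Linf_norm 0 T v" if "admissible_control D A S B T y v"
    unfolding rn using bdd by (rule cInf_lower[rotated]) (use that in \<open>auto simp: V_def\<close>)
qed

text \<open>The condition defining \<open>reach0\<close> enters here: in reversed time the control
  is small near s = 0. The value of \<open>Linf_norm\<close> on (s, T) bounds the control only after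
  membership in \<open>Linf\<close> on that interval is known.\<close>

lemma vanishing_near_end:
  assumes T: "0 < T" and v: "v \<in> Linf 0 T" and lim: "((\<lambda>s. Linf_norm s T v) \<longlongrightarrow> 0) (at_left T)" and \<eta>: "0 < \<eta>"
  shows "\<exists>d>0. d < T \<and> (AE t in leb 0 d. norm (v (T - t)) \<le> \<eta>)"
proof -
  have "\<forall>\<^sub>F s in at_left T. Linf_norm s T v < \<eta>" using lim \<eta> by (rule order_tendstoD(2))
  moreover have "\<forall>\<^sub>F s in at_left T. s \<in> {0<..<T}" using T by (rule eventually_at_left_real)
  ultimately have "\<forall>\<^sub>F s in at_left T. Linf_norm s T v < \<eta> \<and> s \<in> {0<..<T}" by (rule eventually_conj)
  then have "\<exists>s. Linf_norm s T v < \<eta> \<and> s \<in> {0<..<T}" by (rule eventually_happens'[OF trivial_limit_at_left_real])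
  then obtain s where s: "Linf_norm s T v < \<eta>" "0 < s" "s < T" by auto
  have sub: "{s<..<T} \<subseteq> {0<..<T}" using s by auto
  have "v \<in> Linf s T"
  proof (rule Linf_I(1))
    show "strongly_measurable (leb s T) v" using v by (intro strongly_measurable_leb_mono[OF _ sub]) (simp add: Linf_def)
    show "AE t in leb s T. norm (v t) \<le> Linf_norm 0 T v" by (rule AE_leb_mono[OF Linf_AE(1)[OF v T] sub])
  qed (use s Linf_AE(2)[OF v T] in auto)
  then have "AE t in leb s T. norm (v t) \<le> Linf_norm s T v" using s by (intro Linf_AE)
  then have "AE t in leb 0 T. t \<in> {s<..<T} \<longrightarrow> norm (v t) \<le> \<eta>"
    unfolding AE_leb_iff by eventually_elim (use s in auto)
  then have "AE t in leb 0 T. T - t \<in> {s<..<T} \<longrightarrow> norm (v (T - t)) \<le> \<eta>" by (rule AE_reflect)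
  then have "AE t in leb 0 (T - s). norm (v (T - t)) \<le> \<eta>"
    unfolding AE_leb_iff by eventually_elim (use s in auto)
  then show ?thesis using s by (intro exI[of _ "T - s"]) auto
qed

text \<open>No control of norm at most M' = M - 1/(n+1) reaches y, so duality yields some z beating
  M'. Dividing by the \<open>L\<^sup>1\<close> norm of its observation normalises it.\<close>

lemma nearly_optimal_exists:
  assumes T: "0 < T" and y: "y \<noteq> 0" and v0: "admissible_control D A S B T y v0"
  shows "\<exists>z\<in>Ds. (\<integral>t. norm (obs z t) \<partial>leb 0 T) \<le> 1 \<and> reach_norm D A S B T y - 1 / real (Suc n) \<le> y \<bullet> z"
proof -
  define M where "M = reach_norm D A S B T y"
  define M' where "M' = M - 1 / real (Suc n)"
  show ?thesis
  proof (cases "M' \<le> 0")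
    case True
    have "obs 0 t = 0" if "0 \<le> t" for t using obs_linear[OF Ds_0(1) Ds_0(1) that, of 0 0] by simp
    then have "(\<integral>t. norm (obs 0 t) \<partial>leb 0 T) = (\<integral>t. 0 \<partial>leb 0 T)"
      by (intro Bochner_Integration.integral_cong) auto
    then show ?thesis using True Ds_0(1) by (intro bexI[of _ 0]) (auto simp: M'_def M_def)
  next
    case False
    then have M': "0 < M'" by simp
    have "\<exists>z\<in>Ds. M' * (\<integral>t. norm (obs z t) \<partial>leb 0 T) < y \<bullet> z"
    proof (rule minimal_norm_duality[OF T])
      fix w :: "real \<Rightarrow> 'u"
      assume w: "strongly_measurable (leb 0 T) w" "AE t in leb 0 T. norm (w t) \<le> M'"
      show "reach T w \<noteq> y"
      proof
        assume r: "reach T w = y"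
        define v where "v t = w (T - t)" for t
        have "strongly_measurable (leb 0 T) v" unfolding v_def by (rule strongly_measurable_reflect[OF w(1)])
        moreover have "AE t in leb 0 T. norm (v t) \<le> M'" unfolding v_def by (rule AE_reflect[OF w(2)])
        ultimately have "v \<in> Linf 0 T" "Linf_norm 0 T v \<le> M'" using Linf_I[of 0 T v M'] T M' by auto
        moreover have "yhat D A S B T 0 v = y" using r by (simp add: reach_def v_def[abs_def])
        ultimately have "M \<le> M'"
          using reach_norm_props(2)[OF T y v0, of v] unfolding M_def admissible_control_def by simp
        then show False by (simp add: M'_def)
      qed
    qed (use M' in simp)
    then obtain z where z: "z \<in> Ds" "M' * (\<integral>t. norm (obs z t) \<partial>leb 0 T) < y \<bullet> z" by blast
    define N where "N = (\<integral>t. norm (obs z t) \<partial>leb 0 T)"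
    have vL: "v0 \<in> Linf 0 T" and yv: "y = yhat D A S B T 0 v0" using v0 by (auto simp: admissible_control_def)
    define w where "w t = v0 (T - t)" for t
    have wsm: "strongly_measurable (leb 0 T) w"
      unfolding w_def using vL by (intro strongly_measurable_reflect) (simp add: Linf_def)
    have wae: "AE t in leb 0 T. norm (w t) \<le> Linf_norm 0 T v0"
      unfolding w_def by (rule AE_reflect[OF Linf_AE(1)[OF vL T]])
    have L0: "0 \<le> Linf_norm 0 T v0" by (rule Linf_AE(2)[OF vL T])
    have yz: "y \<bullet> z = (\<integral>t. w t \<bullet> obs z t \<partial>leb 0 T)"
      using reach_inner(2)[OF T Lp_two_bounded(1)[OF T wsm wae L0] z(1)] by (simp add: yv yhat_reach w_def[abs_def])
    have "\<bar>y \<bullet> z\<bar> \<le> Linf_norm 0 T v0 * N"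
      unfolding yz N_def by (rule bounded_inner_integral(2)[OF T wsm wae L0 obs_sm[OF z(1) order_refl] obs_norm_int[OF z(1) order_refl]])
    moreover have "0 \<le> N" unfolding N_def by (rule integral_nonneg_AE) simp
    \<comment> \<open>If the observation had mass 0, the pairing with v0 would give <y, z> = 0,
      whereas <y, z> is positive.\<close>
    ultimately have "0 < N" using z(2) M' by (cases "N = 0") (auto simp: N_def[symmetric])
    define u where "u = (1 / N) *\<^sub>R z"
    have u: "u \<in> Ds" unfolding u_def by (rule Ds_scale(1)[OF z(1)])
    have ou: "obs u t = (1 / N) *\<^sub>R obs z t" if "0 \<le> t" for t
      using obs_linear[OF z(1) z(1) that, of "1 / N" 0] by (simp add: u_def)
    have "(\<integral>t. norm (obs u t) \<partial>leb 0 T) = (\<integral>t. norm (obs z t) / N \<partial>leb 0 T)"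
      by (rule Bochner_Integration.integral_cong) (use \<open>0 < N\<close> in \<open>auto simp: ou\<close>)
    also have "\<dots> = 1" using \<open>0 < N\<close> by (simp add: N_def)
    finally have "(\<integral>t. norm (obs u t) \<partial>leb 0 T) \<le> 1" by simp
    moreover have "M' \<le> y \<bullet> u"
      using z(2) \<open>0 < N\<close> by (simp add: u_def N_def[symmetric] pos_le_divide_eq less_imp_le)
    ultimately show ?thesis using u unfolding M'_def M_def by blast
  qed
qed

text \<open>\<open>Y_T\<close> is formulated in forward time, the limit function in reversed time;
  reflection of (0, T) preserves the \<open>L\<^sup>1\<close> norm.\<close>

lemma Y_T_I:
  assumes T: "0 < T" and F: "strongly_measurable (leb 0 T) F" "integrable (leb 0 T) (\<lambda>t. norm (F t))"
    and approx: "\<And>e. 0 < e \<Longrightarrow> \<exists>w\<in>Ds. (\<integral>t. norm (F t - obs w t) \<partial>leb 0 T) \<le> e"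
  shows "(\<lambda>t. F (T - t)) \<in> Y_T D A S B T"
proof -
  have L1: "g \<in> Lp 1 0 T \<longleftrightarrow> strongly_measurable (leb 0 T) g \<and> integrable (leb 0 T) (\<lambda>t. norm (g t))" for g :: "real \<Rightarrow> 'u"
    by (simp add: Lp_def)
  have L1n: "Lp_norm 1 0 T g = (\<integral>t. norm (g t) \<partial>leb 0 T)" for g :: "real \<Rightarrow> 'u"
    by (simp add: Lp_norm_def integral_nonneg_AE)
  have "F \<in> Lp 1 0 T" using F by (simp add: L1)
  then have f: "(\<lambda>t. F (T - t)) \<in> Lp 1 0 T" by (rule Lp_reflect)
  have "\<exists>g\<in>X_T D A S B T. Lp_norm 1 0 T (\<lambda>t. F (T - t) - g t) < e" if e: "0 < e" for e
  proof -
    obtain w where w: "w \<in> Ds" "(\<integral>t. norm (F t - obs w t) \<partial>leb 0 T) \<le> e / 2" using approx[of "e / 2"] e by auto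
    have sm: "strongly_measurable (leb 0 T) (\<lambda>t. F t - obs w t)" by (intro strongly_measurable_diff F obs_sm w order_refl)
    have "integrable (leb 0 T) (\<lambda>t. norm (F t - obs w t))"
    proof (rule Bochner_Integration.integrable_bound)
      show "integrable (leb 0 T) (\<lambda>t. norm (F t) + norm (obs w t))" using F(2) obs_norm_int[OF w(1) order_refl] by simp
      show "(\<lambda>t. norm (F t - obs w t)) \<in> borel_measurable (leb 0 T)" by (rule leb_norm_measurable[OF sm])
      show "AE t in leb 0 T. norm (norm (F t - obs w t)) \<le> norm (norm (F t) + norm (obs w t))"
        by (intro AE_I2) (simp add: norm_triangle_ineq4)
    qed
    then have "(\<lambda>t. F t - obs w t) \<in> Lp 1 0 T" using sm by (simp add: L1)
    then have "Lp_norm 1 0 T (\<lambda>t. F (T - t) - obs w (T - t)) = Lp_norm 1 0 T (\<lambda>t. F t - obs w t)"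
      by (rule Lp_reflect(2))
    also have "\<dots> < e" using w(2) e by (simp add: L1n)
    finally have "Lp_norm 1 0 T (\<lambda>t. F (T - t) - obs w (T - t)) < e" .
    moreover have "(\<lambda>t. obs w (T - t)) \<in> X_T D A S B T" using w(1) by (auto simp: X_T_def obs_def)
    ultimately show ?thesis by (intro bexI[of _ "\<lambda>t. obs w (T - t)"])
  qed
  then show ?thesis using f by (simp add: Y_T_def)
qed

lemma minimal_norm_maximum_principle:
  assumes H: "null_controlled p" and T: "0 < T" and y: "y \<in> reach0 D A S B T" "y \<noteq> 0"
  shows "\<exists>f \<in> Y_T D A S B T. \<not> (AE t in leb 0 T. f t = 0) \<and>
           (\<forall>v. minimal_norm_control D A S B T y v \<longrightarrow>
             (AE t in leb 0 T.
                v t \<bullet> f t \<in> (\<lambda>w. w \<bullet> f t) ` cball 0 (reach_norm D A S B T y) \<and>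
                (\<forall>w\<in>cball 0 (reach_norm D A S B T y). w \<bullet> f t \<le> v t \<bullet> f t)))"
proof -
  obtain v0 where v0: "v0 \<in> Linf 0 T" "((\<lambda>s. Linf_norm s T v0) \<longlongrightarrow> 0) (at_left T)" "y = yhat D A S B T 0 v0"
    using y(1) by (auto simp: reach0_def)
  have adm0: "admissible_control D A S B T y v0" using v0 by (simp add: admissible_control_def)
  define M where "M = reach_norm D A S B T y"
  have M: "0 < M" unfolding M_def by (rule reach_norm_props(1)[OF T y(2) adm0])
  obtain z F where z: "\<And>n. z n \<in> Ds" "\<And>n. (\<integral>t. norm (obs (z n) t) \<partial>leb 0 T) \<le> 1" "\<And>n. M - 1 / real (Suc n) \<le> y \<bullet> z n"
    and F1: "strongly_measurable (leb 0 (T + 1)) F" and ae: "AE t in leb 0 (T + 1). (\<lambda>n. obs (z n) t) \<longlonglongrightarrow> F t"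
    and lim: "\<And>a. 0 < a \<Longrightarrow> a < T + 1 \<Longrightarrow> (\<lambda>n. \<integral>\<^sup>+t. norm (obs (z n) t - F t) \<partial>leb a (T + 1)) \<longlonglongrightarrow> 0"
    using nearly_optimal_selection[OF H T nearly_optimal_exists[OF T y(2) adm0]] unfolding M_def by blast
  have sub: "{0<..<T} \<subseteq> {0<..<T + 1}" by auto
  have F: "strongly_measurable (leb 0 T) F" by (rule strongly_measurable_leb_mono[OF F1 sub])
  \<comment> \<open>Fatou's lemma yields only an inequality, since mass may be lost at 0; the final
    comparison needs nothing more.\<close>
  have Fnn: "(\<integral>\<^sup>+t. norm (F t) \<partial>leb 0 T) \<le> 1"
  proof -
    have "(\<integral>\<^sup>+t. norm (F t) \<partial>leb 0 T) = (\<integral>\<^sup>+t. liminf (\<lambda>n. ennreal (norm (obs (z n) t))) \<partial>leb 0 T)"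
    proof (rule nn_integral_cong_AE)
      show "AE t in leb 0 T. ennreal (norm (F t)) = liminf (\<lambda>n. ennreal (norm (obs (z n) t)))"
        using AE_leb_mono[OF ae sub]
      proof eventually_elim
        case (elim t)
        then have "(\<lambda>n. ennreal (norm (obs (z n) t))) \<longlonglongrightarrow> ennreal (norm (F t))" by (intro tendsto_intros)
        then show ?case by (intro lim_imp_Liminf[symmetric]) auto
      qed
    qed
    also have "\<dots> \<le> liminf (\<lambda>n. \<integral>\<^sup>+t. norm (obs (z n) t) \<partial>leb 0 T)"
      by (rule nn_integral_liminf) (rule measurable_compose[OF leb_norm_measurable[OF obs_sm[OF z(1) order_refl]] measurable_ennreal])
    also have "\<dots> \<le> limsup (\<lambda>n. \<integral>\<^sup>+t. norm (obs (z n) t) \<partial>leb 0 T)" by (rule Liminf_le_Limsup) simp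
    also have "\<dots> \<le> 1"
    proof (rule Limsup_bounded, rule always_eventually, rule allI)
      fix n
      have "(\<integral>\<^sup>+t. norm (obs (z n) t) \<partial>leb 0 T) = ennreal (\<integral>t. norm (obs (z n) t) \<partial>leb 0 T)"
        by (rule nn_integral_eq_integral_leb[OF obs_norm_int[OF z(1) order_refl]]) simp
      also have "\<dots> \<le> ennreal 1" using z(2) by (rule ennreal_leI)
      finally show "(\<integral>\<^sup>+t. norm (obs (z n) t) \<partial>leb 0 T) \<le> 1" by simp
    qed
    finally show ?thesis .
  qed
  have Fi: "integrable (leb 0 T) (\<lambda>t. norm (F t))"
    using Fnn leb_norm_measurable[OF F] by (intro integrableI_bounded) (auto intro: le_less_trans)
  have F_1: "(\<integral>t. norm (F t) \<partial>leb 0 T) \<le> 1"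
  proof -
    have "ennreal (\<integral>t. norm (F t) \<partial>leb 0 T) \<le> ennreal 1"
      using Fnn nn_integral_eq_integral_leb[OF Fi] by simp
    then show ?thesis by (subst (asm) ennreal_le_iff) auto
  qed
  have approx: "\<exists>w\<in>Ds. (\<integral>t. norm (F t - obs w t) \<partial>leb 0 T) \<le> e" if e: "0 < e" for e
  proof -
    have "(\<integral>\<^sup>+t. norm (F t) \<partial>leb 0 T) < \<infinity>" using Fnn by (rule le_less_trans) simp
    then obtain w where w: "w \<in> Ds" "(\<integral>\<^sup>+t. norm (F t - obs w t) \<partial>leb 0 T) \<le> ennreal e"
      using local_limit_approximable[OF T z(1) F1 _ lim e] by blast
    have m: "(\<lambda>t. norm (F t - obs w t)) \<in> borel_measurable (leb 0 T)"
      by (intro leb_norm_measurable strongly_measurable_diff F obs_sm w order_refl)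
    have "integrable (leb 0 T) (\<lambda>t. norm (F t - obs w t))"
      using w(2) m by (intro integrableI_bounded) (auto intro: le_less_trans)
    then have "ennreal (\<integral>t. norm (F t - obs w t) \<partial>leb 0 T) \<le> ennreal e"
      using w(2) nn_integral_eq_integral_leb[of 0 T "\<lambda>t. norm (F t - obs w t)"] by simp
    then have "(\<integral>t. norm (F t - obs w t) \<partial>leb 0 T) \<le> e" using e by (subst (asm) ennreal_le_iff) auto
    then show ?thesis using w(1) by blast
  qed
  have ctrl: "strongly_measurable (leb 0 T) (\<lambda>t. v (T - t))" "AE t in leb 0 T. norm (v (T - t)) \<le> Linf_norm 0 T v"
    "0 \<le> Linf_norm 0 T v" "\<And>w. w \<in> Ds \<Longrightarrow> (\<integral>t. v (T - t) \<bullet> obs w t \<partial>leb 0 T) = y \<bullet> w"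
    if v: "admissible_control D A S B T y v" for v
  proof -
    have vL: "v \<in> Linf 0 T" and yv: "yhat D A S B T 0 v = y" using v by (auto simp: admissible_control_def)
    show sm: "strongly_measurable (leb 0 T) (\<lambda>t. v (T - t))"
      using vL by (intro strongly_measurable_reflect) (simp add: Linf_def)
    show b: "AE t in leb 0 T. norm (v (T - t)) \<le> Linf_norm 0 T v" by (rule AE_reflect[OF Linf_AE(1)[OF vL T]])
    show n: "0 \<le> Linf_norm 0 T v" by (rule Linf_AE(2)[OF vL T])
    show "(\<integral>t. v (T - t) \<bullet> obs w t \<partial>leb 0 T) = y \<bullet> w" if "w \<in> Ds" for w
      using reach_inner(2)[OF T Lp_two_bounded(1)[OF T sm b n] that] yv by (simp add: yhat_reach)
  qed
  define w0 where "w0 t = v0 (T - t)" for t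
  have w0: "M \<le> (\<integral>t. w0 t \<bullet> F t \<partial>leb 0 T)"
  proof (rule local_convergence_integral_le[OF T z(1,2) F Fi F_1 lim])
    show "strongly_measurable (leb 0 T) w0" unfolding w0_def by (rule ctrl(1)[OF adm0])
    show "AE t in leb 0 T. norm (w0 t) \<le> Linf_norm 0 T v0" unfolding w0_def by (rule ctrl(2)[OF adm0])
    show "0 \<le> Linf_norm 0 T v0" by (rule ctrl(3)[OF adm0])
    show "\<exists>d>0. d < T \<and> (AE t in leb 0 d. norm (w0 t) \<le> \<eta>)" if "0 < \<eta>" for \<eta>
      unfolding w0_def by (rule vanishing_near_end[OF T v0(1,2) that])
    show "M - 1 / real (Suc n) \<le> (\<integral>t. w0 t \<bullet> obs (z n) t \<partial>leb 0 T)" for n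
      unfolding w0_def ctrl(4)[OF adm0 z(1)] by (rule z(3))
  qed
  \<comment> \<open>All admissible controls give the same pairing <y, w> with an observation
    \<open>obs w\<close>, and F is an \<open>L\<^sup>1\<close> limit of such observations. The
    equality therefore extends to F, which is not itself assumed to be an observation.\<close>
  have same: "(\<integral>t. v (T - t) \<bullet> F t \<partial>leb 0 T) = (\<integral>t. w0 t \<bullet> F t \<partial>leb 0 T)" if v: "admissible_control D A S B T y v" for v
  proof -
    \<comment> \<open>Each of the two pairings with F is within its control norm times r of <y, w>,
      so K r bounds their difference.\<close>
    define K where "K = Linf_norm 0 T v + Linf_norm 0 T v0"
    have K: "0 \<le> K" using ctrl(3)[OF v] ctrl(3)[OF adm0] by (simp add: K_def)
    have "\<bar>(\<integral>t. v (T - t) \<bullet> F t \<partial>leb 0 T) - (\<integral>t. w0 t \<bullet> F t \<partial>leb 0 T)\<bar> \<le> 0 + e" if e: "0 < e" for e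
    proof -
      define r where "r = e / (K + 1)"
      have r: "0 < r" using e K by (simp add: r_def)
      obtain w where w: "w \<in> Ds" "(\<integral>t. norm (F t - obs w t) \<partial>leb 0 T) \<le> r" using approx[OF r] by blast
      have sm: "strongly_measurable (leb 0 T) (\<lambda>t. F t - obs w t)" by (intro strongly_measurable_diff F obs_sm w order_refl)
      have int: "integrable (leb 0 T) (\<lambda>t. norm (F t - obs w t))"
      proof (rule Bochner_Integration.integrable_bound)
        show "integrable (leb 0 T) (\<lambda>t. norm (F t) + norm (obs w t))" using Fi obs_norm_int[OF w(1) order_refl] by simp
        show "(\<lambda>t. norm (F t - obs w t)) \<in> borel_measurable (leb 0 T)" by (rule leb_norm_measurable[OF sm])
        show "AE t in leb 0 T. norm (norm (F t - obs w t)) \<le> norm (norm (F t) + norm (obs w t))"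
          by (intro AE_I2) (simp add: norm_triangle_ineq4)
      qed
      have one: "\<bar>(\<integral>t. u (T - t) \<bullet> F t \<partial>leb 0 T) - y \<bullet> w\<bar> \<le> Linf_norm 0 T u * r"
        if u: "admissible_control D A S B T y u" for u
      proof -
        have "(\<integral>t. u (T - t) \<bullet> (F t - obs w t) \<partial>leb 0 T) = (\<integral>t. u (T - t) \<bullet> F t \<partial>leb 0 T) - (\<integral>t. u (T - t) \<bullet> obs w t \<partial>leb 0 T)"
          unfolding inner_diff_right
          by (intro Bochner_Integration.integral_diff bounded_inner_integral(1)[OF T ctrl(1,2,3)[OF u]] F Fi
              obs_sm[OF w(1) order_refl] obs_norm_int[OF w(1) order_refl])
        moreover have "\<bar>\<integral>t. u (T - t) \<bullet> (F t - obs w t) \<partial>leb 0 T\<bar> \<le> Linf_norm 0 T u * (\<integral>t. norm (F t - obs w t) \<partial>leb 0 T)"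
          by (rule bounded_inner_integral(2)[OF T ctrl(1,2,3)[OF u] sm int])
        moreover have "\<dots> \<le> Linf_norm 0 T u * r" by (intro mult_left_mono w ctrl(3)[OF u])
        ultimately show ?thesis using ctrl(4)[OF u w(1)] by simp
      qed
      have "K * r \<le> e" using K e by (simp add: r_def divide_simps)
      moreover have "K * r = Linf_norm 0 T v * r + Linf_norm 0 T v0 * r" by (simp add: K_def distrib_right)
      ultimately show ?thesis using one[OF v] one[OF adm0] unfolding w0_def by linarith
    qed
    then have "\<bar>(\<integral>t. v (T - t) \<bullet> F t \<partial>leb 0 T) - (\<integral>t. w0 t \<bullet> F t \<partial>leb 0 T)\<bar> \<le> 0" by (rule field_le_epsilon)
    then show ?thesis by simp
  qed
  define f where "f t = F (T - t)" for t
  have fY: "f \<in> Y_T D A S B T" unfolding f_def by (rule Y_T_I[OF T F Fi approx])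
  have f0: "\<not> (AE t in leb 0 T. f t = 0)"
  proof
    assume "AE t in leb 0 T. f t = 0"
    then have "AE t in leb 0 T. f (T - t) = 0" by (rule AE_reflect)
    then have "AE t in leb 0 T. w0 t \<bullet> F t = 0" by eventually_elim (simp add: f_def)
    then have "(\<integral>t. w0 t \<bullet> F t \<partial>leb 0 T) = 0" by (rule integral_eq_zero_AE)
    then show False using w0 M by simp
  qed
  have "AE t in leb 0 T. v t \<bullet> f t \<in> (\<lambda>w. w \<bullet> f t) ` cball 0 M \<and> (\<forall>w\<in>cball 0 M. w \<bullet> f t \<le> v t \<bullet> f t)"
    if v: "minimal_norm_control D A S B T y v" for v
  proof -
    have adm: "admissible_control D A S B T y v" and vM: "Linf_norm 0 T v = M"
      using v by (auto simp: minimal_norm_control_def M_def)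
    have b: "AE t in leb 0 T. norm (v (T - t)) \<le> M" using ctrl(2)[OF adm] by (simp add: vM)
    have vi: "integrable (leb 0 T) (\<lambda>t. v (T - t) \<bullet> F t)"
      by (rule bounded_inner_integral(1)[OF T ctrl(1)[OF adm] b less_imp_le[OF M] F Fi])
    \<comment> \<open>The Cauchy-Schwarz defect. It is nonnegative because v has norm M, while its
      integral is at most M * 1 - M, so it vanishes almost everywhere.\<close>
    define g where "g t = M * norm (F t) - v (T - t) \<bullet> F t" for t
    have gi: "integrable (leb 0 T) g" unfolding g_def using vi Fi by simp
    have g0: "AE t in leb 0 T. 0 \<le> g t"
      using b
    proof eventually_elim
      case (elim t)
      have "v (T - t) \<bullet> F t \<le> norm (v (T - t)) * norm (F t)" by (rule norm_cauchy_schwarz)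
      also have "\<dots> \<le> M * norm (F t)" using elim by (intro mult_right_mono) auto
      finally show ?case by (simp add: g_def)
    qed
    have "(\<integral>t. g t \<partial>leb 0 T) = M * (\<integral>t. norm (F t) \<partial>leb 0 T) - (\<integral>t. v (T - t) \<bullet> F t \<partial>leb 0 T)"
      unfolding g_def using vi Fi by simp
    also have "\<dots> \<le> M * 1 - M"
      using mult_left_mono[OF F_1 less_imp_le[OF M]] w0 same[OF adm] by simp
    finally have "(\<integral>t. g t \<partial>leb 0 T) = 0" using integral_nonneg_AE[OF g0] by simp
    then have "AE t in leb 0 T. g t = 0" using integral_nonneg_eq_0_iff_AE[OF gi g0] by simp
    then have "AE t in leb 0 T. g t = 0 \<and> norm (v (T - t)) \<le> M" using b by eventually_elim simp
    then have "AE t in leb 0 T. g (T - t) = 0 \<and> norm (v (T - (T - t))) \<le> M" by (rule AE_reflect)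
    then show ?thesis
    proof eventually_elim
      case (elim t)
      have eq: "v t \<bullet> f t = M * norm (f t)" using elim by (simp add: g_def f_def)
      have "w \<bullet> f t \<le> v t \<bullet> f t" if "w \<in> cball 0 M" for w
      proof -
        have "w \<bullet> f t \<le> norm w * norm (f t)" by (rule norm_cauchy_schwarz)
        also have "\<dots> \<le> M * norm (f t)" using that by (intro mult_right_mono) auto
        finally show ?thesis by (simp add: eq)
      qed
      moreover have "v t \<in> cball 0 M" using elim by simp
      ultimately show ?case by blast
    qed
  qed
  then show ?thesis using fY f0 unfolding M_def by blast
qed

end

theorem theorem5p1:
  fixes D :: "'x::{real_inner, complete_space} set"
    and A :: "'x \<Rightarrow> 'x"
    and S :: "real \<Rightarrow> 'x \<Rightarrow> 'x"
    and B :: "'u::{real_inner, complete_space} \<Rightarrow> 'x \<Rightarrow> real"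
    and T :: real
  assumes "generates D A S"
    and "control_operator D A B"
    and "B \<noteq> (\<lambda>u z. 0)"
    and "admissible D A S B"
    and "\<exists>p0\<ge>2. \<forall>T' th. 0 < th \<and> th < T' \<longrightarrow> A_p D A S B p0 T' th \<subseteq> A_inf D A S B T' th"
    and "0 < T"
  shows "\<forall>yT \<in> reach0 D A S B T - {0}. \<exists>f \<in> Y_T D A S B T. \<not> (AE t in leb 0 T. f t = 0) \<and>
           (\<forall>v. minimal_norm_control D A S B T yT v \<longrightarrow>
             (AE t in leb 0 T.
                v t \<bullet> f t \<in> (\<lambda>w. w \<bullet> f t) ` cball 0 (reach_norm D A S B T yT) \<and>
                (\<forall>w\<in>cball 0 (reach_norm D A S B T yT). w \<bullet> f t \<le> v t \<bullet> f t)))"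
proof
  fix yT assume yT: "yT \<in> reach0 D A S B T - {0}"
  interpret control_system D A S B
    by unfold_locales (use assms in auto)
  obtain p where "null_controlled p" using assms(5) unfolding null_controlled_def by blast
  then show "\<exists>f \<in> Y_T D A S B T. \<not> (AE t in leb 0 T. f t = 0) \<and>
           (\<forall>v. minimal_norm_control D A S B T yT v \<longrightarrow>
             (AE t in leb 0 T.
                v t \<bullet> f t \<in> (\<lambda>w. w \<bullet> f t) ` cball 0 (reach_norm D A S B T yT) \<and>
                (\<forall>w\<in>cball 0 (reach_norm D A S B T yT). w \<bullet> f t \<le> v t \<bullet> f t)))"
    by (rule minimal_norm_maximum_principle) (use assms(6) yT in auto)
qed

end
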